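(* $\omega(n)=\omega(28-n)$ for every $n\in\{0,\ldots,28\}\setminus\{6,22\}$, and $\omega(6)+1=\omega(22)$.
   Context: A set of lines through the origin in a Euclidean space is equiangular if any two distinct lines of the set form the same angle. For a set $U$ of lines, $\langle U\rangle_{\mathbb R}$ is the smallest $\mathbb R$-linear subspace containing $U$. Two sets $U,U'$ of equiangular lines are equivalent if there is an $\mathbb R$-linear map $f:\langle U\rangle_{\mathbb R}\to\langle U'\rangle_{\mathbb R}$ preserving inner products with $f(U)=U'$. The empty set is regarded as the set of equiangular lines of cardinality $0$, and a single line counts as a set of equiangular lines (with any common angle). $\omega(n)$ is the number, up to equivalence, of sets of $n$ equiangular lines with common angle $\arccos(1/3)$ in dimension $7$, i.e. contained in $\mathbb R^7$. Equivalently, $\omega(n)$ is the number of switching classes of Seidel matrices $S$ of order $n$ (real symmetric matrices with zero diagonal and off-diagonal entries $\pm1$) with largest eigenvalue at most $3$ and $\operatorname{rank}(3I-S)\le 7$, where $S,S'$ are switching equivalent iff $P^\top SP=S'$ for a signed permutation matrix $P$ (for $n=0$ the empty matrix gives $\omega(0)=1$). *)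

theory Defs
  imports "HOL-Analysis.Analysis"
begin

definition is_line :: "'a::euclidean_space set \<Rightarrow> bool" where
  "is_line L \<longleftrightarrow> subspace L \<and> dim L = 1"

(* The value does not depend on the nonzero vectors chosen on the two lines. *)
definition lines_form_angle :: "real \<Rightarrow> 'a::euclidean_space set \<Rightarrow> 'a set \<Rightarrow> bool" where
  "lines_form_angle \<alpha> L M \<longleftrightarrow>
     (\<forall>x\<in>L - {0}. \<forall>y\<in>M - {0}. arccos (\<bar>x \<bullet> y\<bar> / (norm x * norm y)) = \<alpha>)"

(* Sets with at most one line are equiangular with every common angle. *)
definition equiangular :: "real \<Rightarrow> 'a::euclidean_space set set \<Rightarrow> bool" where
  "equiangular \<alpha> U \<longleftrightarrow> (\<forall>L\<in>U. is_line L) \<and> pairwise (lines_form_angle \<alpha>) U"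

(* The map is only required to be linear on the span of U; its values elsewhere are irrelevant. *)
definition lines_equivalent :: "'a::euclidean_space set set \<Rightarrow> 'b::euclidean_space set set \<Rightarrow> bool" where
  "lines_equivalent U U' \<longleftrightarrow>
     (\<exists>f. f \<in> span (\<Union>U) \<rightarrow> span (\<Union>U') \<and>
          (\<forall>x\<in>span (\<Union>U). \<forall>y\<in>span (\<Union>U). f (x + y) = f x + f y) \<and>
          (\<forall>c. \<forall>x\<in>span (\<Union>U). f (c *\<^sub>R x) = c *\<^sub>R f x) \<and>
          (\<forall>x\<in>span (\<Union>U). \<forall>y\<in>span (\<Union>U). f x \<bullet> f y = x \<bullet> y) \<and>
          (\<lambda>L. f ` L) ` U = U')"

definition equiangular_sets :: "nat \<Rightarrow> (real ^ 7) set set set" where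
  "equiangular_sets n = {U. equiangular (arccos (1/3)) U \<and> finite U \<and> card U = n}"

(* There are only finitely many classes for each n (finitely many Gram matrices up to signs),
   so card is the actual number of classes. *)
definition omega :: "nat \<Rightarrow> nat" where
  "omega n = card (equiangular_sets n //
     {(U, U'). U \<in> equiangular_sets n \<and> U' \<in> equiangular_sets n \<and> lines_equivalent U U'})"

end

theory Submission
  imports Defs
begin

text \<open>
  On every line choose the two vectors with x \<bullet> x = 3. A set of lines with common angle arccos (1/3)
  becomes a set V = -V in which all inner products are 1, -1, 3 or -3, and an equivalence of two sets of
  lines becomes an orthogonal map between the sets of vectors, because a map between sets of vectors that
  preserves all inner products extends to an orthogonal map (\<open>gram_extension\<close>).

  In R^7 there is a system of 28 lines, spanned by the vectors \<plusminus>e_i \<plusminus>e_j \<plusminus>e_k for the lines {i, j, k} of the Fano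
  plane; \<open>K56\<close> is its set of 56 vectors. Two facts make it universal. Every system in R^7 can be moved
  into \<open>K56\<close> by an orthogonal map (\<open>embed_line_system\<close>). Two congruent subsystems of \<open>K56\<close> are congruent
  under the symmetry group of \<open>K56\<close>, except possibly for six lines without a triad, that is, without
  three vectors whose mutual inner products are all -1 (\<open>isometric_subsets_of_K56\<close>). So for n \<noteq> 6 the
  number \<open>omega n\<close> counts the orbits of the symmetry group on the n-element subsets of the 28 lines, and
  complementation of subsets turns these orbits into the orbits on (28 - n)-element subsets.

  For n = 6 the orbits still correspond under complementation to those for n = 22, but two of them merge
  into one class. The triad-free systems of six lines are all congruent: up to signs all their inner
  products are 1. Inside \<open>K56\<close> they fall into two orbits, told apart by whether a seventh line of \<open>K56\<close>
  can be added without creating a triad. This accounts for the summand 1. (In the language of root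
  lattices, the two orbits are the two classes of sublattices A_7 of E_8.)

  The link between the two facts is an operation on systems: if x, y, z have mutual inner products -1,
  then -(x + y + z) has norm 3 again and can be added to the system. A system closed under this operation
  is mapped to itself by the reflection in x - y whenever x \<bullet> y = 1. Hence \<open>K56\<close>, which is closed, has
  a large reflection group. The extension theorem composes the given isometry with symmetries until it
  fixes as many vectors as possible and shows how little can then remain unfixed. The embedding theorem
  looks at the closure of a system from a tetrahedron x + y + z + w = 0 of vectors in it; a system without
  triads consists of at most seven lines and is determined by their number.
\<close>

section \<open>Reflections and Gram matrices\<close>

definition refl_along :: "'a::real_inner \<Rightarrow> 'a \<Rightarrow> 'a" where
  "refl_along u x = x - (2 * (x \<bullet> u) / (u \<bullet> u)) *\<^sub>R u"

lemma orthogonal_transformation_refl_along: "orthogonal_transformation (refl_along u)"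
proof (cases "u = 0")
  case True
  have "refl_along u = (\<lambda>x. x)" using True by (auto simp: refl_along_def)
  then show ?thesis by (simp add: orthogonal_transformation_def)
next
  case False
  then have u: "u \<bullet> u \<noteq> 0" by simp
  have "linear (refl_along u)"
    by (rule linearI)
       (simp_all add: refl_along_def algebra_simps inner_add_left add_divide_distrib)
  moreover have "refl_along u v \<bullet> refl_along u w = v \<bullet> w" for v w
  proof -
    define a b where "a = (v \<bullet> u) / (u \<bullet> u)" and "b = (w \<bullet> u) / (u \<bullet> u)"
    have a: "v \<bullet> u = a * (u \<bullet> u)" "w \<bullet> u = b * (u \<bullet> u)" using u by (auto simp: a_def b_def)
    have r: "refl_along u v = v - (2 * a) *\<^sub>R u" "refl_along u w = w - (2 * b) *\<^sub>R u"
      by (auto simp: refl_along_def a_def b_def)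
    show ?thesis
      unfolding r using a
      by (simp add: inner_diff_left inner_diff_right inner_commute[of u w] algebra_simps)
  qed
  ultimately show ?thesis by (simp add: orthogonal_transformation_def)
qed

lemma refl_along_fix: "x \<bullet> u = 0 \<Longrightarrow> refl_along u x = x"
  by (simp add: refl_along_def)

lemma refl_along_swap:
  assumes "x \<bullet> x = y \<bullet> y"
  shows "refl_along (x - y) x = y"
proof (cases "x = y")
  case False
  then have "(x - y) \<bullet> (x - y) \<noteq> 0" by simp
  moreover have "2 * (x \<bullet> (x - y)) = (x - y) \<bullet> (x - y)"
    using assms by (simp add: inner_diff_left inner_diff_right inner_commute[of y x])
  ultimately show ?thesis by (simp add: refl_along_def)
qed (simp add: refl_along_def)

lemma refl_along_uminus: "refl_along (- u) = refl_along u"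
  by (auto simp: refl_along_def)

lemma refl_along_swap2: "x \<bullet> x = y \<bullet> y \<Longrightarrow> refl_along (x - y) y = x"
  using refl_along_swap[of y x] refl_along_uminus[of "x - y"] by simp

lemma orthogonal_transformation_inner:
  "orthogonal_transformation f \<Longrightarrow> f x \<bullet> f y = x \<bullet> y"
  by (simp add: orthogonal_transformation_def)

lemma orthogonal_transformation_comp:
  "orthogonal_transformation f \<Longrightarrow> orthogonal_transformation g \<Longrightarrow> orthogonal_transformation (\<lambda>x. f (g x))"
  using orthogonal_transformation_compose[of f g] by (simp add: o_def)

lemma orthogonal_transformation_minus:
  "orthogonal_transformation f \<Longrightarrow> f (- x) = - f x"
  by (simp add: orthogonal_transformation_def linear_neg)

text \<open>
  One vector after the other is put into place: once f sends x_i to y_i for all i in I, the reflection in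
  f x_k - y_k moves f x_k to y_k and fixes every y_i, since y_i is orthogonal to f x_k - y_k.
\<close>

lemma gram_extension:
  fixes x y :: "'i \<Rightarrow> 'a::real_inner"
  assumes "finite I" and "\<And>i j. i \<in> I \<Longrightarrow> j \<in> I \<Longrightarrow> x i \<bullet> x j = y i \<bullet> y j"
  obtains f where "orthogonal_transformation f" and "\<And>i. i \<in> I \<Longrightarrow> f (x i) = y i"
proof -
  have "\<exists>f. orthogonal_transformation f \<and> (\<forall>i\<in>I. f (x i) = y i)"
    using assms
  proof (induction I rule: finite_induct)
    case empty
    show ?case by (intro exI[of _ "\<lambda>x. x"]) simp
  next
    case (insert k I)
    obtain f where f: "orthogonal_transformation f" "\<forall>i\<in>I. f (x i) = y i"
      using insert by auto
    let ?r = "refl_along (f (x k) - y k)"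
    have nk: "f (x k) \<bullet> f (x k) = y k \<bullet> y k"
      using f insert.prems[of k k] by (simp add: orthogonal_transformation_def)
    have "?r (f (x k)) = y k" using nk by (rule refl_along_swap)
    moreover have "?r (f (x i)) = y i" if "i \<in> I" for i
    proof -
      have "y i \<bullet> f (x k) = y i \<bullet> y k"
        using f insert.prems[of i k] that by (metis insertCI orthogonal_transformation_def)
      then show ?thesis using f(2) that by (simp add: refl_along_fix inner_diff_right)
    qed
    ultimately show ?case
      using orthogonal_transformation_comp[OF orthogonal_transformation_refl_along f(1)]
      by (intro exI[of _ "\<lambda>z. ?r (f z)"]) auto
  qed
  with that show ?thesis by blast
qed

section \<open>Systems of vectors on equiangular lines\<close>

definition line_system :: "'a::real_inner set \<Rightarrow> bool" where
  "line_system V \<longleftrightarrow> (\<forall>x\<in>V. - x \<in> V \<and> x \<bullet> x = 3 \<and> (\<forall>y\<in>V. x \<bullet> y \<in> {1, -1, 3, -3}))"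

definition triad_closed :: "'a::real_inner set \<Rightarrow> bool" where
  "triad_closed V \<longleftrightarrow> (\<forall>x\<in>V. \<forall>y\<in>V. \<forall>z\<in>V.
     x \<bullet> y = -1 \<longrightarrow> x \<bullet> z = -1 \<longrightarrow> y \<bullet> z = -1 \<longrightarrow> - (x + y + z) \<in> V)"

definition has_triad :: "'a::real_inner set \<Rightarrow> bool" where
  "has_triad V \<longleftrightarrow> (\<exists>x\<in>V. \<exists>y\<in>V. \<exists>z\<in>V. x \<bullet> y = -1 \<and> x \<bullet> z = -1 \<and> y \<bullet> z = -1)"

lemma line_systemD:
  assumes "line_system V" "x \<in> V"
  shows "- x \<in> V" "x \<bullet> x = 3" "y \<in> V \<Longrightarrow> x \<bullet> y = 1 \<or> x \<bullet> y = -1 \<or> x \<bullet> y = 3 \<or> x \<bullet> y = -3"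
  using assms by (auto simp: line_system_def)

lemma triad_closedD:
  "triad_closed V \<Longrightarrow> x \<in> V \<Longrightarrow> y \<in> V \<Longrightarrow> z \<in> V \<Longrightarrow>
     x \<bullet> y = -1 \<Longrightarrow> x \<bullet> z = -1 \<Longrightarrow> y \<bullet> z = -1 \<Longrightarrow> - (x + y + z) \<in> V"
  by (auto simp: triad_closed_def)

lemma norm3_eq:
  fixes x y :: "'a::real_inner"
  assumes "x \<bullet> x = 3" "y \<bullet> y = 3"
  shows "x \<bullet> y = 3 \<longleftrightarrow> x = y" "x \<bullet> y = -3 \<longleftrightarrow> x = - y" "\<bar>x \<bullet> y\<bar> \<le> 3"
proof -
  have 1: "(x - y) \<bullet> (x - y) = 6 - 2 * (x \<bullet> y)" "(x + y) \<bullet> (x + y) = 6 + 2 * (x \<bullet> y)"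
    using assms by (auto simp: inner_diff_left inner_diff_right inner_add_left inner_add_right inner_commute[of y x])
  show "x \<bullet> y = 3 \<longleftrightarrow> x = y"
  proof
    assume "x \<bullet> y = 3"
    then have "(x - y) \<bullet> (x - y) = 0" using 1 by simp
    then show "x = y" by simp
  qed (use assms in auto)
  show "x \<bullet> y = -3 \<longleftrightarrow> x = - y"
  proof
    assume "x \<bullet> y = -3"
    then have "(x + y) \<bullet> (x + y) = 0" using 1 by simp
    then show "x = - y" by (simp add: eq_neg_iff_add_eq_0)
  qed (use assms in auto)
  show "\<bar>x \<bullet> y\<bar> \<le> 3" using 1 inner_ge_zero[of "x - y"] inner_ge_zero[of "x + y"] by linarith
qed

text \<open>
  Closing a system under the fourth vector of a triad keeps it a system: the inner product of the new
  vector with an old one is a sum of three odd integers, and its absolute value is at most 3 by the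
  Cauchy-Schwarz inequality.
\<close>

inductive_set triad_closure :: "'a::real_inner set \<Rightarrow> 'a set" for V where
  base: "x \<in> V \<Longrightarrow> x \<in> triad_closure V"
| step: "x \<in> triad_closure V \<Longrightarrow> y \<in> triad_closure V \<Longrightarrow> z \<in> triad_closure V \<Longrightarrow>
    x \<bullet> y = -1 \<Longrightarrow> x \<bullet> z = -1 \<Longrightarrow> y \<bullet> z = -1 \<Longrightarrow> - (x + y + z) \<in> triad_closure V"

lemma triad_fourth_norm:
  fixes x y z :: "'a::real_inner"
  assumes "x \<bullet> x = 3" "y \<bullet> y = 3" "z \<bullet> z = 3" "x \<bullet> y = -1" "x \<bullet> z = -1" "y \<bullet> z = -1"
  shows "(- (x + y + z)) \<bullet> (- (x + y + z)) = 3"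
  using assms by (simp add: inner_diff_left inner_diff_right inner_commute)

lemma triad_closure_inner:
  assumes "line_system V" "w \<bullet> w = 3" "\<And>v. v \<in> V \<Longrightarrow> w \<bullet> v \<in> {1, -1, 3, -3}"
    and "x \<in> triad_closure V"
  shows "x \<bullet> x = 3 \<and> w \<bullet> x \<in> {1, -1, 3, -3}"
  using assms(4)
proof induction
  case (base x)
  then show ?case using assms by (auto simp: line_system_def)
next
  case (step x y z)
  let ?u = "- (x + y + z)"
  have u: "?u \<bullet> ?u = 3" using step by (intro triad_fourth_norm) auto
  have "\<bar>w \<bullet> ?u\<bar> \<le> 3" using norm3_eq(3)[OF assms(2) u] .
  moreover have "w \<bullet> ?u = - (w \<bullet> x) - (w \<bullet> y) - (w \<bullet> z)" by (simp add: inner_diff_right)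
  ultimately have "w \<bullet> ?u \<in> {1, -1, 3, -3}" using step.IH by (elim conjE insertE emptyE) auto
  with u show ?case by blast
qed

lemma line_system_triad_closure:
  assumes V: "line_system V"
  shows "line_system (triad_closure V)"
proof -
  have neg: "- x \<in> triad_closure V" if "x \<in> triad_closure V" for x
    using that
  proof induction
    case (step x y z)
    then have "- (- x + - y + - z) \<in> triad_closure V" by (intro triad_closure.step) auto
    then show ?case by (simp add: algebra_simps)
  qed (use V in \<open>auto simp: line_system_def intro: triad_closure.base\<close>)
  have norm: "x \<bullet> x = 3" if "x \<in> triad_closure V" for x
    using that
  proof induction
    case (step x y z)
    then show ?case by (intro triad_fourth_norm) auto
  qed (use V in \<open>auto simp: line_system_def\<close>)
  have 1: "v \<bullet> x \<in> {1, -1, 3, -3}" if "x \<in> triad_closure V" "v \<in> V" for x v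
    using triad_closure_inner[OF V _ _ that(1), of v] V that(2) by (auto simp: line_system_def)
  have 2: "x \<bullet> y \<in> {1, -1, 3, -3}" if "x \<in> triad_closure V" "y \<in> triad_closure V" for x y
    using triad_closure_inner[OF V norm[OF that(1)] _ that(2)] 1[OF that(1)] by (simp add: inner_commute)
  show ?thesis using neg norm 2 by (auto simp: line_system_def)
qed

lemma triad_closed_triad_closure: "triad_closed (triad_closure V)"
  unfolding triad_closed_def by (blast intro: triad_closure.step)

lemma line_system_image:
  assumes "orthogonal_transformation f" "line_system V"
  shows "line_system (f ` V)"
proof -
  have 1: "- f x = f (- x)" for x using assms(1) by (simp add: orthogonal_transformation_minus)
  have 2: "f x \<bullet> f y = x \<bullet> y" for x y using assms(1) by (rule orthogonal_transformation_inner)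
  show ?thesis
    using assms(2) unfolding line_system_def ball_simps 1 2 by blast
qed

lemma triad_closed_image:
  assumes f: "orthogonal_transformation f" and V: "triad_closed V"
  shows "triad_closed (f ` V)"
  unfolding triad_closed_def
proof (intro ballI impI)
  fix x' y' z' assume "x' \<in> f ` V" "y' \<in> f ` V" "z' \<in> f ` V"
    and i: "x' \<bullet> y' = -1" "x' \<bullet> z' = -1" "y' \<bullet> z' = -1"
  then obtain x y z where x: "x' = f x" "y' = f y" "z' = f z" "x \<in> V" "y \<in> V" "z \<in> V" by blast
  have "- (x + y + z) \<in> V"
    by (rule triad_closedD[OF V x(4-6)]) (use i x f in \<open>auto simp: orthogonal_transformation_inner\<close>)
  moreover have "f (- (x + y + z)) = - (x' + y' + z')"
    using orthogonal_transformation_linear[OF f] x(1-3) by (simp add: linear_diff linear_neg)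
  ultimately show "- (x' + y' + z') \<in> f ` V" by (metis imageI)
qed

text \<open>
  If k \<bullet> x = k \<bullet> y, then k is fixed. If k \<bullet> x = 1 and k \<bullet> y = -1, then the image k - x + y is the
  fourth vector for the triad x, -y, -k. The vectors \<plusminus>x and \<plusminus>y are swapped.
\<close>

lemma refl_preserves_closed_system:
  assumes V: "line_system V" "triad_closed V" and xy: "x \<in> V" "y \<in> V" "x \<bullet> y = 1" and k: "k \<in> V"
  shows "refl_along (x - y) k \<in> V"
proof -
  note l = line_systemD[OF V(1)]
  have n: "(x - y) \<bullet> (x - y) = 4" using l(2) xy
    by (simp add: inner_diff_left inner_diff_right inner_commute[of y x])
  have r: "refl_along (x - y) k = k - ((k \<bullet> x - k \<bullet> y) / 2) *\<^sub>R (x - y)"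
    using n by (simp add: refl_along_def inner_diff_right)
  have kx: "k \<bullet> x = 1 \<or> k \<bullet> x = -1 \<or> k = x \<or> k = - x"
    using l(3)[OF k xy(1)] norm3_eq[OF l(2)[OF k] l(2)[OF xy(1)]] by blast
  have ky: "k \<bullet> y = 1 \<or> k \<bullet> y = -1 \<or> k = y \<or> k = - y"
    using l(3)[OF k xy(2)] norm3_eq[OF l(2)[OF k] l(2)[OF xy(2)]] by blast
  consider "k \<bullet> x = k \<bullet> y" | "k = x" | "k = y" | "k = - x" | "k = - y"
    | "k \<bullet> x = 1" "k \<bullet> y = -1" | "k \<bullet> x = -1" "k \<bullet> y = 1"
    using kx ky by auto
  then show ?thesis
  proof cases
    case 1 then show ?thesis using r k by simp
  next
    case 2 then show ?thesis using r xy l(2) by (simp add: inner_commute)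
  next
    case 3 then show ?thesis using r xy l(2) by (simp add: inner_commute)
  next
    case 4 then show ?thesis using r xy l by (simp add: inner_commute algebra_simps)
  next
    case 5 then show ?thesis using r xy l by (simp add: inner_commute algebra_simps)
  next
    case 6
    have "- (x + (- y) + (- k)) \<in> V"
      by (rule triad_closedD[OF V(2)]) (use 6 xy k l(1) in \<open>auto simp: inner_commute\<close>)
    moreover have "refl_along (x - y) k = - (x + (- y) + (- k))" using r 6 by simp
    ultimately show ?thesis by metis
  next
    case 7
    have "- (y + (- x) + (- k)) \<in> V"
      by (rule triad_closedD[OF V(2)]) (use 7 xy k l(1) in \<open>auto simp: inner_commute\<close>)
    moreover have "refl_along (x - y) k = - (y + (- x) + (- k))" using r 7 by simp
    ultimately show ?thesis by metis
  qed
qed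

section \<open>The 56 vectors of the Fano plane\<close>

text \<open>
  The seven coordinates are called a, b, c, p, q, r, s and stand for the points of the Fano plane with
  lines abc, apq, ars, bpr, bqs, cps, cqr.
\<close>

definition vec7 :: "real \<Rightarrow> real \<Rightarrow> real \<Rightarrow> real \<Rightarrow> real \<Rightarrow> real \<Rightarrow> real \<Rightarrow> real ^ 7" where
  "vec7 a b c p q r s = (\<chi> i. if i = 0 then a else if i = 1 then b else if i = 2 then c
     else if i = 3 then p else if i = 4 then q else if i = 5 then r else s)"

lemma UNIV_7: "(UNIV :: 7 set) = {0, 1, 2, 3, 4, 5, 6}"
proof -
  have "card {0, 1, 2, 3, 4, 5, 6 :: 7} = CARD(7)" by simp
  then show ?thesis by (metis card_subset_eq finite top_greatest)
qed

lemma distinct_7: "distinct [0, 1, 2, 3, 4, 5, 6 :: 7]"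
  by simp

lemma sum_7: "sum f (UNIV :: 7 set) = f 0 + f 1 + f 2 + f 3 + f 4 + f 5 + f 6"
proof -
  have "sum f (UNIV :: 7 set) = sum_list (map f [0, 1, 2, 3, 4, 5, 6])"
    unfolding sum_list_distinct_conv_sum_set[OF distinct_7] UNIV_7 by simp
  then show ?thesis by (simp add: add.assoc)
qed

lemma vec7_nth [simp]:
  "vec7 a b c p q r s $ 0 = a" "vec7 a b c p q r s $ 1 = b" "vec7 a b c p q r s $ 2 = c"
  "vec7 a b c p q r s $ 3 = p" "vec7 a b c p q r s $ 4 = q" "vec7 a b c p q r s $ 5 = r"
  "vec7 a b c p q r s $ 6 = s"
  by (simp_all add: vec7_def)

lemma inner_vec7 [simp]:
  "vec7 a b c p q r s \<bullet> vec7 a' b' c' p' q' r' s' =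
   a * a' + b * b' + c * c' + p * p' + q * q' + r * r' + s * s'"
  by (simp only: inner_vec_def sum_7 vec7_nth inner_real_def)

lemma vec7_eq_iff [simp]:
  "vec7 a b c p q r s = vec7 a' b' c' p' q' r' s' \<longleftrightarrow>
   a = a' \<and> b = b' \<and> c = c' \<and> p = p' \<and> q = q' \<and> r = r' \<and> s = s'"
proof
  assume e: "vec7 a b c p q r s = vec7 a' b' c' p' q' r' s'"
  have "vec7 a b c p q r s $ i = vec7 a' b' c' p' q' r' s' $ i" for i using e by simp
  from this[of 0] this[of 1] this[of 2] this[of 3] this[of 4] this[of 5] this[of 6]
  show "a = a' \<and> b = b' \<and> c = c' \<and> p = p' \<and> q = q' \<and> r = r' \<and> s = s'"
    by (simp only: vec7_nth simp_thms)
qed simp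

lemma vec7_cases:
  obtains a b c p q r s where "x = vec7 a b c p q r s"
proof
  show "x = vec7 (x $ 0) (x $ 1) (x $ 2) (x $ 3) (x $ 4) (x $ 5) (x $ 6)"
    unfolding vec_eq_iff
  proof
    fix i :: 7
    have "i \<in> {0, 1, 2, 3, 4, 5, 6}" using UNIV_7 by blast
    then show "x $ i = vec7 (x $ 0) (x $ 1) (x $ 2) (x $ 3) (x $ 4) (x $ 5) (x $ 6) $ i"
      by (elim insertE emptyE) (simp_all only: vec7_nth)
  qed
qed

lemma vec7_arith [simp]:
  "vec7 a b c p q r s + vec7 a' b' c' p' q' r' s' = vec7 (a+a') (b+b') (c+c') (p+p') (q+q') (r+r') (s+s')"
  "vec7 a b c p q r s - vec7 a' b' c' p' q' r' s' = vec7 (a-a') (b-b') (c-c') (p-p') (q-q') (r-r') (s-s')"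
  "- vec7 a b c p q r s = vec7 (-a) (-b) (-c) (-p) (-q) (-r) (-s)"
  "k *\<^sub>R vec7 a b c p q r s = vec7 (k * a) (k * b) (k * c) (k * p) (k * q) (k * r) (k * s)"
  by (auto simp: vec7_def vec_eq_iff)

text \<open>
  The parity conditions say that the vector reduces modulo 2 to a word of the Hamming code spanned by the
  lines of the Fano plane; each condition is attached to the complement of a line. The words of weight 3
  are the lines themselves, so these are the vectors with entries \<plusminus>1 on one line and 0 elsewhere
  (\<open>K56_cases\<close>, \<open>K56_intros\<close>). The conditions are additive, which makes closure under triads immediate.
\<close>

definition K56 :: "(real ^ 7) set" where
  "K56 = {vec7 (of_int a) (of_int b) (of_int c) (of_int p) (of_int q) (of_int r) (of_int s) | a b c p q r s.
     a*a + b*b + c*c + p*p + q*q + r*r + s * s = 3 \<and>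
     even (p + q + r + s) \<and> even (b + c + r + s) \<and> even (a + c + q + s)}"

lemma int_square_le_3:
  fixes t :: int
  assumes "t * t \<le> 3"
  shows "t * t = (if even t then 0 else 1)" "even t \<Longrightarrow> t = 0" "odd t \<Longrightarrow> \<bar>t\<bar> = 1"
proof -
  have "\<bar>t\<bar> < 2"
  proof (rule ccontr)
    assume "\<not> \<bar>t\<bar> < 2"
    then have "2 * 2 \<le> \<bar>t\<bar> * \<bar>t\<bar>" by (intro mult_mono) auto
    with assms show False by simp
  qed
  then have "t = 0 \<or> t = 1 \<or> t = -1" by linarith
  then show "t * t = (if even t then 0 else 1)" "even t \<Longrightarrow> t = 0" "odd t \<Longrightarrow> \<bar>t\<bar> = 1" by auto
qed

text \<open>
  Modulo 2 the coordinates c, q, r, s determine the others; with the norm condition only the seven words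
  of weight 3 are left.
\<close>

lemma fano_parity:
  fixes a b c p q r s :: int
  assumes n: "a*a + b*b + c*c + p*p + q*q + r*r + s * s = 3"
    and e: "even (p + q + r + s)" "even (b + c + r + s)" "even (a + c + q + s)"
  shows "a*a \<le> 3" "b*b \<le> 3" "c*c \<le> 3" "p*p \<le> 3" "q*q \<le> 3" "r*r \<le> 3" "s * s \<le> 3"
    and "odd a \<and> odd b \<and> odd c \<and> even p \<and> even q \<and> even r \<and> even s
    \<or> odd a \<and> odd p \<and> odd q \<and> even b \<and> even c \<and> even r \<and> even s
    \<or> odd a \<and> odd r \<and> odd s \<and> even b \<and> even c \<and> even p \<and> even q
    \<or> odd b \<and> odd p \<and> odd r \<and> even a \<and> even c \<and> even q \<and> even s
    \<or> odd b \<and> odd q \<and> odd s \<and> even a \<and> even c \<and> even p \<and> even r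
    \<or> odd c \<and> odd p \<and> odd s \<and> even a \<and> even b \<and> even q \<and> even r
    \<or> odd c \<and> odd q \<and> odd r \<and> even a \<and> even b \<and> even p \<and> even s"
proof -
  have nn: "0 \<le> t * t" for t :: int by simp
  note le = nn[of a] nn[of b] nn[of c] nn[of p] nn[of q] nn[of r] nn[of s]
  show b: "a*a \<le> 3" "b*b \<le> 3" "c*c \<le> 3" "p*p \<le> 3" "q*q \<le> 3" "r*r \<le> 3" "s * s \<le> 3"
    using n le by linarith+
  define u where "u t = (if even t then 0 else 1 :: int)" for t :: int
  have u: "t * t = u t" if "t * t \<le> 3" for t
    using int_square_le_3(1)[OF that] by (simp only: u_def)
  have n': "u a + u b + u c + u p + u q + u r + u s = 3"
    using n u[OF b(1)] u[OF b(2)] u[OF b(3)] u[OF b(4)] u[OF b(5)] u[OF b(6)] u[OF b(7)]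
    by linarith
  show "odd a \<and> odd b \<and> odd c \<and> even p \<and> even q \<and> even r \<and> even s
    \<or> odd a \<and> odd p \<and> odd q \<and> even b \<and> even c \<and> even r \<and> even s
    \<or> odd a \<and> odd r \<and> odd s \<and> even b \<and> even c \<and> even p \<and> even q
    \<or> odd b \<and> odd p \<and> odd r \<and> even a \<and> even c \<and> even q \<and> even s
    \<or> odd b \<and> odd q \<and> odd s \<and> even a \<and> even c \<and> even p \<and> even r
    \<or> odd c \<and> odd p \<and> odd s \<and> even a \<and> even b \<and> even q \<and> even r
    \<or> odd c \<and> odd q \<and> odd r \<and> even a \<and> even b \<and> even p \<and> even s"
    using n' e unfolding u_def even_add
    by (cases "even a"; cases "even b"; cases "even c"; cases "even p"; cases "even q"; cases "even r"; simp)
qed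

lemma K56_cases:
  assumes "x \<in> K56"
  obtains (abc) a b c where "x = vec7 a b c 0 0 0 0" "\<bar>a\<bar> = 1" "\<bar>b\<bar> = 1" "\<bar>c\<bar> = 1"
    | (apq) a p q where "x = vec7 a 0 0 p q 0 0" "\<bar>a\<bar> = 1" "\<bar>p\<bar> = 1" "\<bar>q\<bar> = 1"
    | (ars) a r s where "x = vec7 a 0 0 0 0 r s" "\<bar>a\<bar> = 1" "\<bar>r\<bar> = 1" "\<bar>s\<bar> = 1"
    | (bpr) b p r where "x = vec7 0 b 0 p 0 r 0" "\<bar>b\<bar> = 1" "\<bar>p\<bar> = 1" "\<bar>r\<bar> = 1"
    | (bqs) b q s where "x = vec7 0 b 0 0 q 0 s" "\<bar>b\<bar> = 1" "\<bar>q\<bar> = 1" "\<bar>s\<bar> = 1"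
    | (cps) c p s where "x = vec7 0 0 c p 0 0 s" "\<bar>c\<bar> = 1" "\<bar>p\<bar> = 1" "\<bar>s\<bar> = 1"
    | (cqr) c q r where "x = vec7 0 0 c 0 q r 0" "\<bar>c\<bar> = 1" "\<bar>q\<bar> = 1" "\<bar>r\<bar> = 1"
proof -
  obtain a b c p q r s :: int where x: "x = vec7 (of_int a) (of_int b) (of_int c) (of_int p) (of_int q) (of_int r) (of_int s)"
    and n: "a*a + b*b + c*c + p*p + q*q + r*r + s * s = 3"
    and e: "even (p + q + r + s)" "even (b + c + r + s)" "even (a + c + q + s)"
    using assms unfolding K56_def mem_Collect_eq by (elim exE conjE) (rule that)
  note b = fano_parity(1-7)[OF n e] and ab = fano_parity(8)[OF n e]
  note u = int_square_le_3
  have r: "\<bar>real_of_int t\<bar> = 1 \<longleftrightarrow> \<bar>t\<bar> = 1" for t by linarith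
  have z: "even a \<Longrightarrow> a = 0" "even b \<Longrightarrow> b = 0" "even c \<Longrightarrow> c = 0" "even p \<Longrightarrow> p = 0"
    "even q \<Longrightarrow> q = 0" "even r \<Longrightarrow> r = 0" "even s \<Longrightarrow> s = 0" using u(2) b by blast+
  have o1: "odd a \<Longrightarrow> \<bar>a\<bar> = 1" "odd b \<Longrightarrow> \<bar>b\<bar> = 1" "odd c \<Longrightarrow> \<bar>c\<bar> = 1" "odd p \<Longrightarrow> \<bar>p\<bar> = 1"
    "odd q \<Longrightarrow> \<bar>q\<bar> = 1" "odd r \<Longrightarrow> \<bar>r\<bar> = 1" "odd s \<Longrightarrow> \<bar>s\<bar> = 1" using u(3) b by blast+
  from ab show thesis
  proof (elim disjE conjE)
    assume "odd a" "odd b" "odd c" "even p" "even q" "even r" "even s"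
    then have "\<bar>real_of_int a\<bar> = 1 \<and> \<bar>real_of_int b\<bar> = 1 \<and> \<bar>real_of_int c\<bar> = 1 \<and> p = 0 \<and> q = 0 \<and> r = 0 \<and> s = 0"
      unfolding r using o1 z by blast
    then show thesis using abc[of "of_int a" "of_int b" "of_int c"] x by simp
  next
    assume "odd a" "odd p" "odd q" "even b" "even c" "even r" "even s"
    then have "\<bar>real_of_int a\<bar> = 1 \<and> \<bar>real_of_int p\<bar> = 1 \<and> \<bar>real_of_int q\<bar> = 1 \<and> b = 0 \<and> c = 0 \<and> r = 0 \<and> s = 0"
      unfolding r using o1 z by blast
    then show thesis using apq[of "of_int a" "of_int p" "of_int q"] x by simp
  next
    assume "odd a" "odd r" "odd s" "even b" "even c" "even p" "even q"
    then have "\<bar>real_of_int a\<bar> = 1 \<and> \<bar>real_of_int r\<bar> = 1 \<and> \<bar>real_of_int s\<bar> = 1 \<and> b = 0 \<and> c = 0 \<and> p = 0 \<and> q = 0"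
      unfolding r using o1 z by blast
    then show thesis using ars[of "of_int a" "of_int r" "of_int s"] x by simp
  next
    assume "odd b" "odd p" "odd r" "even a" "even c" "even q" "even s"
    then have "\<bar>real_of_int b\<bar> = 1 \<and> \<bar>real_of_int p\<bar> = 1 \<and> \<bar>real_of_int r\<bar> = 1 \<and> a = 0 \<and> c = 0 \<and> q = 0 \<and> s = 0"
      unfolding r using o1 z by blast
    then show thesis using bpr[of "of_int b" "of_int p" "of_int r"] x by simp
  next
    assume "odd b" "odd q" "odd s" "even a" "even c" "even p" "even r"
    then have "\<bar>real_of_int b\<bar> = 1 \<and> \<bar>real_of_int q\<bar> = 1 \<and> \<bar>real_of_int s\<bar> = 1 \<and> a = 0 \<and> c = 0 \<and> p = 0 \<and> r = 0"
      unfolding r using o1 z by blast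
    then show thesis using bqs[of "of_int b" "of_int q" "of_int s"] x by simp
  next
    assume "odd c" "odd p" "odd s" "even a" "even b" "even q" "even r"
    then have "\<bar>real_of_int c\<bar> = 1 \<and> \<bar>real_of_int p\<bar> = 1 \<and> \<bar>real_of_int s\<bar> = 1 \<and> a = 0 \<and> b = 0 \<and> q = 0 \<and> r = 0"
      unfolding r using o1 z by blast
    then show thesis using cps[of "of_int c" "of_int p" "of_int s"] x by simp
  next
    assume "odd c" "odd q" "odd r" "even a" "even b" "even p" "even s"
    then have "\<bar>real_of_int c\<bar> = 1 \<and> \<bar>real_of_int q\<bar> = 1 \<and> \<bar>real_of_int r\<bar> = 1 \<and> a = 0 \<and> b = 0 \<and> p = 0 \<and> s = 0"
      unfolding r using o1 z by blast
    then show thesis using cqr[of "of_int c" "of_int q" "of_int r"] x by simp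
  qed
qed

lemma K56_intros:
  assumes "\<bar>a\<bar> = 1" "\<bar>b\<bar> = 1" "\<bar>c\<bar> = 1"
  shows "vec7 a b c 0 0 0 0 \<in> K56" "vec7 a 0 0 b c 0 0 \<in> K56" "vec7 a 0 0 0 0 b c \<in> K56"
    "vec7 0 a 0 b 0 c 0 \<in> K56" "vec7 0 a 0 0 b 0 c \<in> K56" "vec7 0 0 a b 0 0 c \<in> K56" "vec7 0 0 a 0 b c 0 \<in> K56"
proof -
  have s: "\<exists>i::int. t = of_int i \<and> i * i = 1 \<and> odd i" if "\<bar>t\<bar> = 1" for t :: real
    using that by (intro exI[of _ "if t = 1 then 1 else -1"]) auto
  obtain i j k :: int where "a = of_int i" "b = of_int j" "c = of_int k" "i * i = 1" "j * j = 1" "k * k = 1" "odd i" "odd j" "odd k"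
    using assms s by metis
  note x = this
  have z: "(0::real) = of_int 0" by simp
  show "vec7 a b c 0 0 0 0 \<in> K56" "vec7 a 0 0 b c 0 0 \<in> K56" "vec7 a 0 0 0 0 b c \<in> K56"
    "vec7 0 a 0 b 0 c 0 \<in> K56" "vec7 0 a 0 0 b 0 c \<in> K56" "vec7 0 0 a b 0 0 c \<in> K56" "vec7 0 0 a 0 b c 0 \<in> K56"
    unfolding K56_def mem_Collect_eq x z vec7_eq_iff of_int_eq_iff using x by auto
qed

lemma K56_norm:
  assumes "x \<in> K56"
  shows "x \<bullet> x = 3"
proof -
  have "\<bar>t\<bar> = 1 \<Longrightarrow> t * t = 1" for t :: real by (metis abs_mult_self_eq mult_1)
  with assms show ?thesis by (elim K56_cases) simp_all
qed

lemma triad_closed_K56: "triad_closed K56"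
  unfolding triad_closed_def
proof (intro ballI impI)
  fix x y z assume x: "x \<in> K56" "y \<in> K56" "z \<in> K56" and i: "x \<bullet> y = -1" "x \<bullet> z = -1" "y \<bullet> z = -1"
  note n = K56_norm
  have 3: "(- (x + y + z)) \<bullet> (- (x + y + z)) = 3"
    by (rule triad_fourth_norm) (use n x i in auto)
  obtain a b c p q r s :: int where x': "x = vec7 (of_int a) (of_int b) (of_int c) (of_int p) (of_int q) (of_int r) (of_int s)"
     "even (p + q + r + s)" "even (b + c + r + s)" "even (a + c + q + s)"
    using x(1) unfolding K56_def mem_Collect_eq by (elim exE conjE) (rule that)
  obtain a' b' c' p' q' r' s' :: int where y': "y = vec7 (of_int a') (of_int b') (of_int c') (of_int p') (of_int q') (of_int r') (of_int s')"
     "even (p' + q' + r' + s')" "even (b' + c' + r' + s')" "even (a' + c' + q' + s')"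
    using x(2) unfolding K56_def mem_Collect_eq by (elim exE conjE) (rule that)
  obtain a'' b'' c'' p'' q'' r'' s'' :: int where z': "z = vec7 (of_int a'') (of_int b'') (of_int c'') (of_int p'') (of_int q'') (of_int r'') (of_int s'')"
     "even (p'' + q'' + r'' + s'')" "even (b'' + c'' + r'' + s'')" "even (a'' + c'' + q'' + s'')"
    using x(3) unfolding K56_def mem_Collect_eq by (elim exE conjE) (rule that)
  let ?A = "-(a+a'+a'')" let ?B = "-(b+b'+b'')" let ?C = "-(c+c'+c'')" let ?P = "-(p+p'+p'')"
  let ?Q = "-(q+q'+q'')" let ?R = "-(r+r'+r'')" let ?S = "-(s+s'+s'')"
  have sum4: "even (-(i+i'+i'') + -(j+j'+j'') + -(k+k'+k'') + -(l+l'+l''))"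
    if "even (i + j + k + l)" "even (i' + j' + k' + l')" "even (i'' + j'' + k'' + l'')"
    for i j k l i' j' k' l' i'' j'' k'' l'' :: int
  proof -
    have "-(i+i'+i'') + -(j+j'+j'') + -(k+k'+k'') + -(l+l'+l'') =
        - ((i + j + k + l) + (i' + j' + k' + l') + (i'' + j'' + k'' + l''))" by simp
    then show ?thesis using that by (metis dvd_add dvd_minus_iff)
  qed
  have u: "- (x + y + z) = vec7 (of_int ?A) (of_int ?B) (of_int ?C) (of_int ?P) (of_int ?Q) (of_int ?R) (of_int ?S)"
    by (simp add: x' y' z')
  have "real_of_int (?A*?A + ?B*?B + ?C*?C + ?P*?P + ?Q*?Q + ?R*?R + ?S*?S) = real_of_int 3"
    using 3 unfolding u inner_vec7 by simp
  then have "?A*?A + ?B*?B + ?C*?C + ?P*?P + ?Q*?Q + ?R*?R + ?S*?S = 3" by (simp only: of_int_eq_iff)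
  moreover have "even (?P + ?Q + ?R + ?S)" "even (?B + ?C + ?R + ?S)" "even (?A + ?C + ?Q + ?S)"
    by (rule sum4; fact)+
  ultimately show "- (x + y + z) \<in> K56" unfolding K56_def mem_Collect_eq u by blast
qed

lemma line_system_K56: "line_system K56"
  unfolding line_system_def
proof (intro ballI conjI)
  fix x assume x: "x \<in> K56"
  then show "- x \<in> K56" by (elim K56_cases) (auto intro: K56_intros)
  note n = K56_norm
  show "x \<bullet> x = 3" using n x .
  fix y assume y: "y \<in> K56"
  obtain a b c p q r s :: int where x': "x = vec7 (of_int a) (of_int b) (of_int c) (of_int p) (of_int q) (of_int r) (of_int s)"
     "a*a + b*b + c*c + p*p + q*q + r*r + s * s = 3" "even (p + q + r + s)" "even (b + c + r + s)" "even (a + c + q + s)"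
    using x unfolding K56_def mem_Collect_eq by (elim exE conjE) (rule that)
  obtain a' b' c' p' q' r' s' :: int where y': "y = vec7 (of_int a') (of_int b') (of_int c') (of_int p') (of_int q') (of_int r') (of_int s')"
     "a'*a' + b'*b' + c'*c' + p'*p' + q'*q' + r'*r' + s' * s' = 3" "even (p' + q' + r' + s')" "even (b' + c' + r' + s')" "even (a' + c' + q' + s')"
    using y unfolding K56_def mem_Collect_eq by (elim exE conjE) (rule that)
  let ?N = "a*a' + b*b' + c*c' + p*p' + q*q' + r*r' + s * s'"
  have "odd ?N"
    using fano_parity(8)[OF x'(2-5)] fano_parity(8)[OF y'(2-5)] unfolding even_add even_mult_iff
    by (elim disjE conjE; simp only: simp_thms)
  moreover have "x \<bullet> y = of_int ?N" using x' y' by simp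
  moreover have "\<bar>x \<bullet> y\<bar> \<le> 3" using norm3_eq(3)[OF n[OF x] n[OF y]] .
  ultimately have "odd ?N" "\<bar>?N\<bar> \<le> 3" by (blast, linarith)
  moreover have "N = 1 \<or> N = -1 \<or> N = 3 \<or> N = -3" if "odd N" "\<bar>N\<bar> \<le> 3" for N :: int
    using that by presburger
  ultimately have "?N = 1 \<or> ?N = -1 \<or> ?N = 3 \<or> ?N = -3" by blast
  then show "x \<bullet> y \<in> {1, -1, 3, -3}" using \<open>x \<bullet> y = of_int ?N\<close> by (elim disjE) (simp_all only:, simp_all)
qed

text \<open>
  Numbering the lines of the Fano plane and the signs gives 7 * 8 = 56 vectors.
\<close>

lemma fano_family:
  defines "F \<equiv> \<lambda>(j, a, b, c). if j = (0::nat) then vec7 a b c 0 0 0 0 else if j = 1 then vec7 a 0 0 b c 0 0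
    else if j = 2 then vec7 a 0 0 0 0 b c else if j = 3 then vec7 0 a 0 b 0 c 0
    else if j = 4 then vec7 0 a 0 0 b 0 c else if j = 5 then vec7 0 0 a b 0 0 c else vec7 0 0 a 0 b c 0"
    and "S \<equiv> {1, -1 :: real}"
  shows "K56 = F ` ({0, 1, 2, 3, 4, 5, 6} \<times> S \<times> S \<times> S)" "inj_on F ({0, 1, 2, 3, 4, 5, 6} \<times> S \<times> S \<times> S)"
proof -
  let ?D = "{0, 1, 2, 3, 4, 5, 6} \<times> S \<times> S \<times> S"
  have s: "\<bar>t\<bar> = 1 \<longleftrightarrow> t \<in> S" for t :: real by (auto simp: S_def)
  have i: "F (j, a, b, c) \<in> F ` ?D" if "j \<in> {0, 1, 2, 3, 4, 5, 6}" "\<bar>a\<bar> = 1" "\<bar>b\<bar> = 1" "\<bar>c\<bar> = 1" for j a b c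
    using that unfolding s by blast
  have f: "vec7 a b c 0 0 0 0 = F (0, a, b, c)" "vec7 a 0 0 b c 0 0 = F (1, a, b, c)"
    "vec7 a 0 0 0 0 b c = F (2, a, b, c)" "vec7 0 a 0 b 0 c 0 = F (3, a, b, c)"
    "vec7 0 a 0 0 b 0 c = F (4, a, b, c)" "vec7 0 0 a b 0 0 c = F (5, a, b, c)"
    "vec7 0 0 a 0 b c 0 = F (6, a, b, c)" for a b c
    by (simp_all add: F_def)
  show "K56 = F ` ?D"
  proof
    show "K56 \<subseteq> F ` ?D"
    proof
      fix x assume "x \<in> K56"
      then show "x \<in> F ` ?D"
        by (cases rule: K56_cases; hypsubst; subst f; intro i; simp)
    qed
    show "F ` ?D \<subseteq> K56"
      by (auto simp: F_def s[symmetric] intro!: K56_intros)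
  qed
  have nz: "t \<noteq> 0" if "t \<in> S" for t using that by (auto simp: S_def)
  show "inj_on F ?D"
  proof (rule inj_onI)
    fix u v assume d: "u \<in> ?D" "v \<in> ?D" and e: "F u = F v"
    obtain j a b c where u: "u = (j, a, b, c)" by (cases u)
    obtain j' a' b' c' where v: "v = (j', a', b', c')" by (cases v)
    have nn: "a \<noteq> 0" "b \<noteq> 0" "c \<noteq> 0" "a' \<noteq> 0" "b' \<noteq> 0" "c' \<noteq> 0" and
      j: "j = 0 \<or> j = 1 \<or> j = 2 \<or> j = 3 \<or> j = 4 \<or> j = 5 \<or> j = 6"
      "j' = 0 \<or> j' = 1 \<or> j' = 2 \<or> j' = 3 \<or> j' = 4 \<or> j' = 5 \<or> j' = 6"
      using d nz unfolding u v by simp_all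
    show "u = v"
      using j e[unfolded u v] unfolding u v
      by (elim disjE; simp only: f[symmetric]; insert nn; simp)
  qed
qed

lemma finite_K56: "finite K56"
  unfolding fano_family(1) by (intro finite_imageI) auto

lemma card_K56: "card K56 = 56"
  unfolding fano_family(1) card_image[OF fano_family(2)] by (simp add: card_cartesian_product)

section \<open>Symmetries and root frames\<close>

definition sym56 :: "(real ^ 7 \<Rightarrow> real ^ 7) set" where
  "sym56 = {f. orthogonal_transformation f \<and> f ` K56 = K56}"

lemma sym56D:
  assumes "f \<in> sym56"
  shows "orthogonal_transformation f" "f ` K56 = K56" "x \<in> K56 \<Longrightarrow> f x \<in> K56" "f x \<bullet> f y = x \<bullet> y" "f (- x) = - f x"
  using assms orthogonal_transformation_inner[of f x y] orthogonal_transformation_minus[of f x]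
  by (auto simp: sym56_def)

lemma sym56I:
  assumes f: "orthogonal_transformation f" and "\<And>x. x \<in> K56 \<Longrightarrow> f x \<in> K56"
  shows "f \<in> sym56"
proof -
  have "inj f" using f by (rule orthogonal_transformation_inj)
  then have "card (f ` K56) = card K56" by (meson card_image inj_on_subset subset_UNIV)
  then show ?thesis
    using assms finite_K56 card_subset_eq[of K56 "f ` K56"] by (auto simp: sym56_def)
qed

lemma sym56_id: "(\<lambda>x. x) \<in> sym56"
  by (rule sym56I) auto

lemma sym56_comp: "f \<in> sym56 \<Longrightarrow> g \<in> sym56 \<Longrightarrow> (\<lambda>x. f (g x)) \<in> sym56"
  by (rule sym56I) (auto intro: orthogonal_transformation_comp sym56D)

lemma sym56_minus: "(\<lambda>x. - x) \<in> sym56"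
  by (rule sym56I) (auto simp: orthogonal_transformation_def linear_uminus line_systemD(1)[OF line_system_K56])

lemma sym56_inv:
  assumes "f \<in> sym56"
  obtains g where "g \<in> sym56" "\<And>x. g (f x) = x" "\<And>x. f (g x) = x"
proof
  have f: "orthogonal_transformation f" using assms by (rule sym56D)
  note b = orthogonal_transformation_bij[OF f]
  show 1: "inv f (f x) = x" "f (inv f x) = x" for x
    using b by (auto simp: bij_is_inj bij_is_surj surj_f_inv_f)
  show "inv f \<in> sym56"
  proof (rule sym56I)
    show "orthogonal_transformation (inv f)" using f by (rule orthogonal_transformation_inv)
    fix x assume "x \<in> K56"
    then obtain y where "y \<in> K56" "x = f y" using assms by (auto simp: sym56_def)
    then show "inv f x \<in> K56" using 1 by simp
  qed
qed

lemma sym56_refl_along: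
  assumes "x \<in> K56" "y \<in> K56" "x \<bullet> y = 1"
  shows "refl_along (x - y) \<in> sym56"
  by (rule sym56I[OF orthogonal_transformation_refl_along])
     (rule refl_preserves_closed_system[OF line_system_K56 triad_closed_K56 assms])

text \<open>
  Two vectors of K56 with inner product 1 are swapped by a reflection, and -id settles the other inner
  products, so the group is transitive on vectors. For the second vectors, the difficult case is z \<bullet> u = -1
  for the image z and the target u: then z goes to u in two steps by way of a vector k that has inner
  product 1 with both, and both reflections fix the first vector.
\<close>

lemma sym56_transitive_pairs:
  assumes x: "x \<in> K56" and y: "y \<in> K56" and xy: "x \<bullet> y = -1"
  obtains f where "f \<in> sym56" "f x = vec7 1 1 1 0 0 0 0" "f y = vec7 1 (-1) (-1) 0 0 0 0"
proof -
  let ?t = "vec7 1 1 1 0 0 0 0" let ?u = "vec7 1 (-1) (-1) 0 0 0 0"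
  note K = line_systemD[OF line_system_K56]
  have t: "?t \<in> K56" "?u \<in> K56" by (auto intro!: K56_intros)
  have tu: "?t \<bullet> ?t = 3" "?u \<bullet> ?u = 3" by simp_all
  have "\<exists>f\<in>sym56. f x = ?t"
  proof -
    have refl: "\<exists>f\<in>sym56. f z = ?t" if "z \<in> K56" "z \<bullet> ?t = 1" for z
      using sym56_refl_along[OF that(1) t(1) that(2)] refl_along_swap[of z ?t] K(2)[OF that(1)] tu(1)
      by metis
    consider "x \<bullet> ?t = 1" | "x = ?t" | "x \<bullet> ?t = -1" | "x = - ?t"
      using K(3)[OF x t(1)] norm3_eq[OF K(2)[OF x] tu(1)] by blast
    then show ?thesis
    proof cases
      case 1 then show ?thesis using refl[OF x] by blast
    next
      case 2 then show ?thesis by (intro bexI[OF _ sym56_id]) simp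
    next
      case 3
      then obtain f where "f \<in> sym56" "f (- x) = ?t" using refl[OF K(1)[OF x]] by (metis inner_minus_left minus_minus)
      then show ?thesis by (intro bexI[OF _ sym56_comp[OF _ sym56_minus, of f]]) simp_all
    next
      case 4 then show ?thesis by (intro bexI[OF _ sym56_minus]) simp
    qed
  qed
  then obtain f where f: "f \<in> sym56" "f x = ?t" by blast
  define z where "z = f y"
  have z: "z \<in> K56" "z \<bullet> ?t = -1"
    using sym56D(3)[OF f(1) y] sym56D(4)[OF f(1), of y x] xy f(2) by (auto simp: z_def inner_commute)
  have r: "refl_along (v - w) \<in> sym56 \<and> refl_along (v - w) v = w \<and> refl_along (v - w) ?t = ?t"
    if "v \<in> K56" "w \<in> K56" "v \<bullet> w = 1" "v \<bullet> ?t = -1" "w \<bullet> ?t = -1" for v w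
    using sym56_refl_along[OF that(1-3)] refl_along_swap[of v w] K(2)[OF that(1)] K(2)[OF that(2)]
      refl_along_fix[of ?t "v - w"] that(4,5) by (simp add: inner_commute inner_diff_left inner_diff_right del: vec7_arith inner_vec7)
  have "\<exists>g\<in>sym56. g ?t = ?t \<and> g z = ?u"
  proof (cases "\<exists>k\<in>K56. k \<bullet> ?t = -1 \<and> k \<bullet> ?u = 1 \<and> k \<bullet> z = 1")
    case True
    then obtain k where k: "k \<in> K56" "k \<bullet> ?t = -1" "k \<bullet> ?u = 1" "k \<bullet> z = 1" by blast
    have "?u \<bullet> ?t = -1" by simp
    then show ?thesis
      using r[OF z(1) k(1) _ z(2) k(2)] r[OF k(1) t(2) k(3) k(2)] k(4)
      by (intro bexI[of _ "\<lambda>x. refl_along (k - ?u) (refl_along (z - k) x)"]) (auto intro: sym56_comp simp: inner_commute simp del: vec7_arith inner_vec7)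
  next
    case False
    note nk = False
    consider "z \<bullet> ?u = 1" | "z = ?u" | "z \<bullet> ?u = -1" | "z = - ?u"
      using K(3)[OF z(1) t(2)] norm3_eq[OF K(2)[OF z(1)] tu(2)] by blast
    then show ?thesis
    proof cases
      case 1
      have "?u \<bullet> ?t = -1" by simp
      then show ?thesis using r[OF z(1) t(2) 1 z(2)] by blast
    next
      case 2 then show ?thesis by (intro bexI[OF _ sym56_id]) simp
    next
      case 3
      have s: "\<bar>w\<bar> = 1 \<longleftrightarrow> w = 1 \<or> w = -1" for w :: real by auto
      have "\<exists>k\<in>K56. k \<bullet> ?t = -1 \<and> k \<bullet> ?u = 1 \<and> k \<bullet> z = 1"
        using z(1)
      proof (cases rule: K56_cases)
        case (abc a b c)
        with 3 z(2) have e: "a = -1" "c = - b" by auto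
        have "b = 1 \<or> b = -1" using abc(3) s by simp
        then show ?thesis
        proof
          assume "b = 1"
          then show ?thesis using e abc
            by (intro bexI[of _ "vec7 0 0 (-1) 1 0 0 1"] K56_intros) auto
        next
          assume "b = -1"
          then show ?thesis using e abc
            by (intro bexI[of _ "vec7 0 (-1) 0 1 0 1 0"] K56_intros) auto
        qed
      next
        case (apq a p q)
        then have "p * p = 1" by (metis abs_mult_self_eq mult_1)
        then show ?thesis using apq
          by (intro bexI[of _ "vec7 0 (-1) 0 p 0 1 0"] K56_intros) auto
      next
        case (ars a r s')
        then have "r * r = 1" by (metis abs_mult_self_eq mult_1)
        then show ?thesis using ars
          by (intro bexI[of _ "vec7 0 (-1) 0 1 0 r 0"] K56_intros) auto
      qed (use 3 z(2) in auto)
      with nk show ?thesis by blast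
    next
      case 4 then show ?thesis using z(2) by simp
    qed
  qed
  then obtain g where "g \<in> sym56" "g ?t = ?t" "g z = ?u" by blast
  then show thesis using that[of "\<lambda>x. g (f x)"] sym56_comp f by (auto simp: z_def)
qed

text \<open>
  Let x, y in K56 have x \<bullet> y = -1, and put e = (x + y)/2, m = (x - y)/2. The vectors of K56 that have inner
  product 1 with e are e \<plusminus> f, where f runs through m and five vectors n_0, ..., n_4 of norm 2, all mutually
  orthogonal and orthogonal to e. So e, m, n_0, ..., n_4 is an orthogonal basis of R^7, and the norm
  formula is its Parseval identity. The vectors of K56 orthogonal to e are half sums
  (\<plusminus>m \<plusminus>n_0 \<plusminus> ... \<plusminus>n_4)/2 with a parity condition on the signs, whence the last clause.
\<close>

definition root_frame :: "real ^ 7 \<Rightarrow> real ^ 7 \<Rightarrow> (nat \<Rightarrow> real ^ 7) \<Rightarrow> bool" where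
  "root_frame e m n \<longleftrightarrow>
     e \<bullet> e = 1 \<and> e \<bullet> m = 0 \<and> m \<bullet> m = 2 \<and>
     (\<forall>j<5. e + n j \<in> K56 \<and> e - n j \<in> K56 \<and> n j \<bullet> e = 0 \<and> n j \<bullet> m = 0 \<and>
        (\<forall>i<5. n j \<bullet> n i = (if i = j then 2 else 0))) \<and>
     (\<forall>z. z \<bullet> z = (z \<bullet> e)\<^sup>2 + (z \<bullet> m)\<^sup>2 / 2 + (\<Sum>j<5. (z \<bullet> n j)\<^sup>2) / 2) \<and>
     (\<forall>\<epsilon>. (\<forall>j<5. \<epsilon> j = 1 \<or> \<epsilon> j = -1) \<longrightarrow>
        (1/2) *\<^sub>R (m + (\<Sum>j<5. \<epsilon> j *\<^sub>R n j)) \<in> K56 \<or> (1/2) *\<^sub>R (- m + (\<Sum>j<5. \<epsilon> j *\<^sub>R n j)) \<in> K56)"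

lemma sum_lessThan_5: "(\<Sum>j<5. f j) = f 0 + f 1 + f 2 + f 3 + f (4::nat)"
  by (simp add: eval_nat_numeral)

lemma all_lessThan_5: "(\<forall>j<5. P j) \<longleftrightarrow> P 0 \<and> P 1 \<and> P 2 \<and> P 3 \<and> P (4::nat)"
  by (auto simp: eval_nat_numeral less_Suc_eq)

lemma root_frame_standard:
  defines "n \<equiv> \<lambda>j::nat. if j = 0 then vec7 0 1 (-1) 0 0 0 0 else if j = 1 then vec7 0 0 0 1 1 0 0
    else if j = 2 then vec7 0 0 0 1 (-1) 0 0 else if j = 3 then vec7 0 0 0 0 0 1 1 else vec7 0 0 0 0 0 1 (-1)"
  shows "root_frame (vec7 1 0 0 0 0 0 0) (vec7 0 1 1 0 0 0 0) n"
proof -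
  have n: "n 0 = vec7 0 1 (-1) 0 0 0 0" "n 1 = vec7 0 0 0 1 1 0 0" "n 2 = vec7 0 0 0 1 (-1) 0 0"
    "n 3 = vec7 0 0 0 0 0 1 1" "n 4 = vec7 0 0 0 0 0 1 (-1)"
    by (simp_all add: n_def)
  let ?e = "vec7 1 0 0 0 0 0 0" let ?m = "vec7 0 1 1 0 0 0 0"
  have 1: "?e + n 0 \<in> K56" "?e - n 0 \<in> K56" "?e + n 1 \<in> K56" "?e - n 1 \<in> K56"
    "?e + n 2 \<in> K56" "?e - n 2 \<in> K56" "?e + n 3 \<in> K56" "?e - n 3 \<in> K56" "?e + n 4 \<in> K56" "?e - n 4 \<in> K56"
    unfolding n by (simp_all add: K56_intros)
  have 2: "z \<bullet> z = (z \<bullet> ?e)\<^sup>2 + (z \<bullet> ?m)\<^sup>2 / 2 + (\<Sum>j<5. (z \<bullet> n j)\<^sup>2) / 2" for z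
  proof -
    obtain a b c p q r s where z: "z = vec7 a b c p q r s" by (rule vec7_cases)
    show ?thesis unfolding z sum_lessThan_5 n by (simp add: power2_eq_square field_simps)
  qed
  have 3: "(1/2) *\<^sub>R (?m + (\<Sum>j<5. \<epsilon> j *\<^sub>R n j)) \<in> K56 \<or> (1/2) *\<^sub>R (- ?m + (\<Sum>j<5. \<epsilon> j *\<^sub>R n j)) \<in> K56"
    if "\<forall>j<5. \<epsilon> j = 1 \<or> \<epsilon> j = -1" for \<epsilon>
    using that unfolding all_lessThan_5 sum_lessThan_5 n by (elim conjE disjE) (simp_all add: K56_intros)
  have 4: "\<forall>j<5. ?e + n j \<in> K56 \<and> ?e - n j \<in> K56 \<and> n j \<bullet> ?e = 0 \<and> n j \<bullet> ?m = 0 \<and>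
      (\<forall>i<5. n j \<bullet> n i = (if i = j then 2 else 0))"
    unfolding all_lessThan_5 by (intro conjI 1) (simp_all add: n n(2)[unfolded One_nat_def])
  show ?thesis
    unfolding root_frame_def
    by (intro conjI; (rule 4 | (intro allI, rule 2) | (intro allI impI, rule 3, assumption) | simp))
qed

lemma root_frame_map:
  assumes f: "f \<in> sym56" and fr: "root_frame e m n"
  shows "root_frame (f e) (f m) (\<lambda>j. f (n j))"
proof -
  obtain g where g: "\<And>x. g (f x) = x" "\<And>x. f (g x) = x" using sym56_inv[OF f] by metis
  have o: "orthogonal_transformation f" using f by (rule sym56D)
  note l = orthogonal_transformation_linear[OF o]
  note i = orthogonal_transformation_inner[OF o]
  have fl: "f e + f (n j) = f (e + n j)" "f e - f (n j) = f (e - n j)"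
    "(1/2) *\<^sub>R (f m + (\<Sum>j<5. \<epsilon> j *\<^sub>R f (n j))) = f ((1/2) *\<^sub>R (m + (\<Sum>j<5. \<epsilon> j *\<^sub>R n j)))"
    "(1/2) *\<^sub>R (- f m + (\<Sum>j<5. \<epsilon> j *\<^sub>R f (n j))) = f ((1/2) *\<^sub>R (- m + (\<Sum>j<5. \<epsilon> j *\<^sub>R n j)))" for j \<epsilon>
    using l by (simp_all add: linear_add linear_diff linear_scale linear_sum linear_neg)
  have sq: "z \<bullet> z = (z \<bullet> f e)\<^sup>2 + (z \<bullet> f m)\<^sup>2 / 2 + (\<Sum>j<5. (z \<bullet> f (n j))\<^sup>2) / 2" for z
  proof -
    have j: "g z \<bullet> y = z \<bullet> f y" for y using i[of "g z" y] by (simp add: g)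
    have "z \<bullet> z = g z \<bullet> g z" using i[of "g z" "g z"] by (simp add: g)
    then show ?thesis using fr unfolding root_frame_def j[symmetric] by simp
  qed
  have k: "f x \<in> K56 \<longleftrightarrow> x \<in> K56" for x
  proof
    assume "f x \<in> K56"
    then obtain y where "y \<in> K56" "f x = f y" using sym56D(2)[OF f] by blast
    then show "x \<in> K56" by (metis g(1))
  qed (rule sym56D(3)[OF f])
  note fr' = fr[unfolded root_frame_def]
  show ?thesis
    unfolding root_frame_def i fl k
    by (intro conjI; (intro allI, rule sq)?; insert fr'; elim conjE; assumption)
qed

text \<open>
  By transitivity on such pairs it is enough to have a frame for one pair.
\<close>

lemma root_frame_exists:
  assumes "x \<in> K56" "y \<in> K56" "x \<bullet> y = -1"
  obtains e m n where "x = e + m" "y = e - m" "root_frame e m n"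
proof -
  obtain f where f: "f \<in> sym56" "f x = vec7 1 1 1 0 0 0 0" "f y = vec7 1 (-1) (-1) 0 0 0 0"
    using sym56_transitive_pairs[OF assms] by blast
  obtain g where g: "g \<in> sym56" "\<And>x. g (f x) = x" using sym56_inv[OF f(1)] by metis
  have l: "linear g" using g(1) by (simp add: sym56D orthogonal_transformation_linear)
  obtain n where "root_frame (vec7 1 0 0 0 0 0 0) (vec7 0 1 1 0 0 0 0) n" using root_frame_standard by blast
  from root_frame_map[OF g(1) this] that[of "g (vec7 1 0 0 0 0 0 0)" "g (vec7 0 1 1 0 0 0 0)"]
    linear_add[OF l] linear_diff[OF l] g(2)[of x] g(2)[of y] f(2,3)
  show thesis by (simp add: linear_add[OF l, symmetric] linear_diff[OF l, symmetric])
qed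

lemma root_frameD:
  assumes "root_frame e m n"
  shows "e \<bullet> e = 1" "e \<bullet> m = 0" "m \<bullet> m = 2"
    "j < 5 \<Longrightarrow> e + n j \<in> K56" "j < 5 \<Longrightarrow> e - n j \<in> K56" "j < 5 \<Longrightarrow> n j \<bullet> e = 0" "j < 5 \<Longrightarrow> n j \<bullet> m = 0"
    "j < 5 \<Longrightarrow> i < 5 \<Longrightarrow> n j \<bullet> n i = (if i = j then 2 else 0)"
    "z \<bullet> z = (z \<bullet> e)\<^sup>2 + (z \<bullet> m)\<^sup>2 / 2 + (\<Sum>j<5. (z \<bullet> n j)\<^sup>2) / 2"
    "(\<And>j. j < 5 \<Longrightarrow> \<epsilon> j = 1 \<or> \<epsilon> j = -1) \<Longrightarrow>
        (1/2) *\<^sub>R (m + (\<Sum>j<5. \<epsilon> j *\<^sub>R n j)) \<in> K56 \<or> (1/2) *\<^sub>R (- m + (\<Sum>j<5. \<epsilon> j *\<^sub>R n j)) \<in> K56"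
  using assms unfolding root_frame_def by blast+

lemma root_frame_inner:
  assumes "root_frame e m n"
  shows "v \<bullet> z = (v \<bullet> e) * (z \<bullet> e) + (v \<bullet> m) * (z \<bullet> m) / 2 + (\<Sum>j<5. (v \<bullet> n j) * (z \<bullet> n j)) / 2"
proof -
  note r = root_frameD(9)[OF assms]
  have "2 * (v \<bullet> z) = (v + z) \<bullet> (v + z) - v \<bullet> v - z \<bullet> z"
    by (simp add: inner_add_left inner_add_right inner_commute[of z v])
  also have "\<dots> = 2 * ((v \<bullet> e) * (z \<bullet> e) + (v \<bullet> m) * (z \<bullet> m) / 2 + (\<Sum>j<5. (v \<bullet> n j) * (z \<bullet> n j)) / 2)"
    unfolding r[of "v + z"] r[of v] r[of z] sum_lessThan_5
    by (simp add: inner_add_left power2_eq_square field_simps)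
  finally show ?thesis by simp
qed

lemma root_frame_eqI:
  assumes "root_frame e m n" "v \<bullet> e = z \<bullet> e" "v \<bullet> m = z \<bullet> m" "\<And>j. j < 5 \<Longrightarrow> v \<bullet> n j = z \<bullet> n j"
  shows "v = z"
proof -
  have "(v - z) \<bullet> (v - z) = 0"
    using root_frameD(9)[OF assms(1), of "v - z"] assms(2-4) by (simp add: inner_diff_left)
  then show ?thesis by simp
qed

lemma K56_inner_cases:
  assumes "v \<in> K56" "w \<in> K56"
  obtains "v \<bullet> w = 1" | "v \<bullet> w = -1" | "v = w" "v \<bullet> w = 3" | "v = - w" "v \<bullet> w = -3"
  using line_systemD(3)[OF line_system_K56 assms] norm3_eq(1,2)[OF K56_norm[OF assms(1)] K56_norm[OF assms(2)]] by blast

lemma K56_inner: "v \<in> K56 \<Longrightarrow> w \<in> K56 \<Longrightarrow> v \<bullet> w = 1 \<or> v \<bullet> w = -1 \<or> v \<bullet> w = 3 \<or> v \<bullet> w = -3"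
  by (rule line_systemD(3)[OF line_system_K56])

lemma K56_minus: "v \<in> K56 \<Longrightarrow> - v \<in> K56"
  by (rule line_systemD(1)[OF line_system_K56])

text \<open>
  If v \<bullet> m = 0, then v \<bullet> e = \<plusminus>1, and v \<bullet> (e + n_j), v \<bullet> (e - n_j) are odd integers of absolute value at most 3.
  If v \<bullet> n_j \<noteq> 0, one of them must be \<plusminus>3. By Parseval some v \<bullet> n_j is not 0.
\<close>

lemma orthogonal_to_frame_root:
  assumes fr: "root_frame e m n" and xy: "e + m \<in> K56" "e - m \<in> K56"
    and v: "v \<in> K56" and vm: "v \<bullet> m = 0"
  shows "j < 5 \<Longrightarrow> v \<bullet> n j \<noteq> 0 \<Longrightarrow> v \<in> {e + n j, e - n j, - (e + n j), - (e - n j)}"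
    and "\<exists>j<5. v \<bullet> n j \<noteq> 0"
proof -
  have a: "v \<bullet> e = 1 \<or> v \<bullet> e = -1"
  proof -
    have "v \<noteq> e + m" "v \<noteq> - (e + m)" using vm root_frameD(2,3)[OF fr] by (auto simp: inner_add_left inner_diff_left)
    moreover have "v \<bullet> (e + m) = v \<bullet> e" using vm by (simp add: inner_add_right)
    ultimately show ?thesis using K56_inner_cases[OF v xy(1)] by fastforce
  qed
  show "v \<in> {e + n j, e - n j, - (e + n j), - (e - n j)}" if j: "j < 5" "v \<bullet> n j \<noteq> 0"
  proof -
    have k: "e + n j \<in> K56" "e - n j \<in> K56" using root_frameD(4,5)[OF fr] j by auto
    have 1: "v \<bullet> (e + n j) = v \<bullet> e + v \<bullet> n j" "v \<bullet> (e - n j) = v \<bullet> e - v \<bullet> n j"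
      by (auto simp: inner_add_right inner_diff_right)
    have 2: "v = w" if "v \<bullet> w = 3" "w \<in> K56" for w using norm3_eq[OF K56_norm[OF v] K56_norm[OF that(2)]] that by blast
    have 3: "v = - w" if "v \<bullet> w = -3" "w \<in> K56" for w using norm3_eq[OF K56_norm[OF v] K56_norm[OF that(2)]] that by blast
    have "v \<bullet> (e + n j) = 3 \<or> v \<bullet> (e - n j) = 3 \<or> v \<bullet> (e + n j) = -3 \<or> v \<bullet> (e - n j) = -3"
      using K56_inner[OF v k(1)] K56_inner[OF v k(2)] a j(2) unfolding 1 by linarith
    then show ?thesis using 2 3 k by blast
  qed
  show "\<exists>j<5. v \<bullet> n j \<noteq> 0"
  proof (rule ccontr)
    assume "\<not> ?thesis"
    then have "v \<bullet> v = (v \<bullet> e)\<^sup>2" using root_frameD(9)[OF fr, of v] vm by simp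
    then show False using a K56_norm[OF v] by auto
  qed
qed

section \<open>Triad-free systems inside the 56 vectors\<close>

text \<open>
  For a system V = -V without triads this says that a further line of K56 can be added to it such that
  there are still no triads. It is invariant under symmetries of K56 but not under arbitrary isometries
  between subsystems.
\<close>

definition extendable :: "(real ^ 7) set \<Rightarrow> bool" where
  "extendable V \<longleftrightarrow> (\<exists>k\<in>K56. k \<notin> V \<and> (\<forall>x\<in>V. \<forall>y\<in>V. \<not> (x \<bullet> y = -1 \<and> x \<bullet> k = -1 \<and> y \<bullet> k = -1)))"

definition signed_set :: "(nat \<Rightarrow> 'a::real_inner) \<Rightarrow> nat \<Rightarrow> 'a set" where
  "signed_set b N = b ` {..<N} \<union> (\<lambda>i. - b i) ` {..<N}"

lemma signed_setI: "i < N \<Longrightarrow> b i \<in> signed_set b N" "i < N \<Longrightarrow> - b i \<in> signed_set b N"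
  by (auto simp: signed_set_def)

lemma signed_setE:
  assumes "v \<in> signed_set b N"
  obtains i where "i < N" "v = b i" | i where "i < N" "v = - b i"
  using assms by (auto simp: signed_set_def)

lemma signed_set_props:
  fixes b :: "nat \<Rightarrow> 'a::real_inner"
  assumes b: "\<And>i j. i < N \<Longrightarrow> j < N \<Longrightarrow> b i \<bullet> b j = (if i = j then 3 else 1)"
  shows "finite (signed_set b N)" "card (signed_set b N) = 2 * N" "\<not> has_triad (signed_set b N)"
    "\<And>v. v \<in> signed_set b N \<Longrightarrow> - v \<in> signed_set b N"
proof -
  have ne: "i = j" if "i < N" "j < N" "b i = b j" for i j
    using b[OF that(1,2)] b[OF that(1,1)] that(3) by (auto split: if_splits)
  have nm: "b i \<noteq> - b j" if "i < N" "j < N" for i j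
  proof
    assume "b i = - b j"
    then have "b i \<bullet> b j = - (b j \<bullet> b j)" by simp
    then show False using b[OF that] b[OF that(2,2)] by (auto split: if_splits)
  qed
  have 1: "inj_on b {..<N}" "inj_on (\<lambda>i. - b i) {..<N}" using ne by (auto simp: inj_on_def)
  have "b ` {..<N} \<inter> (\<lambda>i. - b i) ` {..<N} = {}" using nm by auto
  then show "card (signed_set b N) = 2 * N"
    unfolding signed_set_def by (subst card_Un_disjoint) (auto simp: card_image[OF 1(1)] card_image[OF 1(2)])
  show "finite (signed_set b N)" unfolding signed_set_def by auto
  show "\<And>v. v \<in> signed_set b N \<Longrightarrow> - v \<in> signed_set b N" by (auto simp: signed_set_def)
  show "\<not> has_triad (signed_set b N)"
  proof
    assume "has_triad (signed_set b N)"
    then obtain x y z where s: "x \<in> signed_set b N" "y \<in> signed_set b N" "z \<in> signed_set b N"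
      and i: "x \<bullet> y = -1" "x \<bullet> z = -1" "y \<bullet> z = -1"
      unfolding has_triad_def by blast
    from s(1) show False
    proof (cases rule: signed_setE)
      case (1 p) show ?thesis using s(2,3) 1 i by (elim signed_setE) (simp_all add: b split: if_splits)
    next
      case (2 p) show ?thesis using s(2,3) 2 i by (elim signed_setE) (simp_all add: b split: if_splits)
    qed
  qed
qed

text \<open>
  If k \<bullet> b_i = -1 and k \<bullet> b_j = 1, then b_i, -b_j and k form a triad. So an admissible k has the same inner product with all b_i, and its sign can be chosen.
\<close>

lemma extendable_signed_set:
  assumes b: "\<And>i j. i < N \<Longrightarrow> j < N \<Longrightarrow> b i \<bullet> b j = (if i = j then 3 else 1)"
    and N: "0 < N" and bK: "\<And>i. i < N \<Longrightarrow> b i \<in> K56"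
  shows "extendable (signed_set b N) \<longleftrightarrow> (\<exists>k\<in>K56. \<forall>i<N. k \<bullet> b i = 1)"
proof
  assume "extendable (signed_set b N)"
  then obtain k where k: "k \<in> K56" "k \<notin> signed_set b N"
    and nt: "\<And>x y. x \<in> signed_set b N \<Longrightarrow> y \<in> signed_set b N \<Longrightarrow> \<not> (x \<bullet> y = -1 \<and> x \<bullet> k = -1 \<and> y \<bullet> k = -1)"
    unfolding extendable_def by blast
  have m: "b i \<in> signed_set b N" "- b i \<in> signed_set b N" if "i < N" for i
    using that by (auto intro: signed_setI)
  have pm: "k \<bullet> b i = 1 \<or> k \<bullet> b i = -1" if "i < N" for i
    by (rule K56_inner_cases[OF k(1) bK[OF that]]) (use m[OF that] k(2) in auto)
  have eq: "k \<bullet> b i = k \<bullet> b 0" if i: "i < N" for i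
  proof (rule ccontr)
    assume ne: "k \<bullet> b i \<noteq> k \<bullet> b 0"
    then have "i \<noteq> 0" by metis
    then have "b i \<bullet> b 0 = 1" "b 0 \<bullet> b i = 1" using b i N by auto
    then show False
      using pm[OF i] pm[OF N] ne nt[OF m(1)[OF i] m(2)[OF N]] nt[OF m(1)[OF N] m(2)[OF i]]
      by (auto simp: inner_commute)
  qed
  show "\<exists>k\<in>K56. \<forall>i<N. k \<bullet> b i = 1"
    using pm[OF N]
  proof
    assume "k \<bullet> b 0 = 1" then show ?thesis using eq k(1) by auto
  next
    assume "k \<bullet> b 0 = -1" then show ?thesis using eq K56_minus[OF k(1)] by (intro bexI[of _ "- k"]) auto
  qed
next
  assume "\<exists>k\<in>K56. \<forall>i<N. k \<bullet> b i = 1"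
  then obtain k where k: "k \<in> K56" "\<And>i. i < N \<Longrightarrow> k \<bullet> b i = 1" by blast
  have k': "b i \<bullet> k = 1" if "i < N" for i using k(2)[OF that] by (simp add: inner_commute)
  have "k \<notin> signed_set b N"
  proof
    assume "k \<in> signed_set b N"
    then show False
    proof (cases rule: signed_setE)
      case (1 i) then show ?thesis using k(2)[of i] b[of i i] by simp
    next
      case (2 i) then show ?thesis using k(2)[of i] b[of i i] by simp
    qed
  qed
  moreover have "\<not> (x \<bullet> y = -1 \<and> x \<bullet> k = -1 \<and> y \<bullet> k = -1)" if xy: "x \<in> signed_set b N" "y \<in> signed_set b N" for x y
    using xy by (elim signed_setE) (auto simp: b k')
  ultimately show "extendable (signed_set b N)" unfolding extendable_def using k(1) by blast
qed

lemma extendable_sym56: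
  assumes "f \<in> sym56"
  shows "extendable (f ` V) \<longleftrightarrow> extendable V"
proof -
  have 1: "extendable (f ` V)" if f: "f \<in> sym56" and V: "extendable V" for f V
  proof -
    obtain k where k: "k \<in> K56" "k \<notin> V" "\<forall>x\<in>V. \<forall>y\<in>V. \<not> (x \<bullet> y = -1 \<and> x \<bullet> k = -1 \<and> y \<bullet> k = -1)"
      using V unfolding extendable_def by blast
    have "f k \<notin> f ` V" using k(2) orthogonal_transformation_inj[OF sym56D(1)[OF f]] by (auto dest: injD)
    then show ?thesis
      unfolding extendable_def using sym56D(3)[OF f k(1)] k(3)
      by (intro bexI[of _ "f k"]) (auto simp: sym56D(4)[OF f])
  qed
  obtain g where g: "g \<in> sym56" "\<And>x. g (f x) = x" using sym56_inv[OF assms] by metis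
  have "g ` f ` V = V" using g(2) by (simp add: image_image)
  then show ?thesis using 1[OF assms, of V] 1[OF g(1), of "f ` V"] by metis
qed

section \<open>Extending isometries between subsystems\<close>

text \<open>
  The orbit of an isometry g under composition with symmetries of K56 contains one that fixes as many
  vectors of V as possible. For such a g, any composite with a symmetry that keeps the fixed vectors and
  brings one more vector back to its place is impossible (\<open>no_gain\<close>). The candidates are products of
  reflections and -id.
\<close>

locale maximal_isometry =
  fixes V :: "(real ^ 7) set" and g :: "real ^ 7 \<Rightarrow> real ^ 7"
  assumes VK: "V \<subseteq> K56" and Vminus: "v \<in> V \<Longrightarrow> - v \<in> V"
    and g: "orthogonal_transformation g" and gK: "v \<in> V \<Longrightarrow> g v \<in> K56"
    and maximal: "s \<in> sym56 \<Longrightarrow> card {v \<in> V. s (g v) = v} \<le> card {v \<in> V. g v = v}"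
begin

lemma finite_V: "finite V"
  using VK finite_K56 by (rule finite_subset)

lemma g_inner: "g u \<bullet> g v = u \<bullet> v"
  using g by (rule orthogonal_transformation_inner)

lemma g_minus: "g (- v) = - g v"
  using g by (rule orthogonal_transformation_minus)

lemma g_eq_iff: "g u = g v \<longleftrightarrow> u = v"
  using orthogonal_transformation_inj[OF g] by (auto dest: injD)

lemma inK: "v \<in> V \<Longrightarrow> v \<in> K56"
  using VK by blast

lemma no_gain:
  assumes "s \<in> sym56" "\<And>a. a \<in> V \<Longrightarrow> g a = a \<Longrightarrow> s a = a" "v \<in> V" "g v \<noteq> v"
  shows "s (g v) \<noteq> v"
proof
  assume "s (g v) = v"
  then have "{v \<in> V. g v = v} \<subset> {v \<in> V. s (g v) = v}" using assms(2-4) by force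
  then have "card {v \<in> V. g v = v} < card {v \<in> V. s (g v) = v}"
    using finite_V by (intro psubset_card_mono) auto
  with maximal[OF assms(1)] show False by simp
qed

lemma fixed_inner: "g a = a \<Longrightarrow> a \<bullet> g v = a \<bullet> v"
  using g_inner[of a v] by simp

lemma refl_fixes:
  assumes "a \<bullet> u = a \<bullet> w"
  shows "refl_along (u - w) a = a"
  using assms by (intro refl_along_fix) (simp add: inner_diff_right)

lemma norms: "v \<in> V \<Longrightarrow> v \<bullet> v = 3" "v \<in> V \<Longrightarrow> g v \<bullet> g v = 3"
  using K56_norm[OF inK] g_inner by auto

lemma not_1: "v \<in> V \<Longrightarrow> v \<bullet> g v \<noteq> 1"
proof
  assume v: "v \<in> V" "v \<bullet> g v = 1"
  have "g v \<noteq> v" using v norms by auto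
  moreover have "refl_along (g v - v) \<in> sym56"
    by (rule sym56_refl_along) (use v inK gK in \<open>auto simp: inner_commute\<close>)
  moreover have "refl_along (g v - v) (g v) = v" using norms v by (intro refl_along_swap) auto
  moreover have "refl_along (g v - v) a = a" if "g a = a" for a
    using fixed_inner[OF that] by (intro refl_fixes) auto
  ultimately show False using no_gain[of "refl_along (g v - v)" v] v(1) by blast
qed

lemma not_m3: "v \<in> V \<Longrightarrow> v \<bullet> g v \<noteq> -3"
proof
  assume v: "v \<in> V" "v \<bullet> g v = -3"
  then have gv: "g v = - v" using norm3_eq(2)[OF norms[OF v(1)]] by (metis minus_minus)
  have "g v \<noteq> v" using v norms by auto
  moreover have False if a: "a \<in> V" "g a = a" for a
  proof -
    have "a \<bullet> v = 0" using fixed_inner[OF a(2), of v] gv by simp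
    then show False using K56_inner[OF inK[OF a(1)] inK[OF v(1)]] by simp
  qed
  moreover have "- g v = v" using gv by simp
  ultimately show False using no_gain[OF sym56_minus, of v] v(1) by blast
qed

lemma nonfixed_inner: "v \<in> V \<Longrightarrow> g v \<noteq> v \<Longrightarrow> v \<bullet> g v = -1"
  using not_1 not_m3 K56_inner[OF inK gK] norm3_eq(1)[OF norms] by metis

text \<open>
  A vector v with v \<bullet> g v = -1 could be restored in two steps, g v to k to v. The reflections fix a if
  k \<bullet> a = v \<bullet> a = g v \<bullet> a, so some fixed vector must prevent this.
\<close>

lemma obstructed:
  assumes v: "v \<in> V" "g v \<noteq> v" and k: "k \<in> K56" "k \<bullet> v = 1" "k \<bullet> g v = 1"
  shows "\<exists>a\<in>V. g a = a \<and> k \<bullet> a \<noteq> v \<bullet> a"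
proof (rule ccontr)
  assume no: "\<not> ?thesis"
  let ?s = "\<lambda>z. refl_along (k - v) (refl_along (g v - k) z)"
  have "?s \<in> sym56"
    by (rule sym56_comp[OF sym56_refl_along sym56_refl_along]) (use v k inK gK in \<open>auto simp: inner_commute\<close>)
  moreover have "refl_along (g v - k) (g v) = k" "refl_along (k - v) k = v"
    using norms v K56_norm[OF k(1)] by (intro refl_along_swap; simp)+
  then have "?s (g v) = v" by simp
  moreover have "?s a = a" if a: "a \<in> V" "g a = a" for a
  proof -
    have "a \<bullet> k = a \<bullet> v" using no a by (metis inner_commute)
    moreover have "a \<bullet> g v = a \<bullet> v" using fixed_inner[OF a(2)] .
    ultimately show ?thesis by (simp add: refl_fixes)
  qed
  ultimately show False using no_gain[of ?s v] v by blast
qed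

text \<open>
  From here on e + m in V is moved to e - m by g.
\<close>

context
  fixes e m n
  assumes fr: "root_frame e m n" and xV: "e + m \<in> V" and gx: "g (e + m) = e - m"
begin

lemma yK: "e - m \<in> K56"
  using gK[OF xV] gx by simp

lemma m_nz: "m \<noteq> 0" "e + m \<noteq> e - m"
proof -
  show "m \<noteq> 0" using root_frameD(3)[OF fr] by auto
  show "e + m \<noteq> e - m"
  proof
    assume "e + m = e - m"
    then have "(e + m) \<bullet> m = (e - m) \<bullet> m" by (rule arg_cong)
    then show False using root_frameD(3)[OF fr] by (simp add: inner_add_left inner_diff_left)
  qed
qed

lemma fixed_orth_m:
  assumes "g a = a"
  shows "a \<bullet> m = 0"
proof -
  have "a \<bullet> (e - m) = a \<bullet> (e + m)" using fixed_inner[OF assms, of "e + m"] gx by simp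
  then show ?thesis by (simp add: inner_diff_right inner_add_right)
qed

text \<open>
  The vector k = e + n_j would be a stepping stone from e - m to e + m. The fixed vector that obstructs it
  is orthogonal to m but not to n_j, which leaves only \<plusminus>(e \<plusminus> n_j).
\<close>

lemma obstruction:
  assumes j: "j < 5"
  shows "\<exists>\<epsilon>. (\<epsilon> = 1 \<or> \<epsilon> = -1) \<and> e + \<epsilon> *\<^sub>R n j \<in> V \<and> g (e + \<epsilon> *\<^sub>R n j) = e + \<epsilon> *\<^sub>R n j"
proof -
  note f = root_frameD[OF fr]
  have "(e + n j) \<bullet> (e + m) = 1" "(e + n j) \<bullet> (e - m) = 1"
    using f(1-3) f(6,7)[OF j] by (auto simp: inner_add_left inner_add_right inner_diff_right)
  then obtain a where a: "a \<in> V" "g a = a" "(e + n j) \<bullet> a \<noteq> (e + m) \<bullet> a"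
    using obstructed[OF xV _ f(4)[OF j]] gx m_nz by auto
  have am: "a \<bullet> m = 0" using a(2) by (rule fixed_orth_m)
  then have "a \<bullet> n j \<noteq> 0" using a(3) by (auto simp: inner_commute[of _ a] inner_add_right)
  then have "a \<in> {e + n j, e - n j, - (e + n j), - (e - n j)}"
    using orthogonal_to_frame_root(1)[OF fr inK[OF xV] yK inK[OF a(1)] am j] by simp
  then consider "a = e + 1 *\<^sub>R n j" | "a = e + (-1) *\<^sub>R n j" | "- a = e + 1 *\<^sub>R n j" | "- a = e + (-1) *\<^sub>R n j"
    by auto
  then show ?thesis
  proof cases
    case 1 then show ?thesis using a by (intro exI[of _ 1]) simp
  next
    case 2 then show ?thesis using a by (intro exI[of _ "-1"]) simp
  next
    case 3 then show ?thesis using a(2) Vminus[OF a(1)] g_minus[of a] by (intro exI[of _ 1]) simp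
  next
    case 4 then show ?thesis using a(2) Vminus[OF a(1)] g_minus[of a] by (intro exI[of _ "-1"]) simp
  qed
qed

lemma fixed_shape:
  assumes "v \<in> V" "v \<bullet> m = 0"
  shows "\<exists>j<5. v \<in> {e + n j, e - n j, - (e + n j), - (e - n j)}"
  using orthogonal_to_frame_root[OF fr inK[OF xV] yK inK[OF assms(1)] assms(2)] by blast

text \<open>
  The vector g v is the mirror image of v in the hyperplane orthogonal to m, so v \<bullet> g v = 3 - (v \<bullet> m)^2. As
  this has to be -1 or 3, the reflection can only move \<plusminus>(e + m) and \<plusminus>(e - m).
\<close>

lemma mirrored_shape:
  assumes v: "v \<in> V" and gv: "g v = v - (v \<bullet> m) *\<^sub>R m"
  shows "v \<in> {e + m, - (e + m), e - m, - (e - m)} \<or> g v = v \<and> v \<bullet> m = 0"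
proof (cases "v \<bullet> m = 0")
  case True
  then show ?thesis using gv by simp
next
  case False
  have "v \<bullet> g v = 3 - (v \<bullet> m)\<^sup>2"
    using norms(1)[OF v] unfolding gv by (simp add: inner_diff_right power2_eq_square)
  moreover have "g v \<noteq> v" using False gv m_nz by simp
  ultimately have "(v \<bullet> m)\<^sup>2 = 2\<^sup>2" using nonfixed_inner[OF v] by simp
  then have vm: "v \<bullet> m = 2 \<or> v \<bullet> m = -2" by (simp only: power2_eq_iff)
  have 1: "v \<bullet> (e + m) = v \<bullet> e + v \<bullet> m" "v \<bullet> (e - m) = v \<bullet> e - v \<bullet> m"
    by (auto simp: inner_add_right inner_diff_right)
  have "v \<bullet> (e + m) = 3 \<or> v \<bullet> (e + m) = -3 \<or> v \<bullet> (e - m) = 3 \<or> v \<bullet> (e - m) = -3"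
    using vm K56_inner[OF inK[OF v] inK[OF xV]] K56_inner[OF inK[OF v] yK] unfolding 1 by (elim disjE) auto
  then show ?thesis
    using norm3_eq(1,2)[OF norms(1)[OF v] norms(1)[OF xV]] norm3_eq(1,2)[OF norms(1)[OF v] K56_norm[OF yK]] by blast
qed

text \<open>
  Since g fixes the a_j = e + \<epsilon>_j n_j and moves e + m to e - m, the vectors v and g v have the same inner
  products \<eta>_j with the a_j, and the inner product \<tau> of v with e + m is that of g v with e - m. So each of v
  and g v is determined by its inner product with e, called \<alpha> and \<beta>. When \<tau> and all \<eta>_j are \<plusminus>1, Parseval
  gives one equation 4 \<gamma>^2 = \<gamma> T for both, where T = \<tau> + \<eta>_0 + ... + \<eta>_4. If \<alpha> = \<beta>, then g v is the
  mirror image of v. Otherwise one of them is 0 and the other is \<delta> = T/4 = \<plusminus>1, so exactly one of the six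
  signs is -\<delta>. If that sign is an \<eta>_j, then v \<bullet> g v = 1, which is excluded; if it is \<tau>, then v or g v
  is forced.
\<close>

lemma mirrored_or_exceptional:
  assumes v: "v \<in> V"
  shows "g v = v - (v \<bullet> m) *\<^sub>R m \<or> v = e - m \<or> v = - (e - m) \<or> g v = e + m \<or> g v = - (e + m)"
proof -
  note f = root_frameD[OF fr]
  from obstruction obtain \<epsilon> where eps: "\<And>j. j < 5 \<Longrightarrow> \<epsilon> j = 1 \<or> \<epsilon> j = -1"
    and A: "\<And>j. j < 5 \<Longrightarrow> e + \<epsilon> j *\<^sub>R n j \<in> V" "\<And>j. j < 5 \<Longrightarrow> g (e + \<epsilon> j *\<^sub>R n j) = e + \<epsilon> j *\<^sub>R n j"
    by metis
  define \<tau> where "\<tau> = v \<bullet> (e + m)"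
  define \<eta> where "\<eta> j = v \<bullet> (e + \<epsilon> j *\<^sub>R n j)" for j
  define \<alpha> where "\<alpha> = v \<bullet> e"
  define \<beta> where "\<beta> = g v \<bullet> e"
  have z\<tau>: "g v \<bullet> (e - m) = \<tau>" using g_inner[of v "e + m"] gx by (simp add: \<tau>_def)
  have z\<eta>: "g v \<bullet> (e + \<epsilon> j *\<^sub>R n j) = \<eta> j" if "j < 5" for j
    using g_inner[of v "e + \<epsilon> j *\<^sub>R n j"] A(2)[OF that] by (simp add: \<eta>_def)
  have ee: "\<epsilon> j * \<epsilon> j = 1" if "j < 5" for j using eps[OF that] by auto
  have vm: "v \<bullet> m = \<tau> - \<alpha>" by (simp add: \<tau>_def \<alpha>_def inner_add_right)
  have zm: "g v \<bullet> m = \<beta> - \<tau>" using z\<tau> by (simp add: \<beta>_def inner_diff_right)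
  have vn: "v \<bullet> n j = \<epsilon> j * (\<eta> j - \<alpha>)" if "j < 5" for j
    using ee[OF that] by (simp add: \<eta>_def \<alpha>_def inner_add_right mult.assoc[symmetric])
  have zn: "g v \<bullet> n j = \<epsilon> j * (\<eta> j - \<beta>)" if "j < 5" for j
    using ee[OF that] by (simp add: z\<eta>[OF that, symmetric] \<beta>_def inner_add_right mult.assoc[symmetric])
  have trivial: "g v = v - (v \<bullet> m) *\<^sub>R m" if triv: "v \<in> {e + m, - (e + m)} \<or> g v = v"
  proof -
    have m2: "(e + m) \<bullet> m = 2" using f(1-3) by (simp add: inner_add_left)
    consider "g v = v" | "v = e + m" | "v = - (e + m)" using triv by blast
    then show ?thesis
    proof cases
      case 1
      then show ?thesis using fixed_orth_m by simp
    next
      case 2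
      have "e - m = (e + m) - (2::real) *\<^sub>R m" by (simp add: scaleR_2)
      then show ?thesis using gx unfolding 2 m2 by simp
    next
      case 3
      have "v \<bullet> m = -2" using m2 unfolding 3 by (simp only: inner_minus_left)
      moreover have "- (e - m) = - (e + m) - (-2::real) *\<^sub>R m" by (simp add: scaleR_2)
      moreover have "g v = - (e - m)" using gx g_minus[of "e + m"] unfolding 3 by simp
      ultimately show ?thesis using 3 by metis
    qed
  qed
  show ?thesis
  proof (cases "v \<in> {e + m, - (e + m)} \<or> g v = v")
    case True
    then show ?thesis using trivial by blast
  next
    case False
    have \<tau>1: "\<tau> = 1 \<or> \<tau> = -1"
      using K56_inner_cases[OF inK[OF v] inK[OF xV]] False unfolding \<tau>_def by (metis insertI1 insertI2 singletonI)
    have \<eta>1: "\<eta> j = 1 \<or> \<eta> j = -1" if j: "j < 5" for j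
    proof -
      have "v \<noteq> e + \<epsilon> j *\<^sub>R n j" "v \<noteq> - (e + \<epsilon> j *\<^sub>R n j)"
        using False A(2)[OF j] g_minus[of "e + \<epsilon> j *\<^sub>R n j"] by auto
      then show ?thesis
        using K56_inner_cases[OF inK[OF v] inK[OF A(1)[OF j]]] unfolding \<eta>_def by metis
    qed
    define T where "T = \<tau> + (\<Sum>j<5. \<eta> j)"
    have quad: "\<gamma> = 0 \<or> 4 * \<gamma> = T"
      if "3 = \<gamma>\<^sup>2 + (\<tau> - \<gamma>)\<^sup>2 / 2 + (\<Sum>j<5. (\<epsilon> j * (\<eta> j - \<gamma>))\<^sup>2) / 2" for \<gamma>
    proof -
      have "(\<epsilon> j * (\<eta> j - \<gamma>))\<^sup>2 = 1 - 2 * \<gamma> * \<eta> j + \<gamma>\<^sup>2" if "j < 5" for j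
        using eps[OF that] \<eta>1[OF that] by (auto simp: power2_eq_square algebra_simps)
      then have "(\<Sum>j<5. (\<epsilon> j * (\<eta> j - \<gamma>))\<^sup>2) = (\<Sum>j<5. 1 - 2 * \<gamma> * \<eta> j + \<gamma>\<^sup>2)" by (intro sum.cong) auto
      also have "\<dots> = 5 - 2 * \<gamma> * (\<Sum>j<5. \<eta> j) + 5 * \<gamma>\<^sup>2" unfolding sum_lessThan_5 by (simp add: algebra_simps)
      finally have s: "(\<Sum>j<5. (\<epsilon> j * (\<eta> j - \<gamma>))\<^sup>2) = 5 - 2 * \<gamma> * (\<Sum>j<5. \<eta> j) + 5 * \<gamma>\<^sup>2" .
      have t: "(\<tau> - \<gamma>)\<^sup>2 = 1 - 2 * \<gamma> * \<tau> + \<gamma>\<^sup>2" using \<tau>1 by (auto simp: power2_eq_square algebra_simps)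
      have "\<gamma> * (4 * \<gamma> - T) = 0" using that unfolding s t T_def by (simp add: field_simps power2_eq_square)
      then show ?thesis by auto
    qed
    have "3 = \<alpha>\<^sup>2 + (\<tau> - \<alpha>)\<^sup>2 / 2 + (\<Sum>j<5. (\<epsilon> j * (\<eta> j - \<alpha>))\<^sup>2) / 2"
      using f(9)[of v] norms(1)[OF v] vn by (simp add: vm \<alpha>_def[symmetric])
    then have \<alpha>: "\<alpha> = 0 \<or> 4 * \<alpha> = T" by (rule quad)
    have "3 = \<beta>\<^sup>2 + (\<tau> - \<beta>)\<^sup>2 / 2 + (\<Sum>j<5. (\<epsilon> j * (\<eta> j - \<beta>))\<^sup>2) / 2"
      using f(9)[of "g v"] norms(2)[OF v] zn by (simp add: zm \<beta>_def[symmetric] power2_commute)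
    then have \<beta>: "\<beta> = 0 \<or> 4 * \<beta> = T" by (rule quad)
    show ?thesis
    proof (cases "\<alpha> = \<beta>")
      case True
      have "g v = v - (v \<bullet> m) *\<^sub>R m"
      proof (rule root_frame_eqI[OF fr])
        have me: "m \<bullet> e = 0" using f(2) by (simp add: inner_commute)
        show "g v \<bullet> e = (v - (v \<bullet> m) *\<^sub>R m) \<bullet> e"
          using True by (simp add: inner_diff_left me \<alpha>_def \<beta>_def)
        show "g v \<bullet> m = (v - (v \<bullet> m) *\<^sub>R m) \<bullet> m"
          using True by (simp add: inner_diff_left f(3) vm zm)
        fix j :: nat assume j: "j < 5"
        have "m \<bullet> n j = 0" using f(7)[OF j] by (simp add: inner_commute)
        then show "g v \<bullet> n j = (v - (v \<bullet> m) *\<^sub>R m) \<bullet> n j"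
          using True by (simp add: inner_diff_left vn[OF j] zn[OF j])
      qed
      then show ?thesis ..
    next
      case ne: False
      define \<delta> where "\<delta> = T / 4"
      have ab: "\<alpha> = 0 \<and> \<beta> = \<delta> \<or> \<alpha> = \<delta> \<and> \<beta> = 0" and T0: "T \<noteq> 0" using \<alpha> \<beta> ne by (auto simp: \<delta>_def)
      have \<delta>1: "\<delta> = 1 \<or> \<delta> = -1"
      proof -
        have int: "w \<bullet> e \<in> {0, 1, -1, 2, -2, 3, -3}" if w: "w \<in> K56" for w
        proof -
          have "w \<bullet> e = (w \<bullet> (e + m) + w \<bullet> (e - m)) / 2" by (simp add: inner_add_right inner_diff_right)
          then show ?thesis using K56_inner[OF w inK[OF xV]] K56_inner[OF w yK] by (elim disjE) simp_all
        qed
        have "\<bar>T\<bar> \<le> 6"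
          using \<tau>1 \<eta>1[of 0] \<eta>1[of 1] \<eta>1[of 2] \<eta>1[of 3] \<eta>1[of 4] unfolding T_def sum_lessThan_5 by linarith
        then have "\<bar>\<delta>\<bar> \<le> 3/2" "\<delta> \<noteq> 0" using T0 by (auto simp: \<delta>_def)
        moreover have "\<delta> \<in> {0, 1, -1, 2, -2, 3, -3}"
          using int[OF inK[OF v]] int[OF gK[OF v]] ab unfolding \<alpha>_def[symmetric] \<beta>_def[symmetric] by metis
        ultimately show ?thesis by auto
      qed
      have sum4: "\<tau> + (\<eta> 0 + \<eta> 1 + \<eta> 2 + \<eta> 3 + \<eta> 4) = 4 * \<delta>" using \<delta>_def T_def by (simp add: sum_lessThan_5)
      have vz: "2 * (v \<bullet> g v) = - (\<tau> - \<alpha>) * (\<tau> - \<beta>) + (\<Sum>j<5. (\<eta> j - \<alpha>) * (\<eta> j - \<beta>))"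
      proof -
        have "(v \<bullet> n j) * (g v \<bullet> n j) = (\<eta> j - \<alpha>) * (\<eta> j - \<beta>)" if "j < 5" for j
          using ee[OF that] by (simp add: vn[OF that] zn[OF that] mult.assoc[symmetric])
        then have "(\<Sum>j<5. (v \<bullet> n j) * (g v \<bullet> n j)) = (\<Sum>j<5. (\<eta> j - \<alpha>) * (\<eta> j - \<beta>))" by (intro sum.cong) auto
        moreover have "(v \<bullet> e) * (g v \<bullet> e) = 0" using ab by (auto simp: \<alpha>_def \<beta>_def)
        ultimately have "2 * (v \<bullet> g v) = (\<tau> - \<alpha>) * (\<beta> - \<tau>) + (\<Sum>j<5. (\<eta> j - \<alpha>) * (\<eta> j - \<beta>))"
          using root_frame_inner[OF fr, of v "g v"] unfolding vm zm by simp
        then show ?thesis by (simp add: algebra_simps)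
      qed
      have \<tau>\<delta>: "\<tau> = - \<delta>"
      proof (rule ccontr)
        assume "\<tau> \<noteq> - \<delta>"
        then have \<tau>: "\<tau> = \<delta>" using \<tau>1 \<delta>1 by auto
        have "2 * (v \<bullet> g v) = (\<Sum>j<5. \<eta> j * (\<eta> j - \<delta>))" using vz ab \<tau> by (auto simp: mult.commute)
        also have "\<dots> = (\<Sum>j<5. 1 - \<delta> * \<eta> j)"
        proof (intro sum.cong refl)
          fix j assume "j \<in> {..<5::nat}"
          then have "\<eta> j * \<eta> j = 1" using \<eta>1[of j] by auto
          then show "\<eta> j * (\<eta> j - \<delta>) = 1 - \<delta> * \<eta> j" by (simp add: algebra_simps)
        qed
        also have "\<dots> = 5 - \<delta> * (\<eta> 0 + \<eta> 1 + \<eta> 2 + \<eta> 3 + \<eta> 4)" unfolding sum_lessThan_5 by (simp add: algebra_simps)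
        also have "\<eta> 0 + \<eta> 1 + \<eta> 2 + \<eta> 3 + \<eta> 4 = 3 * \<delta>" using sum4 \<tau> by simp
        also have "5 - \<delta> * (3 * \<delta>) = 2" using \<delta>1 by auto
        finally show False using not_1[OF v] by simp
      qed
      from ab show ?thesis
      proof
        assume a: "\<alpha> = 0 \<and> \<beta> = \<delta>"
        have "g v \<bullet> (e + m) = 3 * \<delta>" using zm a \<tau>\<delta> \<beta>_def by (simp add: inner_add_right)
        then show ?thesis using \<delta>1 norm3_eq(1,2)[OF norms(2)[OF v] norms(1)[OF xV]] by auto
      next
        assume a: "\<alpha> = \<delta> \<and> \<beta> = 0"
        have "v \<bullet> (e - m) = 3 * \<delta>" using vm a \<tau>\<delta> \<alpha>_def by (simp add: inner_diff_right)
        then show ?thesis using \<delta>1 norm3_eq(1,2)[OF norms(1)[OF v] K56_norm[OF yK]] by auto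
      qed
    qed
  qed
qed


text \<open>
  Now the exceptional vectors of the previous lemma are \<plusminus>(e + m) and \<plusminus>(e - m), which g permutes.
  All other vectors of V are fixed.
\<close>

lemma swapped_pair:
  assumes yV: "e - m \<in> V" and gy: "g (e - m) = e + m"
  shows "g ` V = V"
proof -
  have "g v \<in> V" if v: "v \<in> V" for v
  proof -
    have gm: "g (- (e + m)) = - (e - m)" "g (- (e - m)) = - (e + m)" using gx gy g_minus by metis+
    have V: "- (e + m) \<in> V" "- (e - m) \<in> V" using Vminus xV yV by blast+
    consider "g v = v" | "v = e + m" | "v = - (e + m)" | "v = e - m" | "v = - (e - m)" | "g v = e + m" | "g v = - (e + m)"
      using mirrored_or_exceptional[OF v] mirrored_shape[OF v] by blast
    then show ?thesis by cases (use V xV yV gx gy gm v in metis)+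
  qed
  then have "g ` V \<subseteq> V" by blast
  moreover have "inj_on g V" using g_eq_iff by (auto intro: inj_onI)
  ultimately show ?thesis using finite_V by (simp add: endo_inj_surj)
qed

text \<open>
  If g does not swap e + m and e - m, the inner product 1 allows to compose g with the reflection that
  exchanges e + m and g (e - m), after which it does.
\<close>

lemma image_of_partner:
  assumes yV: "e - m \<in> V"
  shows "g (e - m) = e + m \<or> (e + m) \<bullet> g (e - m) = 1"
proof -
  note f = root_frameD[OF fr]
  from obstruction obtain \<epsilon> where eps: "\<And>j. j < 5 \<Longrightarrow> \<epsilon> j = 1 \<or> \<epsilon> j = -1"
    and A: "\<And>j. j < 5 \<Longrightarrow> e + \<epsilon> j *\<^sub>R n j \<in> V" "\<And>j. j < 5 \<Longrightarrow> g (e + \<epsilon> j *\<^sub>R n j) = e + \<epsilon> j *\<^sub>R n j"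
    by metis
  define z where "z = g (e - m)"
  define \<beta> where "\<beta> = z \<bullet> e"
  have "z \<bullet> (e - m) = (e - m) \<bullet> (e + m)" using g_inner[of "e - m" "e + m"] gx by (simp add: z_def)
  also have "\<dots> = -1" using f(1-3) by (simp add: inner_add_right inner_diff_left inner_commute[of m e])
  finally have zm: "z \<bullet> m = \<beta> + 1" by (simp add: \<beta>_def inner_diff_right)
  have zn: "(z \<bullet> n j)\<^sup>2 = (1 - \<beta>)\<^sup>2" if j: "j < 5" for j
  proof -
    have "z \<bullet> (e + \<epsilon> j *\<^sub>R n j) = (e - m) \<bullet> (e + \<epsilon> j *\<^sub>R n j)"
      using g_inner[of "e - m" "e + \<epsilon> j *\<^sub>R n j"] A(2)[OF j] by (simp add: z_def)
    also have "\<dots> = 1" using f(1,2) f(6,7)[OF j]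
      by (simp add: inner_add_right inner_diff_left inner_commute[of m] inner_commute[of e "n j"])
    finally have "\<epsilon> j * (z \<bullet> n j) = 1 - \<beta>" by (simp add: \<beta>_def inner_add_right)
    moreover have "(z \<bullet> n j)\<^sup>2 = (\<epsilon> j * (z \<bullet> n j))\<^sup>2" using eps[OF j] by auto
    ultimately show ?thesis by simp
  qed
  have "z \<bullet> z = 3" using norms(2)[OF yV] by (simp add: z_def)
  then have "3 = \<beta>\<^sup>2 + (\<beta> + 1)\<^sup>2 / 2 + 5 * (1 - \<beta>)\<^sup>2 / 2"
    using f(9)[of z] zn by (simp add: zm \<beta>_def[symmetric])
  then have "\<beta> * (\<beta> - 1) = 0" by (simp add: power2_eq_square field_simps)
  then have "\<beta> = 0 \<or> \<beta> = 1" by simp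
  moreover have "(e + m) \<bullet> z = 2 * \<beta> + 1" using zm by (simp add: inner_commute[of _ z] inner_add_right \<beta>_def)
  ultimately show ?thesis
    using norm3_eq(1)[OF norms(1)[OF xV] norms(2)[OF yV]] by (auto simp: z_def)
qed

text \<open>
  Here g reflects V in the hyperplane orthogonal to m, and this reflection is not a symmetry of K56. But
  changing the signs of both m and n_j is a symmetry, a product of two reflections in vectors m \<plusminus> n_j. It
  differs from g on V only in that it swaps e + n_j and e - n_j, and both of them belong to V.
\<close>

lemma doubled_root:
  assumes mirror: "\<And>v. v \<in> V \<Longrightarrow> v \<in> {e + m, - (e + m)} \<or> g v = v"
    and j: "j < 5" "e + n j \<in> V" "e - n j \<in> V"
  shows "\<exists>h\<in>sym56. h ` V = g ` V"
proof -
  note f = root_frameD[OF fr]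
  define k l where "k = e + n j" and "l = e - n j"
  have ip: "e \<bullet> e = 1" "m \<bullet> m = 2" "n j \<bullet> n j = 2" "e \<bullet> m = 0" "m \<bullet> e = 0" "e \<bullet> n j = 0" "n j \<bullet> e = 0" "m \<bullet> n j = 0" "n j \<bullet> m = 0"
    using f(1-3) f(6,7)[OF j(1)] f(8)[OF j(1,1)] by (auto simp: inner_commute)
  \<comment> \<open>the product of the reflections in m - n_j and m + n_j, which changes the signs of m and n_j\<close>
  define h where "h z = refl_along (e + m - l) (refl_along (e + m - k) z)" for z
  have h: "h \<in> sym56"
    unfolding h_def
    by (rule sym56_comp[OF sym56_refl_along sym56_refl_along])
       (use xV j(2,3) inK ip in \<open>auto simp: k_def l_def inner_add_left inner_add_right inner_diff_left inner_diff_right\<close>)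
  have r: "refl_along (m + n j) z = z - ((z \<bullet> m + z \<bullet> n j) / 2) *\<^sub>R (m + n j)"
    "refl_along (m - n j) z = z - ((z \<bullet> m - z \<bullet> n j) / 2) *\<^sub>R (m - n j)" for z
    by (auto simp: refl_along_def inner_add_left inner_add_right inner_diff_left inner_diff_right ip)
  have el: "e + m - l = m + n j" "e + m - k = m - n j" by (auto simp: k_def l_def)
  have h_eq: "h z = z - (z \<bullet> m) *\<^sub>R m - (z \<bullet> n j) *\<^sub>R n j" for z
    unfolding h_def el r by (simp add: inner_diff_left inner_diff_right inner_add_right ip algebra_simps)
      (simp add: scaleR_add_left[symmetric] add_divide_distrib[symmetric] field_simps scaleR_2[symmetric])
  have hx: "h (e + m) = e - m" "h (- (e + m)) = - (e - m)" "h k = l" "h l = k" "h (- k) = - l" "h (- l) = - k"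
    unfolding h_eq k_def l_def by (simp_all add: inner_add_left inner_diff_left ip scaleR_2)
  have other: "h v = v" if v: "v \<in> V" "g v = v" "v \<notin> {k, l, - k, - l}" for v
  proof -
    have vm: "v \<bullet> m = 0" using v(2) by (rule fixed_orth_m)
    have "v \<bullet> n j = 0"
      using orthogonal_to_frame_root(1)[OF fr inK[OF xV] yK inK[OF v(1)] vm j(1)] v(3) by (auto simp: k_def l_def)
    with vm show ?thesis by (simp add: h_eq)
  qed
  have kl: "k \<in> V" "l \<in> V" "- k \<in> V" "- l \<in> V" using j(2,3) Vminus unfolding k_def l_def by blast+
  have nk: "k \<bullet> m = 0" "l \<bullet> m = 0" by (auto simp: k_def l_def inner_add_left inner_diff_left ip)
  have fix_kl: "g k = k" "g l = l"
    using mirror[OF kl(1)] mirror[OF kl(2)] nk ip by (auto simp: inner_add_left inner_diff_left)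
  then have fix_kl': "g (- k) = - k" "g (- l) = - l" by (simp_all add: g_minus)
  have "h v \<in> g ` V" if v: "v \<in> V" for v
  proof -
    consider "v = e + m" | "v = - (e + m)" | "v = k" | "v = l" | "v = - k" | "v = - l" | "g v = v" "v \<notin> {k, l, - k, - l}"
      using mirror[OF v] by blast
    then have "\<exists>u\<in>V. h v = g u"
      by cases (use hx gx g_minus[of "e + m"] xV Vminus[OF xV] fix_kl fix_kl' kl other[OF v] v in metis)+
    then show ?thesis by auto
  qed
  then have "h ` V \<subseteq> g ` V" by blast
  moreover have "card (h ` V) = card (g ` V)"
    using card_image[of h V] card_image[of g V] orthogonal_transformation_inj[OF sym56D(1)[OF h]]
      orthogonal_transformation_inj[OF g] by (simp add: inj_on_subset)
  ultimately have "h ` V = g ` V" using finite_V by (intro card_subset_eq) auto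
  with h show ?thesis by blast
qed

text \<open>
  Now V consists of the six lines through e + m and the a_j = e + \<epsilon>_j n_j, and g replaces e + m by e - m. A vector of
  K56 that has inner product 1 with all six is orthogonal to e, by Parseval, and must be
  (m + \<epsilon>_0 n_0 + ... + \<epsilon>_4 n_4)/2; for the image of V it is (-m + \<epsilon>_0 n_0 + ... + \<epsilon>_4 n_4)/2. These two
  have inner product 2, so they cannot both lie in K56; one of them does by the last clause of the
  definition of a root frame.
\<close>

lemma unpaired_hexad:
  assumes mirror: "\<And>v. v \<in> V \<Longrightarrow> v \<in> {e + m, - (e + m)} \<or> g v = v"
    and single: "\<And>j. j < 5 \<Longrightarrow> \<not> (e + n j \<in> V \<and> e - n j \<in> V)"
  shows "card V = 12 \<and> \<not> has_triad V \<and> extendable V \<noteq> extendable (g ` V)"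
proof -
  note f = root_frameD[OF fr]
  from obstruction obtain \<epsilon> where eps: "\<And>j. j < 5 \<Longrightarrow> \<epsilon> j = 1 \<or> \<epsilon> j = -1"
    and A: "\<And>j. j < 5 \<Longrightarrow> e + \<epsilon> j *\<^sub>R n j \<in> V" "\<And>j. j < 5 \<Longrightarrow> g (e + \<epsilon> j *\<^sub>R n j) = e + \<epsilon> j *\<^sub>R n j"
    by metis
  have e2: "\<epsilon> i * \<epsilon> i = 1" if "i < 5" for i using eps[OF that] by auto
  define b where "b j = (if j < 5 then e + \<epsilon> j *\<^sub>R n j else e + m)" for j :: nat
  have b_lt: "b j = e + \<epsilon> j *\<^sub>R n j" if "j < 5" for j using that by (simp add: b_def)
  have b5: "b 5 = e + m" by (simp add: b_def)
  have bV: "b j \<in> V" for j using A(1) xV by (simp add: b_def)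
  have six: "j < 6 \<longleftrightarrow> j < 5 \<or> j = 5" for j :: nat by auto
  have V: "V = signed_set b 6"
  proof
    show "signed_set b 6 \<subseteq> V" using bV Vminus by (auto simp: signed_set_def)
    show "V \<subseteq> signed_set b 6"
    proof
      fix v assume v: "v \<in> V"
      have 5: "e + m \<in> signed_set b 6" "- (e + m) \<in> signed_set b 6"
        using signed_setI[of 5 6 b] by (simp_all add: b5)
      show "v \<in> signed_set b 6"
      proof (cases "v \<in> {e + m, - (e + m)}")
        case True then show ?thesis using 5 by blast
      next
        case False
        then have "g v = v" using mirror[OF v] by blast
        then obtain j where j: "j < 5" "v \<in> {e + n j, e - n j, - (e + n j), - (e - n j)}"
          using fixed_shape[OF v fixed_orth_m] by blast
        have nv: "- v \<in> V" using Vminus[OF v] .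
        from j(2) obtain w where w: "w \<in> {e + n j, e - n j}" "v = w \<or> v = - w" by blast
        have "w \<in> V" using w(2) v nv by auto
        then have "w = e + \<epsilon> j *\<^sub>R n j"
          using w(1) eps[OF j(1)] A(1)[OF j(1)] single[OF j(1)] by auto
        then have "v = e + \<epsilon> j *\<^sub>R n j \<or> v = - (e + \<epsilon> j *\<^sub>R n j)" using w(2) by blast
        then show ?thesis using signed_setI[of j 6 b] j(1) by (auto simp: b_lt)
      qed
    qed
  qed
  have ip: "e \<bullet> e = 1" "m \<bullet> m = 2" "e \<bullet> m = 0" "m \<bullet> e = 0" using f(1-3) by (auto simp: inner_commute)
  have ipn: "e \<bullet> n j = 0" "n j \<bullet> e = 0" "m \<bullet> n j = 0" "n j \<bullet> m = 0" if "j < 5" for j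
    using f(6,7)[OF that] by (auto simp: inner_commute)
  have bb: "b i \<bullet> b j = (if i = j then 3 else 1)" if "i < 6" "j < 6" for i j
    using that e2 unfolding six
    by (elim disjE) (auto simp: b_lt b5 inner_add_left inner_add_right ip ipn f(8))
  have gb: "g (b i) \<bullet> g (b j) = (if i = j then 3 else 1)" if "i < 6" "j < 6" for i j
    using bb[OF that] g_inner by simp
  have gV: "g ` V = signed_set (\<lambda>i. g (b i)) 6"
    unfolding V signed_set_def by (auto simp: image_Un image_image g_minus)
  have gb_lt: "g (b j) = b j" if "j < 5" for j using A(2) that by (simp add: b_lt)
  have gb5: "g (b 5) = e - m" by (simp add: b5 gx)
  note extV = extendable_signed_set[of 6 b, OF bb _ inK[OF bV], folded V]
  note extgV = extendable_signed_set[of 6 "\<lambda>i. g (b i)", OF gb _ gK[OF bV], folded gV]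
  \<comment> \<open>coordinates of a vector that completes one of the two systems\<close>
  have coord: "k \<bullet> m = \<sigma> \<and> (\<forall>j<5. k \<bullet> n j = \<epsilon> j)"
    if k: "k \<in> K56" and k1: "\<And>j. j < 5 \<Longrightarrow> k \<bullet> b j = 1" and k2: "k \<bullet> (e + \<sigma> *\<^sub>R m) = 1" and s: "\<sigma> = 1 \<or> \<sigma> = -1" for k \<sigma>
  proof -
    define \<alpha> where "\<alpha> = k \<bullet> e"
    have kn: "\<epsilon> j * (k \<bullet> n j) = 1 - \<alpha>" if "j < 5" for j
      using k1[OF that] by (simp add: b_lt[OF that] inner_add_right \<alpha>_def)
    have kn2: "(k \<bullet> n j)\<^sup>2 = (1 - \<alpha>)\<^sup>2" if "j < 5" for j
    proof -
      have "(k \<bullet> n j)\<^sup>2 = (\<epsilon> j * (k \<bullet> n j))\<^sup>2" using eps[OF that] by auto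
      then show ?thesis unfolding kn[OF that] .
    qed
    have km: "\<sigma> * (k \<bullet> m) = 1 - \<alpha>" using k2 by (simp add: inner_add_right \<alpha>_def)
    have "(k \<bullet> m)\<^sup>2 = (\<sigma> * (k \<bullet> m))\<^sup>2" using s by auto
    then have "(k \<bullet> m)\<^sup>2 = (1 - \<alpha>)\<^sup>2" unfolding km .
    then have "3 = \<alpha>\<^sup>2 + (1 - \<alpha>)\<^sup>2 / 2 + 5 * (1 - \<alpha>)\<^sup>2 / 2"
      using f(9)[of k] K56_norm[OF k] kn2 by (simp add: \<alpha>_def[symmetric])
    then have "\<alpha> * (2 * \<alpha> - 3) = 0" by (simp add: power2_eq_square field_simps)
    then have "\<alpha> = 0 \<or> 2 * \<alpha> = 3" by auto
    moreover have "2 * \<alpha> = k \<bullet> (e + m) + k \<bullet> (e - m)" by (simp add: \<alpha>_def inner_add_right inner_diff_right)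
    then have "2 * \<alpha> \<noteq> 3" using K56_inner[OF k inK[OF xV]] K56_inner[OF k yK] by auto
    ultimately have a: "\<alpha> = 0" by blast
    have "k \<bullet> m = \<sigma>" using km s a by auto
    moreover have "k \<bullet> n j = \<epsilon> j" if "j < 5" for j using kn[OF that] eps[OF that] a by auto
    ultimately show ?thesis by blast
  qed
  have not_both: False if ex: "extendable V" "extendable (g ` V)"
  proof -
    obtain k where k: "k \<in> K56" "\<forall>i<6. k \<bullet> b i = 1" using extV ex(1) by auto
    obtain l where l: "l \<in> K56" "\<forall>i<6. l \<bullet> g (b i) = 1" using extgV ex(2) by auto
    have "k \<bullet> m = 1 \<and> (\<forall>j<5. k \<bullet> n j = \<epsilon> j)"
      by (rule coord[OF k(1)]) (use k(2)[rule_format, of 5] k(2) in \<open>simp_all add: b5\<close>)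
    moreover have "l \<bullet> m = -1 \<and> (\<forall>j<5. l \<bullet> n j = \<epsilon> j)"
      by (rule coord[OF l(1)]) (use l(2)[rule_format, of 5] l(2) gb_lt in \<open>auto simp: gb5 six\<close>)
    ultimately have "k \<bullet> l = (k \<bullet> e) * (l \<bullet> e) - 1 / 2 + (\<Sum>j<5. \<epsilon> j * \<epsilon> j) / 2"
      using root_frame_inner[OF fr, of k l] by simp
    also have "(\<Sum>j<5. \<epsilon> j * \<epsilon> j) = (\<Sum>j<(5::nat). 1)" using e2 by (intro sum.cong) auto
    finally have "k \<bullet> l = (k \<bullet> e) * (l \<bullet> e) + 2" by simp
    moreover have "k \<bullet> e = 0"
    proof -
      have "k \<bullet> b 5 = 1" "k \<bullet> m = 1" using k(2) \<open>k \<bullet> m = 1 \<and> _\<close> by auto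
      then show ?thesis by (simp add: b5 inner_add_right)
    qed
    ultimately show False using K56_inner[OF k(1) l(1)] by simp
  qed
  have one: "extendable V \<or> extendable (g ` V)"
  proof -
    define u where "u = (\<Sum>j<5. \<epsilon> j *\<^sub>R n j)"
    have ue: "u \<bullet> e = 0" "u \<bullet> m = 0"
      by (auto simp: u_def inner_sum_left ipn)
    have un: "u \<bullet> n i = 2 * \<epsilon> i" if "i < 5" for i
    proof -
      have "u \<bullet> n i = (\<Sum>j<5. \<epsilon> j * (n j \<bullet> n i))" by (simp add: u_def inner_sum_left)
      also have "\<dots> = (\<Sum>j<5. if j = i then 2 * \<epsilon> i else 0)" using that by (intro sum.cong) (auto simp: f(8))
      finally show ?thesis using that by simp
    qed
    have kb: "((1/2) *\<^sub>R (\<sigma> *\<^sub>R m + u)) \<bullet> b i = 1" if "i < 5" for i \<sigma>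
      using that e2[OF that] by (simp add: b_lt inner_add_left inner_add_right ue un ip ipn)
    have k5: "((1/2) *\<^sub>R (m + u)) \<bullet> (e + m) = 1" "((1/2) *\<^sub>R (- m + u)) \<bullet> (e - m) = 1"
      by (simp_all add: inner_add_left inner_add_right inner_diff_left inner_diff_right ue ip)
    from f(10)[of \<epsilon>] eps consider "(1/2) *\<^sub>R (m + u) \<in> K56" | "(1/2) *\<^sub>R (- m + u) \<in> K56"
      unfolding u_def by blast
    then show ?thesis
    proof cases
      case 1
      then have "\<exists>k\<in>K56. \<forall>i<6. k \<bullet> b i = 1"
        using kb[of _ 1] k5(1) by (intro bexI[OF _ 1]) (auto simp: six b5)
      then show ?thesis using extV bV by simp
    next
      case 2
      then have "\<exists>k\<in>K56. \<forall>i<6. k \<bullet> g (b i) = 1"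
        using kb[of _ "-1"] k5(2) by (intro bexI[OF _ 2]) (auto simp: six gb5 gb_lt)
      then show ?thesis using extgV bV by simp
    qed
  qed
  have "card V = 12" "\<not> has_triad V"
    using signed_set_props(2,3)[of 6 b, OF bb] unfolding V[symmetric] by simp_all
  then show ?thesis using not_both one by blast
qed

end

lemma nonfixed_frame:
  assumes x: "x \<in> V" "g x \<noteq> x"
  obtains e m n where "x = e + m" "g x = e - m" "root_frame e m n"
  using root_frame_exists[OF inK[OF x(1)] gK[OF x(1)] nonfixed_inner[OF x]] by blast

text \<open>
  If a vector of V is moved inside V, it can be assumed to be swapped with its image, and then g maps V to
  itself. If no vector is moved inside V, then g moves only one line of V, since each exceptional vector of
  \<open>mirrored_or_exceptional\<close> would give a vector moved inside V. In that case \<open>doubled_root\<close> produces the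
  symmetry, unless V is the system of \<open>unpaired_hexad\<close>.
\<close>

lemma image_by_symmetry:
  "(\<exists>h\<in>sym56. h ` V = g ` V) \<or> card V = 12 \<and> \<not> has_triad V \<and> extendable V \<noteq> extendable (g ` V)"
proof (cases "\<exists>x\<in>V. g x \<noteq> x \<and> g x \<in> V")
  case True
  then obtain x where x: "x \<in> V" "g x \<noteq> x" "g x \<in> V" by blast
  obtain e m n where fr: "x = e + m" "g x = e - m" "root_frame e m n" using nonfixed_frame[OF x(1,2)] .
  have xV: "e + m \<in> V" "g (e + m) = e - m" "e - m \<in> V" using x fr by auto
  show ?thesis
  proof (cases "g (e - m) = e + m")
    case True
    then have "g ` V = V" by (rule swapped_pair[OF fr(3) xV])
    then show ?thesis by (intro disjI1 bexI[OF _ sym56_id]) simp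
  next
    case False
    define z where "z = g (e - m)"
    \<comment> \<open>this symmetry keeps all fixed vectors of g, so the composite is maximal as well\<close>
    define s where "s = refl_along ((e + m) - z)"
    have xz: "(e + m) \<bullet> z = 1" using image_of_partner[OF fr(3) xV] False by (simp add: z_def)
    have zK: "z \<in> K56" using gK xV(3) by (simp add: z_def)
    have s: "s \<in> sym56" unfolding s_def by (rule sym56_refl_along[OF inK[OF xV(1)] zK xz])
    have s_fix: "s a = a" if "g a = a" for a
      unfolding s_def
    proof (rule refl_fixes)
      have "a \<bullet> z = a \<bullet> (e - m)" using fixed_inner[OF that] by (simp add: z_def)
      also have "\<dots> = a \<bullet> (e + m)" using fixed_inner[OF that, of "e + m"] xV(2) by simp
      finally show "a \<bullet> (e + m) = a \<bullet> z" by simp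
    qed
    have "z \<bullet> (e - m) = (e - m) \<bullet> (e + m)" using g_inner[of "e - m" "e + m"] xV(2) by (simp add: z_def)
    then have sy: "s (e - m) = e - m"
      unfolding s_def by (intro refl_fixes) (simp add: inner_commute)
    have sz: "s z = e + m"
      unfolding s_def by (rule refl_along_swap2) (simp add: K56_norm[OF inK[OF xV(1)]] K56_norm[OF zK])
    interpret s: maximal_isometry V "\<lambda>v. s (g v)"
    proof
      show "orthogonal_transformation (\<lambda>v. s (g v))"
        using sym56D(1)[OF s] g by (rule orthogonal_transformation_comp)
      show "s (g v) \<in> K56" if "v \<in> V" for v using sym56D(3)[OF s] gK[OF that] .
      fix s' assume s': "s' \<in> sym56"
      have "card {v \<in> V. s' (s (g v)) = v} \<le> card {v \<in> V. g v = v}"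
        by (rule maximal) (rule sym56_comp[OF s' s])
      also have "\<dots> \<le> card {v \<in> V. s (g v) = v}"
        using finite_V s_fix by (intro card_mono) auto
      finally show "card {v \<in> V. s' (s (g v)) = v} \<le> card {v \<in> V. s (g v) = v}" .
    qed (use VK Vminus in auto)
    have sgV: "(\<lambda>v. s (g v)) ` V = V"
      by (rule s.swapped_pair[OF fr(3) xV(1) _ xV(3)]) (use xV sy sz in \<open>auto simp: z_def\<close>)
    obtain t where t: "t \<in> sym56" "\<And>x. t (s x) = x" using sym56_inv[OF s] by metis
    have "t ` (\<lambda>v. s (g v)) ` V = g ` V" using t(2) by (simp add: image_image)
    then have "t ` V = g ` V" unfolding sgV .
    then show ?thesis using t(1) by blast
  qed
next
  case no: False
  show ?thesis
  proof (cases "\<forall>x\<in>V. g x = x")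
    case True
    then have "g ` V = V" by simp
    then show ?thesis by (intro disjI1 bexI[OF _ sym56_id]) simp
  next
    case False
    then obtain x where x: "x \<in> V" "g x \<noteq> x" by blast
    obtain e m n where fr: "x = e + m" "g x = e - m" "root_frame e m n" using nonfixed_frame[OF x] .
    have xV: "e + m \<in> V" "g (e + m) = e - m" using x fr by auto
    have yV: "e - m \<notin> V" using no x fr by metis
    then have yV': "- (e - m) \<notin> V" using Vminus[of "- (e - m)"] by auto
    have xy: "e + m \<noteq> e - m" using m_nz[OF fr(3) xV] by blast
    have to_x: False if v: "v \<in> V" "g v = e + m" for v
    proof -
      have "g v \<noteq> v"
      proof
        assume "g v = v"
        then have "v = e + m" using v(2) by simp
        then show False using xV(2) v(2) xy by simp
      qed
      then show False using no v xV(1) by metis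
    qed
    \<comment> \<open>an exceptional vector would be a vector moved inside V\<close>
    have mirror: "v \<in> {e + m, - (e + m)} \<or> g v = v" if v: "v \<in> V" for v
    proof -
      have "g v \<noteq> e + m" using to_x v by blast
      moreover have "g v \<noteq> - (e + m)" using to_x[OF Vminus[OF v]] g_minus[of v] by auto
      ultimately have "g v = v - (v \<bullet> m) *\<^sub>R m"
        using mirrored_or_exceptional[OF fr(3) xV v] v yV yV' by blast
      then show ?thesis using mirrored_shape[OF fr(3) xV v] v yV yV' by blast
    qed
    show ?thesis
    proof (cases "\<exists>j<5. e + n j \<in> V \<and> e - n j \<in> V")
      case True
      then show ?thesis using doubled_root[OF fr(3) xV mirror] by blast
    next
      case False
      then show ?thesis using unpaired_hexad[OF fr(3) xV mirror] by blast
    qed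
  qed
qed

end

theorem isometric_subsets_of_K56:
  assumes V: "V \<subseteq> K56" "\<And>v. v \<in> V \<Longrightarrow> - v \<in> V"
    and g: "orthogonal_transformation g" "g ` V \<subseteq> K56"
  shows "(\<exists>h\<in>sym56. h ` V = g ` V) \<or> card V = 12 \<and> \<not> has_triad V \<and> extendable V \<noteq> extendable (g ` V)"
proof -
  have fin: "finite V" using V(1) finite_K56 by (rule finite_subset)
  let ?F = "\<lambda>s. card {v \<in> V. s (g v) = v}"
  have "?F s < Suc (card V)" if "s \<in> sym56" for s using fin by (simp add: card_mono less_Suc_eq_le)
  then obtain s where s: "s \<in> sym56" "\<And>s'. s' \<in> sym56 \<Longrightarrow> ?F s' \<le> ?F s"
    using ex_has_greatest_nat[of "\<lambda>s. s \<in> sym56" "\<lambda>x. x" ?F "Suc (card V)"] sym56_id by blast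
  interpret maximal_isometry V "\<lambda>v. s (g v)"
  proof
    show "orthogonal_transformation (\<lambda>v. s (g v))"
      using sym56D(1)[OF s(1)] g(1) by (rule orthogonal_transformation_comp)
    show "s (g v) \<in> K56" if "v \<in> V" for v using sym56D(3)[OF s(1)] g(2) that by blast
    show "?F (\<lambda>v. s' (s v)) \<le> ?F s" if "s' \<in> sym56" for s'
      using s(2)[OF sym56_comp[OF that s(1)]] .
  qed (use V in auto)
  obtain t where t: "t \<in> sym56" "\<And>x. t (s x) = x" using sym56_inv[OF s(1)] by metis
  have i: "(\<lambda>v. s (g v)) ` V = s ` g ` V" by (simp add: image_image)
  have "extendable (s ` g ` V) = extendable (g ` V)" using s(1) by (rule extendable_sym56)
  moreover have "\<exists>h\<in>sym56. h ` V = g ` V" if h: "h \<in> sym56" "h ` V = s ` g ` V" for h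
  proof
    show "(\<lambda>x. t (h x)) \<in> sym56" using t(1) h(1) by (rule sym56_comp)
    have "(\<lambda>x. t (h x)) ` V = t ` h ` V" by (simp add: image_image)
    also have "\<dots> = g ` V" unfolding h(2) using t(2) by (simp add: image_image)
    finally show "(\<lambda>x. t (h x)) ` V = g ` V" .
  qed
  ultimately show ?thesis using image_by_symmetry unfolding i by blast
qed

section \<open>Embedding every system\<close>

lemma independent_if_gram_positive:
  fixes B :: "'a::real_inner set"
  assumes b: "\<And>x y. x \<in> B \<Longrightarrow> y \<in> B \<Longrightarrow> x \<bullet> y = (if x = y then 3 else 1)"
  shows "independent B"
proof
  assume "dependent B"
  then obtain S u where S: "finite S" "S \<subseteq> B" "\<exists>v\<in>S. u v \<noteq> 0" "(\<Sum>v\<in>S. u v *\<^sub>R v) = 0"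
    unfolding dependent_explicit by blast
  define s where "s = sum u S"
  have u: "2 * u y + s = 0" if y: "y \<in> S" for y
  proof -
    have "0 = (\<Sum>v\<in>S. u v *\<^sub>R v) \<bullet> y" using S(4) by simp
    also have "\<dots> = (\<Sum>v\<in>S. u v * (v \<bullet> y))" by (simp add: inner_sum_left)
    also have "\<dots> = (\<Sum>v\<in>S. u v + (if v = y then 2 * u y else 0))"
    proof (intro sum.cong refl)
      fix v assume "v \<in> S"
      then have "v \<in> B" "y \<in> B" using S(2) y by auto
      then show "u v * (v \<bullet> y) = u v + (if v = y then 2 * u y else 0)" using b[of v y] by simp
    qed
    also have "\<dots> = s + 2 * u y" using S(1) y by (simp add: sum.distrib s_def)
    finally show ?thesis by simp
  qed
  \<comment> \<open>the sum of the equations for all y in S shows that s = 0\<close>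
  have "2 * s + of_nat (card S) * s = (\<Sum>y\<in>S. 2 * u y + s)"
    by (simp add: sum.distrib s_def sum_distrib_left)
  also have "\<dots> = 0" using u by simp
  finally have "(2 + of_nat (card S)) * s = 0" by (simp add: algebra_simps)
  then have "s = 0" by (simp add: add_nonneg_eq_0_iff)
  then show False using u S(3) by auto
qed

text \<open>
  Choose the signs such that all vectors have inner product 1 with a fixed one. Two vectors x, y with
  x \<bullet> y = -1 would then form a triad with the negative of the fixed one. The vectors are linearly
  independent, as their Gram matrix is 2I + J, which bounds their number by 7.
\<close>

lemma triad_free_system:
  fixes V :: "(real ^ 7) set"
  assumes V: "line_system V" and nt: "\<not> has_triad V"
  obtains b N where "V = signed_set b N" "N \<le> 7" "\<And>i j. i < N \<Longrightarrow> j < N \<Longrightarrow> b i \<bullet> b j = (if i = j then 3 else 1)"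
proof (cases "V = {}")
  case True
  then show thesis using that[of "\<lambda>_. 0" 0] by (simp add: signed_set_def)
next
  case False
  then obtain x0 where x0: "x0 \<in> V" by blast
  note l = line_systemD[OF V]
  define B where "B = {x \<in> V. x \<bullet> x0 = 1 \<or> x = x0}"
  have BV: "B \<subseteq> V" by (auto simp: B_def)
  have ip: "x \<bullet> y = (if x = y then 3 else 1)" if xy: "x \<in> B" "y \<in> B" for x y
  proof -
    have v: "x \<in> V" "y \<in> V" using xy by (auto simp: B_def)
    have d: "x \<bullet> x0 = 1 \<or> x = x0" "y \<bullet> x0 = 1 \<or> y = x0" using xy by (auto simp: B_def)
    have "x \<bullet> y \<noteq> -1"
    proof
      assume i: "x \<bullet> y = -1"
      then have "x \<noteq> x0" "y \<noteq> x0" using d l(2)[OF x0] by (auto simp: inner_commute)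
      then have "x \<bullet> (- x0) = -1" "y \<bullet> (- x0) = -1" using d by auto
      then show False using i v l(1)[OF x0] nt unfolding has_triad_def by blast
    qed
    moreover have "x \<noteq> - y"
    proof
      assume "x = - y"
      then have "x \<bullet> x0 = - (y \<bullet> x0)" by simp
      then show False using d l(2)[OF x0] by auto
    qed
    ultimately show ?thesis
      using l(2)[OF v(1)] l(3)[OF v] norm3_eq[OF l(2)[OF v(1)] l(2)[OF v(2)]] by auto
  qed
  have "independent B" using ip by (rule independent_if_gram_positive)
  then have B: "finite B" "card B \<le> 7" using independent_bound[of B] by auto
  obtain b where b: "bij_betw b {0..<card B} B" using ex_bij_betw_nat_finite[OF B(1)] by blast
  have bB: "b ` {..<card B} = B" using b by (simp add: bij_betw_def atLeast0LessThan)
  have Vb: "V = signed_set b (card B)"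
  proof
    show "signed_set b (card B) \<subseteq> V" unfolding signed_set_def using bB BV l(1) by blast
    show "V \<subseteq> signed_set b (card B)"
    proof
      fix v assume v: "v \<in> V"
      have "v \<in> B \<or> - v \<in> B"
        using l(1)[OF v] v l(3)[OF v x0] norm3_eq[OF l(2)[OF v] l(2)[OF x0]] by (auto simp: B_def)
      then show "v \<in> signed_set b (card B)"
      proof
        assume "v \<in> B"
        then show ?thesis unfolding signed_set_def bB by blast
      next
        assume "- v \<in> B"
        then obtain i where "i < card B" "- v = b i" using bB by blast
        then have "v = - b i" by (metis minus_minus)
        then show ?thesis using \<open>i < card B\<close> by (auto simp: signed_set_def)
      qed
    qed
  qed
  have "b i \<bullet> b j = (if i = j then 3 else 1)" if ij: "i < card B" "j < card B" for i j
  proof -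
    have "b i \<in> B" "b j \<in> B" using bB ij by blast+
    moreover have "b i = b j \<longleftrightarrow> i = j" using b ij by (auto simp: bij_betw_def inj_on_def)
    ultimately show ?thesis using ip by simp
  qed
  with that Vb B(2) show thesis by blast
qed

lemma signed_set_isometric:
  fixes b c :: "nat \<Rightarrow> 'a::real_inner"
  assumes "\<And>i j. i < N \<Longrightarrow> j < N \<Longrightarrow> b i \<bullet> b j = c i \<bullet> c j"
  obtains f where "orthogonal_transformation f" "f ` signed_set b N = signed_set c N"
proof -
  obtain f where f: "orthogonal_transformation f" "\<And>i. i < N \<Longrightarrow> f (b i) = c i"
    using gram_extension[of "{..<N}" b c] assms by auto
  have "f ` signed_set b N = signed_set c N"
    unfolding signed_set_def image_Un image_image
    using f(2) orthogonal_transformation_minus[OF f(1)] by (intro arg_cong2[of _ _ _ _ "(\<union>)"] image_cong) auto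
  with f(1) that show thesis by blast
qed

text \<open>
  Two lines of the Fano plane meet in one point, so the characteristic vectors of the lines have inner
  product 1. They are the model of a triad-free system.
\<close>

definition fano_basis :: "nat \<Rightarrow> real ^ 7" where
  "fano_basis i = [vec7 1 1 1 0 0 0 0, vec7 1 0 0 1 1 0 0, vec7 1 0 0 0 0 1 1, vec7 0 1 0 1 0 1 0,
     vec7 0 1 0 0 1 0 1, vec7 0 0 1 1 0 0 1, vec7 0 0 1 0 1 1 0] ! i"

lemma fano_basis:
  assumes "i < 7"
  shows "fano_basis i \<in> K56" "j < 7 \<Longrightarrow> fano_basis i \<bullet> fano_basis j = (if i = j then 3 else 1)"
proof -
  have l: "k = 0 \<or> k = 1 \<or> k = 2 \<or> k = 3 \<or> k = 4 \<or> k = 5 \<or> k = 6" if "k < 7" for k :: nat using that by auto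
  show "fano_basis i \<in> K56" using l[OF assms] by (elim disjE) (simp_all add: fano_basis_def K56_intros)
  assume "j < 7"
  show "fano_basis i \<bullet> fano_basis j = (if i = j then 3 else 1)"
    using l[OF assms] l[OF \<open>j < 7\<close>] by (elim disjE; hypsubst) (simp_all add: fano_basis_def)
qed

lemma embed_triad_free:
  fixes V :: "(real ^ 7) set"
  assumes "line_system V" "\<not> has_triad V"
  shows "\<exists>f. orthogonal_transformation f \<and> f ` V \<subseteq> K56"
proof -
  obtain b N where b: "V = signed_set b N" "N \<le> 7" "\<And>i j. i < N \<Longrightarrow> j < N \<Longrightarrow> b i \<bullet> b j = (if i = j then 3 else 1)"
    using triad_free_system[OF assms] by blast
  have "b i \<bullet> b j = fano_basis i \<bullet> fano_basis j" if "i < N" "j < N" for i j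
    using b(3)[OF that] fano_basis(2)[of i j] that b(2) by simp
  then obtain f where "orthogonal_transformation f" "f ` V = signed_set fano_basis N"
    using signed_set_isometric[of N b fano_basis] b(1) by blast
  moreover have "signed_set fano_basis N \<subseteq> K56"
    using fano_basis(1) K56_minus b(2) by (auto simp: signed_set_def)
  ultimately show ?thesis by blast
qed

lemma gram_extension_list:
  fixes xs ys :: "'a::real_inner list"
  assumes "length xs = length ys" "\<forall>i<length xs. \<forall>j<length xs. xs ! i \<bullet> xs ! j = ys ! i \<bullet> ys ! j"
  obtains f where "orthogonal_transformation f" "map f xs = ys"
proof -
  obtain f where f: "orthogonal_transformation f" "\<And>i. i < length xs \<Longrightarrow> f (xs ! i) = ys ! i"
    using gram_extension[of "{..<length xs}" "\<lambda>i. xs ! i" "\<lambda>i. ys ! i"] assms(2) by auto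
  then have "map f xs = ys" using assms(1) by (intro nth_equalityI) auto
  with f(1) that show thesis by blast
qed

text \<open>
  Together with the negative of their sum, these three vectors form a regular tetrahedron with the line abc
  as support.
\<close>

abbreviation "tetra1 \<equiv> vec7 1 1 1 0 0 0 0"
abbreviation "tetra2 \<equiv> vec7 1 (-1) (-1) 0 0 0 0"
abbreviation "tetra3 \<equiv> vec7 (-1) 1 (-1) 0 0 0 0"

text \<open>
  These are the conditions on the last four coordinates of a system that contains the tetrahedron and the
  vectors (1, 0, 0, 1, 1, 0, 0), (1, 0, 0, 1, -1, 0, 0) and (0, 1, 0, 1, 0, 1, 0). The four coordinates are a vector
  of norm 2 with prescribed inner products, and only the root vectors of D_4 that belong to K56 satisfy them.
\<close>

lemma rigid_coordinates:
  fixes p q r s :: real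
  assumes n: "p * p + q * q + r * r + s * s = 2"
  shows "p + q \<in> {0, 2, -2, -4} \<Longrightarrow> p - q \<in> {0, 2, -2, -4} \<Longrightarrow> p + r \<in> {1, -1, 3, -3} \<Longrightarrow>
      vec7 1 0 0 p q r s \<in> K56"
    and "p + q \<in> {1, -1, 3, -3} \<Longrightarrow> p - q \<in> {1, -1, 3, -3} \<Longrightarrow> p + r \<in> {0, 2, -2, -4} \<Longrightarrow>
      vec7 0 1 0 p q r s \<in> K56"
    and "p + q \<in> {1, -1, 3, -3} \<Longrightarrow> p - q \<in> {1, -1, 3, -3} \<Longrightarrow> p + r \<in> {1, -1, 3, -3} \<Longrightarrow>
      vec7 0 0 1 p q r s \<in> K56"
proof -
  have nn: "0 \<le> r * r" "0 \<le> s * s" "0 \<le> p * p" "0 \<le> q * q" by simp_all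
  have one: "\<bar>t\<bar> = 1" if "t * t = 1" for t :: real
    using that by (metis abs_mult_self_eq abs_1 power2_eq_square abs_square_eq_1)
  have sq1: "t * t = 1" if "\<bar>t\<bar> = 1" for t :: real using that by (metis abs_mult_self_eq mult_1)
  have sq: "(p + q) * (p + q) + (p - q) * (p - q) = 2 * (p * p + q * q)" by (simp add: algebra_simps)
  have "p * p + q * q \<le> 2" using n nn(1,2) by linarith
  then have small: "2 * (p * p + q * q) \<le> 4" by simp
  have rb: "\<bar>r\<bar> < 2"
  proof (rule ccontr)
    assume "\<not> \<bar>r\<bar> < 2"
    then have "2 * 2 \<le> \<bar>r\<bar> * \<bar>r\<bar>" by (intro mult_mono) auto
    then show False using n nn by simp
  qed
  {
    assume h: "p + q \<in> {0, 2, -2, -4}" "p - q \<in> {0, 2, -2, -4}" "p + r \<in> {1, -1, 3, -3}"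
    have "p = 0 \<and> q = 0 \<or> \<bar>p\<bar> = 1 \<and> \<bar>q\<bar> = 1"
    proof -
      obtain u v where u: "p + q = u" "p - q = v" "u \<in> {0, 2, -2, -4}" "v \<in> {0, 2, -2, -4}" using h by blast
      then have "p = (u + v) / 2" "q = (u - v) / 2" by auto
      moreover have "u * u + v * v \<le> 4" using sq small u by simp
      ultimately show ?thesis using u(3,4) by auto
    qed
    then show "vec7 1 0 0 p q r s \<in> K56"
    proof
      assume z: "p = 0 \<and> q = 0"
      then have "\<bar>r\<bar> = 1" using h(3) rb by auto
      moreover have "r * r = 1" using calculation by (rule sq1)
      then have "\<bar>s\<bar> = 1" using n z by (intro one) simp
      ultimately show ?thesis using z K56_intros(3)[of 1 r s] by simp
    next
      assume z: "\<bar>p\<bar> = 1 \<and> \<bar>q\<bar> = 1"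
      then have "p * p = 1" "q * q = 1" by (auto intro: sq1)
      then have "r * r + s * s = 0" using n by simp
      then have "r = 0" "s = 0" using nn by (auto simp: add_nonneg_eq_0_iff)
      then show ?thesis using z K56_intros(2)[of 1 p q] by simp
    qed
  }
  have pq: "p = 0 \<and> \<bar>q\<bar> = 1 \<or> \<bar>p\<bar> = 1 \<and> q = 0" if h: "p + q \<in> {1, -1, 3, -3}" "p - q \<in> {1, -1, 3, -3}"
  proof -
    obtain u v where u: "p + q = u" "p - q = v" "u \<in> {1, -1, 3, -3}" "v \<in> {1, -1, 3, -3}" using h by blast
    then have "p = (u + v) / 2" "q = (u - v) / 2" by auto
    moreover have "u * u + v * v \<le> 4" using sq small u by simp
    ultimately show ?thesis using u(3,4) by auto
  qed
  {
    assume h: "p + q \<in> {1, -1, 3, -3}" "p - q \<in> {1, -1, 3, -3}" "p + r \<in> {0, 2, -2, -4}"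
    from pq[OF h(1,2)] show "vec7 0 1 0 p q r s \<in> K56"
    proof
      assume z: "p = 0 \<and> \<bar>q\<bar> = 1"
      then have "q * q = 1" by (intro sq1) simp
      have "r = 0" using h(3) z rb by auto
      then have "\<bar>s\<bar> = 1" using n z \<open>q * q = 1\<close> by (intro one) simp
      then show ?thesis using z \<open>r = 0\<close> K56_intros(5)[of 1 q s] by simp
    next
      assume z: "\<bar>p\<bar> = 1 \<and> q = 0"
      then have "p * p = 1" by (intro sq1) simp
      have "\<bar>r\<bar> = 1" using h(3) z rb by auto
      then have "r * r = 1" by (rule sq1)
      then have "s = 0" using n z \<open>p * p = 1\<close> by simp
      then show ?thesis using z \<open>\<bar>r\<bar> = 1\<close> K56_intros(4)[of 1 p r] by simp
    qed
  }
  {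
    assume h: "p + q \<in> {1, -1, 3, -3}" "p - q \<in> {1, -1, 3, -3}" "p + r \<in> {1, -1, 3, -3}"
    from pq[OF h(1,2)] show "vec7 0 0 1 p q r s \<in> K56"
    proof
      assume z: "p = 0 \<and> \<bar>q\<bar> = 1"
      then have "q * q = 1" by (intro sq1) simp
      have "\<bar>r\<bar> = 1" using h(3) z rb by auto
      then have "r * r = 1" by (rule sq1)
      then have "s = 0" using n z \<open>q * q = 1\<close> by simp
      then show ?thesis using z \<open>\<bar>r\<bar> = 1\<close> K56_intros(7)[of 1 q r] by simp
    next
      assume z: "\<bar>p\<bar> = 1 \<and> q = 0"
      then have "p * p = 1" by (intro sq1) simp
      have "r = 0" using h(3) z rb by auto
      then have "\<bar>s\<bar> = 1" using n z \<open>p * p = 1\<close> by (intro one) simp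
      then show ?thesis using z \<open>r = 0\<close> K56_intros(6)[of 1 p s] by simp
    qed
  }
qed

text \<open>
  The inner products with the four vectors of the tetrahedron sum to 0. If none of them is \<plusminus>3, two are 1
  and two are -1, so the first three coordinates are \<plusminus> a unit vector.
\<close>

lemma system_around_tetrahedron:
  assumes V: "line_system V" and t: "tetra1 \<in> V" "tetra2 \<in> V" "tetra3 \<in> V" "- (tetra1 + tetra2 + tetra3) \<in> V" and v: "v \<in> V"
  shows "v \<in> K56 \<or> (\<exists>p q r s. p * p + q * q + r * r + s * s = 2 \<and>
      (v = vec7 1 0 0 p q r s \<or> - v = vec7 1 0 0 p q r s \<or> v = vec7 0 1 0 p q r s \<or>
       - v = vec7 0 1 0 p q r s \<or> v = vec7 0 0 1 p q r s \<or> - v = vec7 0 0 1 p q r s))"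
proof -
  note l = line_systemD[OF V]
  obtain a b c p q r s where v': "v = vec7 a b c p q r s" by (rule vec7_cases)
  have n: "a * a + b * b + c * c + p * p + q * q + r * r + s * s = 3" using l(2)[OF v] by (simp add: v')
  have tK: "tetra1 \<in> K56" "tetra2 \<in> K56" "tetra3 \<in> K56" "- (tetra1 + tetra2 + tetra3) \<in> K56" by (auto intro!: K56_intros)
  have "v \<in> K56 \<or> v \<bullet> t = 1 \<or> v \<bullet> t = -1" if "t \<in> V" "t \<in> K56" for t
    using l(3)[OF v that(1)] norm3_eq[OF l(2)[OF v] l(2)[OF that(1)]] K56_minus[OF that(2)] that(2) by auto
  from this[OF t(1) tK(1)] this[OF t(2) tK(2)] this[OF t(3) tK(3)] this[OF t(4) tK(4)]
  have "v \<in> K56 \<or> (a + b + c = 1 \<or> a + b + c = -1) \<and> (a - b - c = 1 \<or> a - b - c = -1) \<and>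
     (- a + b - c = 1 \<or> - a + b - c = -1) \<and> (c - a - b = 1 \<or> c - a - b = -1)"
    by (auto simp: v')
  then show ?thesis
  proof
    assume h: "(a + b + c = 1 \<or> a + b + c = -1) \<and> (a - b - c = 1 \<or> a - b - c = -1) \<and>
     (- a + b - c = 1 \<or> - a + b - c = -1) \<and> (c - a - b = 1 \<or> c - a - b = -1)"
    obtain u1 u2 u3 u4 where u: "u1 = 1 \<or> u1 = (-1::real)" "u2 = 1 \<or> u2 = (-1::real)" "u3 = 1 \<or> u3 = (-1::real)" "u4 = 1 \<or> u4 = (-1::real)"
      and e: "a + b + c = u1" "a - b - c = u2" "- a + b - c = u3" "c - a - b = u4" using h by blast
    have "a = (u1 + u2) / 2" "b = (u1 + u3) / 2" "c = (u1 + u4) / 2" "u1 + u2 + u3 + u4 = 0"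
      by (simp_all add: e[symmetric])
    then have abc: "a = 1 \<and> b = 0 \<and> c = 0 \<or> a = -1 \<and> b = 0 \<and> c = 0 \<or> a = 0 \<and> b = 1 \<and> c = 0 \<or> a = 0 \<and> b = -1 \<and> c = 0 \<or>
       a = 0 \<and> b = 0 \<and> c = 1 \<or> a = 0 \<and> b = 0 \<and> c = -1" using u by (elim disjE) simp_all
    have shape: ?thesis if "P * P + Q * Q + R * R + S * S = 2" "u \<in> {v, - v}"
      "u = vec7 1 0 0 P Q R S \<or> u = vec7 0 1 0 P Q R S \<or> u = vec7 0 0 1 P Q R S" for u P Q R S
      using that by (intro disjI2 exI[of _ P] exI[of _ Q] exI[of _ R] exI[of _ S]) auto
    from abc show ?thesis
      by (elim disjE conjE; (intro shape[of p q r s v]; use n v' in simp; fail)?)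
         (intro shape[of "- p" "- q" "- r" "- s" "- v"]; use n v' in simp)+
  qed simp
qed

text \<open>
  The fourth vector belonging to a triad a, b, c is d = -(a + b + c). Any other vector of the system has,
  up to sign, inner product 1 with a and with exactly one of b, c, d. This divides the other lines into
  three pillars. The condition x \<bullet> c = -1 determines x \<bullet> d = -1.
\<close>

definition triad :: "'a::real_inner set \<Rightarrow> 'a \<Rightarrow> 'a \<Rightarrow> 'a \<Rightarrow> bool" where
  "triad V a b c \<longleftrightarrow> a \<in> V \<and> b \<in> V \<and> c \<in> V \<and> a \<bullet> b = -1 \<and> a \<bullet> c = -1 \<and> b \<bullet> c = -1"

definition pillar :: "'a::real_inner set \<Rightarrow> 'a \<Rightarrow> 'a \<Rightarrow> 'a \<Rightarrow> 'a set" where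
  "pillar V a b c = {x \<in> V. x \<bullet> a = 1 \<and> x \<bullet> b = 1 \<and> x \<bullet> c = -1}"

locale closed_system =
  fixes V :: "(real ^ 7) set"
  assumes V: "line_system V" and cl: "triad_closed V"
begin

lemmas neg = line_systemD(1)[OF V] and nrm = line_systemD(2)[OF V] and ip = line_systemD(3)[OF V]

lemma eq_iff: "x \<in> V \<Longrightarrow> y \<in> V \<Longrightarrow> x \<bullet> y = 3 \<longleftrightarrow> x = y" "x \<in> V \<Longrightarrow> y \<in> V \<Longrightarrow> x \<bullet> y = -3 \<longleftrightarrow> x = - y"
  using norm3_eq(1,2)[OF nrm nrm] by blast+

lemma triad_swap: "triad V a b c \<Longrightarrow> triad V a c b"
  by (auto simp: triad_def inner_commute)

lemma triad_fourth:
  assumes "triad V a b c"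
  shows "- (a + b + c) \<in> V" "triad V a (- (a + b + c)) b"
proof -
  have i: "a \<bullet> b = -1" "a \<bullet> c = -1" "b \<bullet> c = -1" "a \<in> V" "b \<in> V" "c \<in> V" using assms by (auto simp: triad_def)
  show 1: "- (a + b + c) \<in> V" using i by (intro triad_closedD[OF cl])
  have "a \<bullet> (- (a + b + c)) = -1" "b \<bullet> (- (a + b + c)) = -1"
    using i nrm by (auto simp: inner_diff_right inner_commute[of b a])
  then show "triad V a (- (a + b + c)) b"
    using 1 i by (auto simp: triad_def inner_commute)
qed

text \<open>
  The fourth vector for the triad x, c, d is -(x + c + d) = a + b - x.
\<close>

lemma pillar_partner:
  assumes t: "triad V a b c" and x: "x \<in> pillar V a b c"
  shows "a + b - x \<in> pillar V a b c"
proof -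
  have i: "a \<bullet> b = -1" "a \<bullet> c = -1" "b \<bullet> c = -1" "a \<in> V" "b \<in> V" "c \<in> V" using t by (auto simp: triad_def)
  have x': "x \<in> V" "x \<bullet> a = 1" "x \<bullet> b = 1" "x \<bullet> c = -1" using x by (auto simp: pillar_def)
  let ?d = "- (a + b + c)"
  have d: "?d \<in> V" "c \<bullet> ?d = -1" "x \<bullet> ?d = -1"
    using triad_fourth(1)[OF t] i x' nrm by (auto simp: inner_diff_right inner_commute)
  have "- (x + c + ?d) \<in> V" using x' i d by (intro triad_closedD[OF cl]) auto
  moreover have "- (x + c + ?d) = a + b - x" by simp
  ultimately have "a + b - x \<in> V" by metis
  moreover have "(a + b - x) \<bullet> a = 1" "(a + b - x) \<bullet> b = 1" "(a + b - x) \<bullet> c = -1"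
    using i x' nrm by (auto simp: inner_diff_left inner_add_left inner_diff_right inner_add_right inner_commute)
  ultimately show ?thesis by (simp add: pillar_def)
qed

lemma pillar_decomposition:
  assumes t: "triad V a b c" and v: "v \<in> V"
  defines "d \<equiv> - (a + b + c)"
  shows "v \<in> {a, b, c, d, - a, - b, - c, - d} \<or>
    (\<exists>w \<in> {v, - v}. w \<in> pillar V a b c \<or> w \<in> pillar V a c b \<or> w \<in> pillar V a d b)"
proof (cases "v \<in> {a, b, c, d, - a, - b, - c, - d}")
  case False
  have d: "d \<in> V" using triad_fourth(1)[OF t] by (simp add: d_def)
  have T: "a \<in> V" "b \<in> V" "c \<in> V" using t by (auto simp: triad_def)
  have pm: "v \<bullet> u = 1 \<or> v \<bullet> u = -1" if "u \<in> V" "v \<noteq> u" "v \<noteq> - u" for u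
    using ip[OF v that(1)] eq_iff[OF v that(1)] that(2,3) by auto
  have abc: "v \<bullet> a = 1 \<or> v \<bullet> a = -1" "v \<bullet> b = 1 \<or> v \<bullet> b = -1" "v \<bullet> c = 1 \<or> v \<bullet> c = -1" "v \<bullet> d = 1 \<or> v \<bullet> d = -1"
    using pm[of a] pm[of b] pm[of c] pm[of d] T d False by auto
  have sum: "v \<bullet> d = - (v \<bullet> a) - v \<bullet> b - v \<bullet> c" by (simp add: d_def inner_diff_right)
  obtain w where w: "w = v \<or> w = - v" "w \<bullet> a = 1" using abc(1) by fastforce
  have wV: "w \<in> V" using w neg[OF v] v by auto
  have "w \<bullet> b = 1 \<or> w \<bullet> b = -1" "w \<bullet> c = 1 \<or> w \<bullet> c = -1" "w \<bullet> d = 1 \<or> w \<bullet> d = -1" "w \<bullet> d = - (w \<bullet> a) - w \<bullet> b - w \<bullet> c"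
    using w abc sum by auto
  then have "w \<in> pillar V a b c \<or> w \<in> pillar V a c b \<or> w \<in> pillar V a d b"
    using w wV by (auto simp: pillar_def)
  then show ?thesis using w by blast
qed simp

text \<open>
  Passing from y to its partner changes the sign of the inner product with x.
\<close>

lemma pillar_sign:
  assumes t: "triad V a b c" and x: "x \<in> pillar V a b c" and y: "y \<in> pillar V a c b"
  obtains z where "z \<in> {y, a + c - y}" "z \<in> pillar V a c b" "x \<bullet> z = 1"
proof -
  have x': "x \<in> V" "x \<bullet> a = 1" "x \<bullet> b = 1" "x \<bullet> c = -1" using x by (auto simp: pillar_def)
  have y': "y \<in> V" "y \<bullet> a = 1" "y \<bullet> c = 1" "y \<bullet> b = -1" using y by (auto simp: pillar_def)
  have "x \<noteq> y" "x \<noteq> - y" using x' y' by auto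
  then have "x \<bullet> y = 1 \<or> x \<bullet> y = -1" using ip[OF x'(1) y'(1)] eq_iff[OF x'(1) y'(1)] by auto
  then show thesis
  proof
    assume "x \<bullet> y = 1" then show thesis using that y by blast
  next
    assume "x \<bullet> y = -1"
    then have "x \<bullet> (a + c - y) = 1" using x' by (simp add: inner_diff_right inner_add_right)
    then show thesis using that pillar_partner[OF triad_swap[OF t] y] by blast
  qed
qed

text \<open>
  After passing to partners where necessary, the six vectors a, b, c, x, x', y have the Gram matrix of the tetrahedron and the three
  vectors in \<open>rigid_coordinates\<close>. After an orthogonal map they are these vectors, and then all other
  vectors of the system have no choice but to lie in K56.
\<close>

lemma embed_two_lines_in_pillar:
  assumes t: "triad V a b c" and x: "x \<in> pillar V a b c" "x' \<in> pillar V a b c" "x \<bullet> x' = 1" and y: "y \<in> pillar V a c b"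
  shows "\<exists>f. orthogonal_transformation f \<and> f ` V \<subseteq> K56"
proof -
  have i: "a \<bullet> b = -1" "a \<bullet> c = -1" "b \<bullet> c = -1" "a \<in> V" "b \<in> V" "c \<in> V" using t by (auto simp: triad_def)
  obtain y1 where y1: "y1 \<in> pillar V a c b" "x \<bullet> y1 = 1" using pillar_sign[OF t x(1) y] by blast
  have y': "y1 \<in> V" "y1 \<bullet> a = 1" "y1 \<bullet> c = 1" "y1 \<bullet> b = -1" using y1 by (auto simp: pillar_def)
  obtain x1 where x1: "x1 \<in> {x', a + b - x'}" "x1 \<in> pillar V a b c" "x1 \<bullet> y1 = 1"
    using pillar_sign[OF triad_swap[OF t] y1(1) x(2)] by (metis inner_commute)
  have "x \<bullet> x1 = 1"
    using x1(1) x(1,3) by (auto simp: pillar_def inner_diff_right inner_add_right)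
  note x1 = x1(2,3) this
  let ?a1 = "vec7 1 0 0 1 1 0 0" let ?a2 = "vec7 1 0 0 1 (-1) 0 0" let ?b1 = "vec7 0 1 0 1 0 1 0"
  have xs: "x \<in> V" "x \<bullet> a = 1" "x \<bullet> b = 1" "x \<bullet> c = -1" "x1 \<in> V" "x1 \<bullet> a = 1" "x1 \<bullet> b = 1" "x1 \<bullet> c = -1"
    using x(1) x1(1) by (auto simp: pillar_def)
  have gram: "\<forall>i<length [a, b, c, x, x1, y1]. \<forall>j<length [a, b, c, x, x1, y1].
      [a, b, c, x, x1, y1] ! i \<bullet> [a, b, c, x, x1, y1] ! j = [tetra1, tetra2, tetra3, ?a1, ?a2, ?b1] ! i \<bullet> [tetra1, tetra2, tetra3, ?a1, ?a2, ?b1] ! j"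
    using i xs y' y1(2) x1(2,3) nrm by (simp add: All_less_Suc inner_commute)
  obtain f where f: "orthogonal_transformation f" "map f [a, b, c, x, x1, y1] = [tetra1, tetra2, tetra3, ?a1, ?a2, ?b1]"
    by (rule gram_extension_list[OF _ gram]) simp
  have fv: "f a = tetra1" "f b = tetra2" "f c = tetra3" "f x = ?a1" "f x1 = ?a2" "f y1 = ?b1" using f(2) by simp_all
  interpret W: closed_system "f ` V"
    using line_system_image[OF f(1) V] triad_closed_image[OF f(1) cl] by unfold_locales
  have W: "tetra1 \<in> f ` V" "tetra2 \<in> f ` V" "tetra3 \<in> f ` V" "?a1 \<in> f ` V" "?a2 \<in> f ` V" "?b1 \<in> f ` V"
    using fv i xs y' by (metis imageI)+
  have "triad (f ` V) tetra1 tetra2 tetra3" using W by (simp add: triad_def)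
  note t4 = W.triad_fourth(1)[OF this]
  have shape: "w \<in> K56" if w: "w \<in> f ` V" and n: "p * p + q * q + r * r + s * s = 2"
    and e: "w = vec7 1 0 0 p q r s \<or> w = vec7 0 1 0 p q r s \<or> w = vec7 0 0 1 p q r s" for w p q r s
  proof -
    have ips: "w \<bullet> ?a1 \<in> {1, -1, 3, -3}" "w \<bullet> ?a2 \<in> {1, -1, 3, -3}" "w \<bullet> ?b1 \<in> {1, -1, 3, -3}"
      using W.ip[OF w W(4)] W.ip[OF w W(5)] W.ip[OF w W(6)] by auto
    from e show ?thesis
    proof (elim disjE)
      assume w': "w = vec7 1 0 0 p q r s"
      show ?thesis using ips unfolding w' by (intro rigid_coordinates(1)[OF n]) auto
    next
      assume w': "w = vec7 0 1 0 p q r s"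
      show ?thesis using ips unfolding w' by (intro rigid_coordinates(2)[OF n]) auto
    next
      assume w': "w = vec7 0 0 1 p q r s"
      show ?thesis using ips unfolding w' by (intro rigid_coordinates(3)[OF n]) auto
    qed
  qed
  have "w \<in> K56" if w: "w \<in> f ` V" for w
    using system_around_tetrahedron[OF W.V W(1-3) t4 w] shape[OF w] shape[OF W.neg[OF w]] K56_minus[of "- w"]
    by (metis minus_minus)
  with f(1) show ?thesis by blast
qed

text \<open>
  A line in each of two pillars gives one in the third. If no pillar has more than one line and its
  partner, then the system is known from five vectors, and their Gram matrix occurs in K56.
\<close>

lemma embed_one_line_per_pillar:
  assumes t: "triad V a b c" and x: "x \<in> pillar V a b c" and y: "y \<in> pillar V a c b"
    and no: "\<And>a b c x x' y. triad V a b c \<Longrightarrow> x \<in> pillar V a b c \<Longrightarrow> x' \<in> pillar V a b c \<Longrightarrow>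
      y \<in> pillar V a c b \<Longrightarrow> x \<bullet> x' \<noteq> 1"
  shows "\<exists>f. orthogonal_transformation f \<and> f ` V \<subseteq> K56"
proof -
  have i: "a \<bullet> b = -1" "a \<bullet> c = -1" "b \<bullet> c = -1" "a \<in> V" "b \<in> V" "c \<in> V" using t by (auto simp: triad_def)
  have x': "x \<in> V" "x \<bullet> a = 1" "x \<bullet> b = 1" "x \<bullet> c = -1" using x by (auto simp: pillar_def)
  obtain z where z: "z \<in> pillar V a c b" "x \<bullet> z = 1" using pillar_sign[OF t x y] by blast
  have z': "z \<in> V" "z \<bullet> a = 1" "z \<bullet> c = 1" "z \<bullet> b = -1" using z by (auto simp: pillar_def)
  define d where "d = - (a + b + c)"
  have td: "triad V a d b" "d \<in> V" using triad_fourth[OF t] by (auto simp: d_def)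
  define u where "u = x - z - b"
  have "- (- x + z + b) \<in> V"
    using neg[OF x'(1)] x' z' i z(2) by (intro triad_closedD[OF cl]) auto
  then have "u \<in> V" by (simp add: u_def)
  moreover have "u \<bullet> a = 1" "u \<bullet> d = 1" "u \<bullet> b = -1"
    using i x' z' nrm by (auto simp: u_def d_def inner_diff_left inner_diff_right inner_commute)
  ultimately have u: "u \<in> pillar V a d b" by (simp add: pillar_def)
  have xd: "x \<in> pillar V a b d"
    using x' by (auto simp: pillar_def d_def inner_diff_right)
  have only: "v = w \<or> v = p + q - w"
    if "triad V p q r" "v \<in> pillar V p q r" "w \<in> pillar V p q r" "h \<in> pillar V p r q" for p q r v w h
  proof -
    have v: "v \<in> V" "v \<bullet> p = 1" "v \<bullet> q = 1" and w: "w \<in> V" "p + q - w \<in> V"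
      using that(2,3) pillar_partner[OF that(1,3)] by (auto simp: pillar_def)
    have "v \<bullet> w \<noteq> 1" using no[OF that] .
    moreover have "v \<bullet> w \<noteq> -3"
    proof
      assume "v \<bullet> w = -3"
      then have "v = - w" using eq_iff(2)[OF v(1) w(1)] by blast
      then show False using v(2) that(3) by (auto simp: pillar_def)
    qed
    ultimately have "v \<bullet> w = 3 \<or> v \<bullet> (p + q - w) = 3"
      using ip[OF v(1) w(1)] v by (auto simp: inner_diff_right inner_add_right)
    then show ?thesis using eq_iff(1)[OF v(1) w(1)] eq_iff(1)[OF v(1) w(2)] by blast
  qed
  have all: "v \<in> {a, b, c, d, - a, - b, - c, - d} \<or> (\<exists>w \<in> {v, - v}. w \<in> {x, a + b - x, z, a + c - z, u, a + d - u})"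
    if v: "v \<in> V" for v
    using pillar_decomposition[OF t v, folded d_def]
  proof (elim disjE bexE)
    fix w assume w: "w \<in> {v, - v}" "w \<in> pillar V a b c"
    then show ?thesis using only[OF t w(2) x z(1)] by blast
  next
    fix w assume w: "w \<in> {v, - v}" "w \<in> pillar V a c b"
    then show ?thesis using only[OF triad_swap[OF t] w(2) z(1) x] by blast
  next
    fix w assume w: "w \<in> {v, - v}" "w \<in> pillar V a d b"
    then show ?thesis using only[OF td(1) w(2) u xd] by blast
  qed blast
  let ?a1 = "vec7 1 0 0 1 1 0 0" let ?b1 = "vec7 0 1 0 1 0 1 0"
  have gram: "\<forall>i<length [a, b, c, x, z]. \<forall>j<length [a, b, c, x, z].
      [a, b, c, x, z] ! i \<bullet> [a, b, c, x, z] ! j = [tetra1, tetra2, tetra3, ?a1, ?b1] ! i \<bullet> [tetra1, tetra2, tetra3, ?a1, ?b1] ! j"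
    using i x' z' z(2) nrm by (simp add: All_less_Suc inner_commute)
  obtain f where f: "orthogonal_transformation f" "map f [a, b, c, x, z] = [tetra1, tetra2, tetra3, ?a1, ?b1]"
    by (rule gram_extension_list[OF _ gram]) simp
  have fv: "f a = tetra1" "f b = tetra2" "f c = tetra3" "f x = ?a1" "f z = ?b1" using f(2) by simp_all
  note l = orthogonal_transformation_linear[OF f(1)]
  note fl = linear_add[OF l] linear_diff[OF l] linear_neg[OF l]
  have fw: "f w \<in> K56" if "w \<in> {a, b, c, d, x, a + b - x, z, a + c - z, u, a + d - u}" for w
    using that by (elim insertE emptyE) (simp_all add: d_def u_def fl fv K56_intros)
  have "f v \<in> K56" if v: "v \<in> V" for v
  proof -
    obtain w where w: "w \<in> {a, b, c, d, x, a + b - x, z, a + c - z, u, a + d - u}" "v = w \<or> v = - w"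
    proof -
      have m: "v = w \<or> v = - w" if "w \<in> {v, - v}" for w using that by auto
      from all[OF v] show thesis
      proof
        assume "v \<in> {a, b, c, d, - a, - b, - c, - d}"
        then show thesis using that[of a] that[of b] that[of c] that[of d] by blast
      next
        assume "\<exists>w \<in> {v, - v}. w \<in> {x, a + b - x, z, a + c - z, u, a + d - u}"
        then obtain w where "w \<in> {v, - v}" "w \<in> {x, a + b - x, z, a + c - z, u, a + d - u}" by blast
        then show thesis using that[of w] m by blast
      qed
    qed
    have "f v = f w \<or> f v = - f w" using w(2) fl(3) by metis
    then show ?thesis using fw[OF w(1)] K56_minus by metis
  qed
  with f(1) show ?thesis by blast
qed

text \<open>
  Put e = (a + b)/2. The differences x - e, for x in the pillar, are equal, opposite or orthogonal. Four of
  them at most are mutually orthogonal, because they are also orthogonal to the three-dimensional space of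
  the tetrahedron. So a largest set B of vectors with mutual inner products 1 has at most four elements,
  and it represents all vectors of the pillar up to partners.
\<close>

lemma embed_single_pillar:
  assumes t: "triad V a b c"
    and no: "pillar V a c b = {}" "pillar V a (- (a + b + c)) b = {}"
  shows "\<exists>f. orthogonal_transformation f \<and> f ` V \<subseteq> K56"
proof -
  have i: "a \<bullet> b = -1" "a \<bullet> c = -1" "b \<bullet> c = -1" "a \<in> V" "b \<in> V" "c \<in> V" using t by (auto simp: triad_def)
  let ?P = "pillar V a b c"
  define good where "good B \<longleftrightarrow> finite B \<and> B \<subseteq> ?P \<and> (\<forall>x\<in>B. \<forall>y\<in>B. x \<noteq> y \<longrightarrow> x \<bullet> y = 1)" for B
  define e where "e = (1/2) *\<^sub>R (a + b)"
  have e: "e \<bullet> e = 1" "e \<bullet> a = 1" "e \<bullet> b = 1" "e \<bullet> c = -1" "\<And>x. x \<in> ?P \<Longrightarrow> e \<bullet> x = 1"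
    using i nrm by (auto simp: e_def inner_add_left inner_add_right inner_commute pillar_def)
  have bound: "card B \<le> 4" if B: "good B" for B
  proof -
    let ?n = "\<lambda>x. x - e"
    let ?E = "{e, a - e, c + e}"
    have Bp: "x \<in> V" "x \<bullet> a = 1" "x \<bullet> b = 1" "x \<bullet> c = -1" "e \<bullet> x = 1" "x \<bullet> e = 1" if "x \<in> B" for x
    proof -
      have "x \<in> ?P" using that B by (auto simp: good_def)
      then show "x \<in> V" "x \<bullet> a = 1" "x \<bullet> b = 1" "x \<bullet> c = -1" "e \<bullet> x = 1" "x \<bullet> e = 1"
        using e(5)[of x] by (auto simp: pillar_def inner_commute)
    qed
    have nn: "(x - e) \<bullet> (y - e) = (if x = y then 2 else 0)" if "x \<in> B" "y \<in> B" for x y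
      using Bp[OF that(1)] Bp[OF that(2)] e B that nrm by (auto simp: good_def inner_diff_left inner_diff_right)
    have nE: "(x - e) \<bullet> h = 0" if "x \<in> B" "h \<in> ?E" for x h
      using Bp[OF that(1)] e that(2) by (auto simp: inner_diff_left inner_diff_right inner_add_right)
    have EE: "g \<bullet> h = 0" if "g \<in> ?E" "h \<in> ?E" "g \<noteq> h" for g h
      using that e i by (auto simp: inner_diff_left inner_diff_right inner_add_right inner_add_left inner_commute)
    have E2: "e \<bullet> e = 1" "(a - e) \<bullet> (a - e) = 2" "(c + e) \<bullet> (c + e) = 2"
      using e i nrm by (auto simp: inner_diff_left inner_diff_right inner_add_right inner_add_left inner_commute)
    have Ei: "e \<bullet> (a - e) = 0" "e \<bullet> (c + e) = 0" "(a - e) \<bullet> (c + e) = 0"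
      using e i by (auto simp: inner_diff_left inner_diff_right inner_add_right inner_add_left inner_commute)
    have cE: "card ?E = 3"
    proof -
      have "e \<noteq> a - e" "e \<noteq> c + e" "a - e \<noteq> c + e" using E2 Ei by (metis zero_neq_one zero_neq_numeral)+
      then show ?thesis by simp
    qed
    have inj: "inj_on ?n B" by (auto simp: inj_on_def)
    have disj: "?n ` B \<inter> ?E = {}"
    proof (rule ccontr)
      assume "?n ` B \<inter> ?E \<noteq> {}"
      then obtain x where "x \<in> B" "x - e \<in> ?E" by blast
      then show False using nE[of x "x - e"] nn[of x x] by simp
    qed
    have "pairwise orthogonal (?n ` B \<union> ?E)"
    proof (intro pairwiseI)
      fix g h assume gh: "g \<in> ?n ` B \<union> ?E" "h \<in> ?n ` B \<union> ?E" "g \<noteq> h"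
      have "g \<bullet> h = 0"
        using gh nE nE[unfolded inner_commute[of "_ - e"]] EE by (auto simp: nn)
      then show "orthogonal g h" by (simp add: orthogonal_def)
    qed
    moreover have "0 \<notin> ?n ` B \<union> ?E" using E2 nn by force
    ultimately have "independent (?n ` B \<union> ?E)" by (rule pairwise_orthogonal_independent)
    then have "card (?n ` B \<union> ?E) \<le> 7" using independent_bound[of "?n ` B \<union> ?E"] by simp
    moreover have "card (?n ` B \<union> ?E) = card B + 3"
      using B cE card_Un_disjoint[OF _ _ disj] card_image[OF inj] by (simp add: good_def)
    ultimately show ?thesis by simp
  qed
  have "good {}" by (simp add: good_def)
  then obtain B where B: "good B" "\<And>C. good C \<Longrightarrow> card C \<le> card B"
    using ex_has_greatest_nat[of good "{}" card 5] bound by (metis less_Suc_eq_le eval_nat_numeral(3) numeral_eq_Suc pred_numeral_simps(3))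
  have cover: "v \<in> B \<or> a + b - v \<in> B" if v: "v \<in> ?P" for v
  proof (rule ccontr)
    assume nv: "\<not> ?thesis"
    have "v \<bullet> x = 1" if x: "x \<in> B" for x
    proof -
      have xP: "x \<in> ?P" using B(1) x by (auto simp: good_def)
      have vV: "v \<in> V" "x \<in> V" "v \<bullet> a = 1" "v \<bullet> b = 1" "x \<bullet> a = 1" "a + b - v \<in> V" using v xP pillar_partner[OF t v] by (auto simp: pillar_def)
      have "v \<noteq> x" "a + b - v \<noteq> x" "v \<noteq> - x" using nv x vV by auto
      then have "v \<bullet> x \<noteq> 3" "(a + b - v) \<bullet> x \<noteq> 3" "v \<bullet> x \<noteq> -3"
        using eq_iff vV by blast+
      moreover have "(a + b - v) \<bullet> x = 2 - v \<bullet> x" using xP by (simp add: pillar_def inner_diff_left inner_add_left inner_diff_right inner_add_right inner_commute)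
      ultimately show ?thesis using ip[OF vV(1,2)] by auto
    qed
    then have "good (insert v B)" using B(1) v by (auto simp: good_def inner_commute)
    from B(2)[OF this] show False using B(1) nv by (simp add: good_def)
  qed
  have fin: "finite B" and BP: "B \<subseteq> ?P" and Bi: "\<And>x y. x \<in> B \<Longrightarrow> y \<in> B \<Longrightarrow> x \<noteq> y \<Longrightarrow> x \<bullet> y = 1"
    using B(1) by (auto simp: good_def)
  obtain \<beta> where \<beta>: "bij_betw \<beta> {0..<card B} B" using ex_bij_betw_nat_finite[OF fin] by blast
  define \<tau> where "\<tau> m = [vec7 1 0 0 1 1 0 0, vec7 1 0 0 1 (-1) 0 0, vec7 1 0 0 0 0 1 1, vec7 1 0 0 0 0 1 (-1)] ! m" for m
  have c4: "card B \<le> 4" using bound[OF B(1)] .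
  have \<beta>B: "\<beta> n \<in> B" if "n < card B" for n using \<beta> that by (auto simp: bij_betw_def)
  have \<beta>i: "\<beta> n \<bullet> \<beta> m = (if n = m then 3 else 1)" if "n < card B" "m < card B" for n m
  proof -
    have "\<beta> n = \<beta> m \<longleftrightarrow> n = m" using \<beta> that by (auto simp: bij_betw_def inj_on_def)
    then show ?thesis using Bi[OF \<beta>B[OF that(1)] \<beta>B[OF that(2)]] nrm BP \<beta>B[OF that(1)] by (auto simp: pillar_def)
  qed
  have \<beta>p: "\<beta> n \<bullet> a = 1" "\<beta> n \<bullet> b = 1" "\<beta> n \<bullet> c = -1" if "n < card B" for n
    using BP \<beta>B[OF that] by (auto simp: pillar_def)
  have lt4: "m = 0 \<or> m = 1 \<or> m = 2 \<or> m = 3" if "m < card B" for m using c4 that by linarith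
  have \<tau>\<tau>: "\<tau> m \<bullet> \<tau> k = (if m = k then 3 else 1)" if "m < card B" "k < card B" for m k
    using lt4[OF that(1)] lt4[OF that(2)] by (elim disjE; hypsubst) (simp_all add: \<tau>_def)
  have \<tau>p: "\<tau> m \<bullet> tetra1 = 1 \<and> \<tau> m \<bullet> tetra2 = 1 \<and> \<tau> m \<bullet> tetra3 = -1" if "m < card B" for m
    using lt4[OF that] by (elim disjE) (simp_all add: \<tau>_def)
  have TT: "\<forall>i<3. \<forall>j<3. [a, b, c] ! i \<bullet> [a, b, c] ! j = [tetra1, tetra2, tetra3] ! i \<bullet> [tetra1, tetra2, tetra3] ! j"
    using i nrm by (simp add: numeral_3_eq_3 All_less_Suc inner_commute)
  have \<tau>T: "\<forall>i<3. \<beta> m \<bullet> [a, b, c] ! i = \<tau> m \<bullet> [tetra1, tetra2, tetra3] ! i" if "m < card B" for m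
    using \<beta>p[OF that] \<tau>p[OF that] by (simp add: numeral_3_eq_3 All_less_Suc)
  define src where "src = case_sum (\<lambda>i. [a, b, c] ! i) \<beta>"
  define trg where "trg = case_sum (\<lambda>i. [tetra1, tetra2, tetra3] ! i) \<tau>"
  let ?I = "Inl ` {..<3} \<union> Inr ` {..<card B} :: (nat + nat) set"
  have gram: "src p \<bullet> src q = trg p \<bullet> trg q" if "p \<in> ?I" "q \<in> ?I" for p q
  proof -
    have l: "i < 3 \<Longrightarrow> m < card B \<Longrightarrow> [a, b, c] ! i \<bullet> \<beta> m = [tetra1, tetra2, tetra3] ! i \<bullet> \<tau> m" for i m
      using \<tau>T[of m] inner_commute[of "[a, b, c] ! i" "\<beta> m"] inner_commute[of "[tetra1, tetra2, tetra3] ! i" "\<tau> m"] by metis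
    show ?thesis
      using that TT \<tau>T l \<beta>i \<tau>\<tau> by (cases p; cases q) (auto simp: src_def trg_def)
  qed
  obtain f where f: "orthogonal_transformation f" "\<And>p. p \<in> ?I \<Longrightarrow> f (src p) = trg p"
    using gram_extension[of ?I src trg, OF _ gram] by auto
  note l = orthogonal_transformation_linear[OF f(1)]
  note fl = linear_add[OF l] linear_diff[OF l] linear_neg[OF l]
  have fv: "f a = tetra1" "f b = tetra2" "f c = tetra3"
    using f(2)[of "Inl 0"] f(2)[of "Inl 1"] f(2)[of "Inl 2"] by (auto simp: src_def trg_def)
  have fB: "f x \<in> K56 \<and> f (a + b - x) \<in> K56" if x: "x \<in> B" for x
  proof -
    have "x \<in> \<beta> ` {0..<card B}" using \<beta> x by (simp add: bij_betw_def)
    then obtain m where m: "m < card B" "x = \<beta> m" by auto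
    then have "f x = \<tau> m" using f(2)[of "Inr m"] by (simp add: src_def trg_def)
    then show ?thesis using lt4[OF m(1)] by (elim disjE) (simp_all add: fl fv \<tau>_def K56_intros)
  qed
  have pil: "f w \<in> K56" if "w \<in> ?P" for w
    using cover[OF that] fB[of w] fB[of "a + b - w"] by auto
  have tri: "f w \<in> K56" if "w \<in> {a, b, c, - (a + b + c), - a, - b, - c, - (- (a + b + c))}" for w
    using that by (elim insertE emptyE) (simp_all add: fl fv K56_intros)
  have "f v \<in> K56" if v: "v \<in> V" for v
  proof -
    have m: "f v \<in> K56" if "f (- v) \<in> K56" using K56_minus[OF that] by (simp add: fl(3))
    show ?thesis using pillar_decomposition[OF t v] no tri pil m by blast
  qed
  with f(1) show ?thesis by blast
qed

text \<open>
  If two pillars are not empty, one of the first two embeddings applies. Otherwise a, b, c, d are relabelled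
  such that only the first pillar is left.
\<close>

lemma embed_with_triad:
  assumes "has_triad V"
  shows "\<exists>f. orthogonal_transformation f \<and> f ` V \<subseteq> K56"
proof (cases "\<exists>a b c x y. triad V a b c \<and> x \<in> pillar V a b c \<and> y \<in> pillar V a c b")
  case True
  then obtain a b c x y where t: "triad V a b c" "x \<in> pillar V a b c" "y \<in> pillar V a c b" by blast
  show ?thesis
    using embed_one_line_per_pillar[OF t] embed_two_lines_in_pillar by blast
next
  case False
  obtain a b c where t: "triad V a b c" using assms by (auto simp: has_triad_def triad_def)
  define d where "d = - (a + b + c)"
  have td: "triad V a d b" using triad_fourth(2)[OF t] by (simp add: d_def)
  have "a + d + b = - c" "a + c + b = - d" by (simp_all add: d_def)
  have same: "pillar V a b d = pillar V a b c" "pillar V a c d = pillar V a c b" "pillar V a d c = pillar V a d b"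
    by (auto simp: pillar_def d_def inner_diff_right)
  have tc: "triad V a c b" using triad_swap[OF t] .
  have tdc: "triad V a d c" using triad_fourth(2)[OF tc] by (simp add: d_def add.commute add.left_commute)
  have one: "pillar V a b c = {} \<or> pillar V a c b = {}" "pillar V a d b = {} \<or> pillar V a b d = {}"
    "pillar V a d c = {} \<or> pillar V a c d = {}"
    using False t td tdc by blast+
  consider "pillar V a c b = {}" "pillar V a d b = {}" | "pillar V a b c = {}" "pillar V a d c = {}"
    | "pillar V a b d = {}" "pillar V a c d = {}"
    using one unfolding same by blast
  then show ?thesis
  proof cases
    case 1
    then show ?thesis using embed_single_pillar[OF t] by (simp add: d_def)
  next
    case 2
    then show ?thesis using embed_single_pillar[OF tc] by (simp add: d_def add.commute add.left_commute)
  next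
    case 3
    have e: "- (a + d + b) = c" by (simp add: d_def)
    show ?thesis by (rule embed_single_pillar[OF td]) (use 3 same in \<open>simp_all only: e\<close>)
  qed
qed

end

theorem embed_line_system:
  fixes V :: "(real ^ 7) set"
  assumes V: "line_system V"
  shows "\<exists>f. orthogonal_transformation f \<and> f ` V \<subseteq> K56"
proof (cases "has_triad V")
  case True
  interpret closed_system "triad_closure V"
    using line_system_triad_closure[OF V] triad_closed_triad_closure by unfold_locales
  have sub: "V \<subseteq> triad_closure V" by (auto intro: triad_closure.base)
  have "has_triad (triad_closure V)" using True sub unfolding has_triad_def by blast
  then show ?thesis using embed_with_triad sub by blast
qed (rule embed_triad_free[OF V])

section \<open>Counting classes\<close>

definition lines_of :: "'a::euclidean_space set \<Rightarrow> 'a set set" where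
  "lines_of V = (\<lambda>v. span {v}) ` V"

definition vectors_of :: "'a::euclidean_space set set \<Rightarrow> 'a set" where
  "vectors_of U = {x \<in> \<Union>U. x \<bullet> x = 3}"

lemma norm3_span:
  fixes x y :: "'a::euclidean_space"
  assumes "x \<bullet> x = 3" "y \<bullet> y = 3" "y \<in> span {x}"
  shows "y = x \<or> y = - x"
proof -
  obtain k where k: "y = k *\<^sub>R x" using assms(3) by (auto simp: span_singleton)
  then have "k * k = 1" using assms(1,2) by simp
  then have "k = 1 \<or> k = -1" by (simp add: square_eq_1_iff)
  then show ?thesis using k by auto
qed

lemma line_norm3:
  assumes "is_line L"
  obtains x where "x \<in> L" "x \<bullet> x = 3" "L = span {x}"
proof -
  have L: "subspace L" "dim L = 1" using assms by (auto simp: is_line_def)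
  obtain B where B: "B \<subseteq> L" "independent B" "L \<subseteq> span B" "card B = dim L" using basis_exists by blast
  obtain b where b: "B = {b}" using B(4) L(2) by (metis card_1_singletonE)
  have b0: "b \<noteq> 0" using B(2) b dependent_zero by blast
  define c where "c = sqrt 3 / norm b"
  have c0: "c \<noteq> 0" using b0 by (simp add: c_def)
  have Lb: "L = span {b}" using B L(1) b span_minimal[of B L] by blast
  have "(c *\<^sub>R b) \<bullet> (c *\<^sub>R b) = (norm (c *\<^sub>R b))\<^sup>2" by (rule dot_square_norm)
  also have "\<dots> = 3" using b0 by (simp add: c_def)
  finally have n: "(c *\<^sub>R b) \<bullet> (c *\<^sub>R b) = 3" .
  have "span {c *\<^sub>R b} = span {b}"
    using span_image_scale[of "{b}" "\<lambda>_. c"] c0 by simp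
  moreover have "c *\<^sub>R b \<in> L" unfolding Lb by (simp add: span_base span_scale)
  ultimately show thesis using that[of "c *\<^sub>R b"] n Lb by simp
qed

lemma is_line_span:
  fixes x :: "'a::euclidean_space"
  assumes "x \<noteq> 0"
  shows "is_line (span {x})"
  using assms by (simp add: is_line_def dim_span dim_singleton)

lemma angle_third_iff:
  fixes x y :: "'a::euclidean_space"
  assumes "x \<bullet> x = 3" "y \<bullet> y = 3"
  shows "arccos (\<bar>x \<bullet> y\<bar> / (norm x * norm y)) = arccos (1/3) \<longleftrightarrow> \<bar>x \<bullet> y\<bar> = 1"
proof -
  have n: "norm x * norm y = 3" using assms by (simp add: norm_eq_sqrt_inner)
  have "\<bar>x \<bullet> y\<bar> \<le> 3" using norm3_eq(3)[OF assms] .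
  then have "\<bar>\<bar>x \<bullet> y\<bar> / 3\<bar> \<le> 1" by simp
  then show ?thesis unfolding n by (subst arccos_eq_iff) auto
qed

lemma line_system_vectors_of:
  assumes U: "equiangular (arccos (1/3)) U"
  shows "line_system (vectors_of U)" "lines_of (vectors_of U) = U"
proof -
  have line: "is_line L" if "L \<in> U" for L using U that by (auto simp: equiangular_def)
  have L: "L = span {x}" if x: "L \<in> U" "x \<in> L" "x \<bullet> x = 3" for L x
  proof -
    obtain y where y: "y \<in> L" "y \<bullet> y = 3" "L = span {y}" using line_norm3[OF line[OF x(1)]] .
    have "y = x \<or> y = - x" using norm3_span[OF y(2) x(3)] x(2) y(3) by auto
    then show ?thesis using y(3) span_image_scale[of "{x}" "\<lambda>_. -1"] by auto
  qed
  show "line_system (vectors_of U)"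
    unfolding line_system_def
  proof (intro ballI conjI)
    fix x assume "x \<in> vectors_of U"
    then obtain M where M: "M \<in> U" "x \<in> M" "x \<bullet> x = 3" by (auto simp: vectors_of_def)
    then show "x \<bullet> x = 3" by simp
    have "- x \<in> M" using line[OF M(1)] M(2) subspace_neg by (auto simp: is_line_def)
    then show "- x \<in> vectors_of U" using M by (auto simp: vectors_of_def)
    fix y assume "y \<in> vectors_of U"
    then obtain N where N: "N \<in> U" "y \<in> N" "y \<bullet> y = 3" by (auto simp: vectors_of_def)
    show "x \<bullet> y \<in> {1, -1, 3, -3}"
    proof (cases "M = N")
      case True
      then have "y = x \<or> y = - x" using norm3_span[OF M(3) N(3)] L[OF M] N(2) by blast
      then show ?thesis using M(3) by auto
    next
      case False
      then have "lines_form_angle (arccos (1/3)) M N"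
        using U M(1) N(1) by (auto simp: equiangular_def pairwise_def)
      then have "arccos (\<bar>x \<bullet> y\<bar> / (norm x * norm y)) = arccos (1/3)"
        using M N unfolding lines_form_angle_def by force
      then have "\<bar>x \<bullet> y\<bar> = 1" using angle_third_iff[OF M(3) N(3)] by blast
      then show ?thesis by auto
    qed
  qed
  show "lines_of (vectors_of U) = U"
  proof
    show "lines_of (vectors_of U) \<subseteq> U" using L by (auto simp: lines_of_def vectors_of_def)
    show "U \<subseteq> lines_of (vectors_of U)"
    proof
      fix M assume M: "M \<in> U"
      obtain y where y: "y \<in> M" "y \<bullet> y = 3" "M = span {y}" using line_norm3[OF line[OF M]] .
      then show "M \<in> lines_of (vectors_of U)" using M by (auto simp: lines_of_def vectors_of_def)
    qed
  qed
qed

lemma equiangular_lines_of: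
  fixes V :: "'a::euclidean_space set"
  assumes V: "line_system V"
  shows "equiangular (arccos (1/3)) (lines_of V)" "vectors_of (lines_of V) = V"
proof -
  note l = line_systemD[OF V]
  have sm: "span {- v} = span {v}" for v :: 'a using span_image_scale[of "{v}" "\<lambda>_. -1"] by simp
  have n0: "v \<noteq> 0" if "v \<in> V" for v using l(2)[OF that] by auto
  have "lines_form_angle (arccos (1/3)) (span {v}) (span {w})" if vw: "v \<in> V" "w \<in> V" "span {v} \<noteq> span {w}" for v w
    unfolding lines_form_angle_def
  proof (intro ballI)
    fix x y assume x: "x \<in> span {v} - {0}" and y: "y \<in> span {w} - {0}"
    obtain h where h: "x = h *\<^sub>R v" "h \<noteq> 0" using x by (auto simp: span_singleton)
    obtain k where k: "y = k *\<^sub>R w" "k \<noteq> 0" using y by (auto simp: span_singleton)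
    have "v \<noteq> w" "v \<noteq> - w" using vw(3) sm by auto
    then have "\<bar>v \<bullet> w\<bar> = 1" using l(3)[OF vw(1,2)] norm3_eq[OF l(2)[OF vw(1)] l(2)[OF vw(2)]] by auto
    then have "arccos (\<bar>v \<bullet> w\<bar> / (norm v * norm w)) = arccos (1/3)" using angle_third_iff l(2) vw by blast
    moreover have "\<bar>x \<bullet> y\<bar> / (norm x * norm y) = \<bar>v \<bullet> w\<bar> / (norm v * norm w)"
      using h k by (simp add: abs_mult)
    ultimately show "arccos (\<bar>x \<bullet> y\<bar> / (norm x * norm y)) = arccos (1/3)" by simp
  qed
  moreover have "is_line (span {v})" if "v \<in> V" for v using is_line_span[OF n0[OF that]] .
  ultimately show "equiangular (arccos (1/3)) (lines_of V)"
    by (auto simp: equiangular_def lines_of_def pairwise_def)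
  show "vectors_of (lines_of V) = V"
  proof
    show "V \<subseteq> vectors_of (lines_of V)" using l(2) by (auto simp: vectors_of_def lines_of_def intro: span_base)
    show "vectors_of (lines_of V) \<subseteq> V"
    proof
      fix x assume "x \<in> vectors_of (lines_of V)"
      then obtain v where "v \<in> V" "x \<in> span {v}" "x \<bullet> x = 3" by (auto simp: vectors_of_def lines_of_def)
      then show "x \<in> V" using norm3_span[of v x] l(1,2) by auto
    qed
  qed
qed

lemma card_lines_of:
  fixes V :: "'a::euclidean_space set"
  assumes V: "line_system V"
  shows "finite V \<longleftrightarrow> finite (lines_of V)" "finite V \<Longrightarrow> card V = 2 * card (lines_of V)"
proof -
  note l = line_systemD[OF V]
  have sm: "span {- v} = span {v}" for v :: 'a using span_image_scale[of "{v}" "\<lambda>_. -1"] by simp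
  have fib: "{w \<in> V. span {w} = span {v}} = {v, - v}" if v: "v \<in> V" for v
  proof
    show "{w \<in> V. span {w} = span {v}} \<subseteq> {v, - v}"
    proof
      fix w assume w: "w \<in> {w \<in> V. span {w} = span {v}}"
      then have "w \<in> span {v}" using span_base[of w "{w}"] by auto
      then show "w \<in> {v, - v}" using norm3_span[OF l(2)[OF v] l(2)] w by auto
    qed
  qed (use v l(1) sm in auto)
  have V_un: "V = (\<Union>L\<in>lines_of V. {w \<in> V. span {w} = L})" by (auto simp: lines_of_def)
  have ff: "finite {w \<in> V. span {w} = L}" if "L \<in> lines_of V" for L
    using that fib by (auto simp: lines_of_def)
  show "finite V \<longleftrightarrow> finite (lines_of V)"
  proof
    assume "finite (lines_of V)"
    then have "finite (\<Union>L\<in>lines_of V. {w \<in> V. span {w} = L})" using ff by blast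
    then show "finite V" using V_un by simp
  qed (simp add: lines_of_def)
  assume fin: "finite V"
  have c2: "card {w \<in> V. span {w} = L} = 2" if L: "L \<in> lines_of V" for L
  proof -
    obtain v where v: "v \<in> V" "L = span {v}" using L by (auto simp: lines_of_def)
    have "v \<noteq> - v"
    proof
      assume "v = - v"
      then have "v \<bullet> v = - (v \<bullet> v)" by (metis inner_minus_left)
      then show False using l(2)[OF v(1)] by simp
    qed
    then show ?thesis using fib[OF v(1)] v(2) by simp
  qed
  have "card V = (\<Sum>v\<in>V. 1)" by simp
  also have "\<dots> = (\<Sum>L\<in>lines_of V. \<Sum>w\<in>{w \<in> V. span {w} = L}. 1)"
    unfolding lines_of_def by (rule sum.image_gen[OF fin])
  also have "\<dots> = (\<Sum>L\<in>lines_of V. 2)" using c2 by (intro sum.cong) auto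
  finally show "card V = 2 * card (lines_of V)" by simp
qed

lemma lines_of_image:
  assumes "orthogonal_transformation f"
  shows "lines_of (f ` V) = (\<lambda>L. f ` L) ` lines_of V"
proof -
  have "span {f v} = f ` span {v}" for v
    using linear_span_image[OF orthogonal_transformation_linear[OF assms], of "{v}"] by simp
  then show ?thesis by (simp add: lines_of_def image_image)
qed

text \<open>
  An equivalence of sets of lines is defined only on the span; it preserves inner products of the chosen
  vectors, so \<open>gram_extension\<close> replaces it by an orthogonal map of the whole space.
\<close>

lemma lines_equivalent_iff:
  fixes V W :: "'a::euclidean_space set"
  assumes V: "line_system V" "finite V" and W: "line_system W"
  shows "lines_equivalent (lines_of V) (lines_of W) \<longleftrightarrow> (\<exists>f. orthogonal_transformation f \<and> f ` V = W)"
proof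
  assume "\<exists>f. orthogonal_transformation f \<and> f ` V = W"
  then obtain f where f: "orthogonal_transformation f" "f ` V = W" by blast
  note l = orthogonal_transformation_linear[OF f(1)]
  have im: "(\<lambda>L. f ` L) ` lines_of V = lines_of W" using lines_of_image[OF f(1)] f(2) by metis
  have "f ` span (\<Union>(lines_of V)) = span (\<Union>(lines_of W))"
    using linear_span_image[OF l, of "\<Union>(lines_of V)"] unfolding im[symmetric] image_Union by simp
  then have "f \<in> span (\<Union>(lines_of V)) \<rightarrow> span (\<Union>(lines_of W))" by blast
  then show "lines_equivalent (lines_of V) (lines_of W)"
    unfolding lines_equivalent_def using im linear_add[OF l] linear_scale[OF l] orthogonal_transformation_inner[OF f(1)]
    by (intro exI[of _ f]) simp
next
  assume "lines_equivalent (lines_of V) (lines_of W)"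
  then obtain f where F: "\<forall>c. \<forall>x\<in>span (\<Union>(lines_of V)). f (c *\<^sub>R x) = c *\<^sub>R f x"
      "\<forall>x\<in>span (\<Union>(lines_of V)). \<forall>y\<in>span (\<Union>(lines_of V)). f x \<bullet> f y = x \<bullet> y"
    and im: "(\<lambda>L. f ` L) ` lines_of V = lines_of W"
    unfolding lines_equivalent_def by (elim exE conjE) (rule that)
  have sc: "f (c *\<^sub>R x) = c *\<^sub>R f x" if "x \<in> span (\<Union>(lines_of V))" for c x
    using F(1) that by simp
  have ip: "f x \<bullet> f y = x \<bullet> y" if "x \<in> span (\<Union>(lines_of V))" "y \<in> span (\<Union>(lines_of V))" for x y
    using F(2) that by simp
  note lV = line_systemD[OF V(1)] and lW = line_systemD[OF W]
  have sp: "v \<in> span (\<Union>(lines_of V))" if "v \<in> V" for v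
    using that by (intro span_base) (auto simp: lines_of_def intro: span_base)
  have fm: "f (- v) = - f v" if "v \<in> V" for v using sc[OF sp[OF that], of "-1"] by simp
  have "f ` V \<subseteq> W"
  proof
    fix y assume "y \<in> f ` V"
    then obtain v where v: "v \<in> V" "y = f v" by blast
    have "f ` span {v} \<in> (\<lambda>L. f ` L) ` lines_of V" using v(1) by (intro imageI) (simp add: lines_of_def)
    then have "f ` span {v} \<in> lines_of W" unfolding im .
    then obtain w where w: "w \<in> W" "f ` span {v} = span {w}" by (auto simp: lines_of_def)
    have "y \<in> span {w}" using w(2) v(2) span_base[of v "{v}"] by blast
    moreover have "y \<bullet> y = 3" using ip[OF sp sp] v lV(2) by simp
    ultimately have "y = w \<or> y = - w" using norm3_span[OF lW(2)[OF w(1)]] by blast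
    then show "y \<in> W" using w(1) lW(1) by blast
  qed
  moreover have "W \<subseteq> f ` V"
  proof
    fix w assume w: "w \<in> W"
    then have "span {w} \<in> (\<lambda>L. f ` L) ` lines_of V" unfolding im by (auto simp: lines_of_def)
    then obtain v where v: "v \<in> V" "span {w} = f ` span {v}" by (auto simp: lines_of_def)
    have "w \<in> f ` span {v}" using v(2) span_base[of w "{w}"] by blast
    then obtain k where "w = f (k *\<^sub>R v)" by (auto simp: span_singleton)
    then have k: "w = k *\<^sub>R f v" using sc[OF sp[OF v(1)]] by simp
    have "f v \<bullet> f v = 3" using ip[OF sp sp] v lV(2) by simp
    moreover have "w \<in> span {f v}" using k by (auto simp: span_singleton)
    ultimately have "w = f v \<or> w = - f v" using norm3_span[of "f v" w] lW(2)[OF w] by blast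
    then show "w \<in> f ` V" using fm[OF v(1)] v(1) lV(1)[OF v(1)] by (metis imageI)
  qed
  ultimately have fV: "f ` V = W" by blast
  obtain h where h: "orthogonal_transformation h" "\<And>v. v \<in> V \<Longrightarrow> h v = f v"
    using gram_extension[of V "\<lambda>v. v" f] V(2) ip sp by auto
  have "h ` V = W" using fV h(2) by auto
  with h(1) show "\<exists>f. orthogonal_transformation f \<and> f ` V = W" by blast
qed

lemma card_image_eq_kernel:
  assumes "\<And>p q. p \<in> P \<Longrightarrow> q \<in> P \<Longrightarrow> \<phi> p = \<phi> q \<longleftrightarrow> \<psi> p = \<psi> q"
  shows "card (\<phi> ` P) = card (\<psi> ` P)"
proof -
  have "bij_betw (\<lambda>c. \<psi> (inv_into P \<phi> c)) (\<phi> ` P) (\<psi> ` P)"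
    unfolding bij_betw_def
  proof
    have i: "inv_into P \<phi> (\<phi> p) \<in> P" "\<phi> (inv_into P \<phi> (\<phi> p)) = \<phi> p" if "p \<in> P" for p
      using that by (auto intro: inv_into_into f_inv_into_f)
    have r: "\<psi> (inv_into P \<phi> (\<phi> p)) = \<psi> p" if "p \<in> P" for p using assms[OF i(1)[OF that] that] i(2)[OF that] by blast
    show "inj_on (\<lambda>c. \<psi> (inv_into P \<phi> c)) (\<phi> ` P)"
      by (rule inj_onI) (use r assms in auto)
    show "(\<lambda>c. \<psi> (inv_into P \<phi> c)) ` \<phi> ` P = \<psi> ` P" using r by (auto simp: image_image)
  qed
  then show ?thesis by (rule bij_betw_same_card)
qed

lemma card_quotient_transfer:
  assumes R: "equiv X R" and S: "equiv P S" and f: "\<And>p. p \<in> P \<Longrightarrow> f p \<in> X"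
    and rel: "\<And>p q. p \<in> P \<Longrightarrow> q \<in> P \<Longrightarrow> (f p, f q) \<in> R \<longleftrightarrow> (p, q) \<in> S"
    and surj: "\<And>x. x \<in> X \<Longrightarrow> \<exists>p\<in>P. (x, f p) \<in> R"
  shows "card (X // R) = card (P // S)"
proof -
  have "X // R = (\<lambda>p. R `` {f p}) ` P"
  proof
    show "X // R \<subseteq> (\<lambda>p. R `` {f p}) ` P"
    proof
      fix c assume "c \<in> X // R"
      then obtain x where x: "x \<in> X" "c = R `` {x}" by (auto elim: quotientE)
      obtain p where "p \<in> P" "(x, f p) \<in> R" using surj[OF x(1)] by blast
      then show "c \<in> (\<lambda>p. R `` {f p}) ` P" using equiv_class_eq[OF R] x(2) by blast
    qed
    show "(\<lambda>p. R `` {f p}) ` P \<subseteq> X // R" using f by (auto intro: quotientI)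
  qed
  moreover have "P // S = (\<lambda>p. S `` {p}) ` P" by (auto simp: quotient_def)
  moreover have "R `` {f p} = R `` {f q} \<longleftrightarrow> S `` {p} = S `` {q}" if "p \<in> P" "q \<in> P" for p q
    using eq_equiv_class_iff[OF R f[OF that(1)] f[OF that(2)]] eq_equiv_class_iff[OF S that] rel[OF that] by blast
  ultimately show ?thesis using card_image_eq_kernel[of P "\<lambda>p. R `` {f p}" "\<lambda>p. S `` {p}"] by simp
qed

definition subsystems :: "nat \<Rightarrow> (real ^ 7) set set" where
  "subsystems n = {V. V \<subseteq> K56 \<and> (\<forall>v\<in>V. - v \<in> V) \<and> card V = 2 * n}"

definition related_by :: "nat \<Rightarrow> (real ^ 7 \<Rightarrow> real ^ 7) set \<Rightarrow> ((real ^ 7) set \<times> (real ^ 7) set) set" where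
  "related_by n G = {(V, W). V \<in> subsystems n \<and> W \<in> subsystems n \<and> (\<exists>f\<in>G. f ` V = W)}"

lemma equiv_related_by:
  assumes "(\<lambda>x. x) \<in> G" "\<And>f g. f \<in> G \<Longrightarrow> g \<in> G \<Longrightarrow> (\<lambda>x. f (g x)) \<in> G"
    and inv: "\<And>f. f \<in> G \<Longrightarrow> \<exists>g\<in>G. \<forall>x. g (f x) = x"
  shows "equiv (subsystems n) (related_by n G)"
proof (rule equivI)
  show "related_by n G \<subseteq> subsystems n \<times> subsystems n" by (auto simp: related_by_def)
  show "refl_on (subsystems n) (related_by n G)"
    using assms(1) by (auto simp: refl_on_def related_by_def intro!: bexI[of _ "\<lambda>x. x"])
  show "sym (related_by n G)"
  proof (rule symI)
    fix V W assume "(V, W) \<in> related_by n G"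
    then obtain f where f: "V \<in> subsystems n" "W \<in> subsystems n" "f \<in> G" "f ` V = W" by (auto simp: related_by_def)
    obtain g where g: "g \<in> G" "\<forall>x. g (f x) = x" using inv[OF f(3)] by blast
    have "g ` W = V" unfolding f(4)[symmetric] using g(2) by (simp add: image_image)
    then show "(W, V) \<in> related_by n G" using f g(1) by (auto simp: related_by_def)
  qed
  show "trans (related_by n G)"
  proof (rule transI)
    fix V W Z assume "(V, W) \<in> related_by n G" "(W, Z) \<in> related_by n G"
    then obtain f g where f: "V \<in> subsystems n" "Z \<in> subsystems n" "f \<in> G" "g \<in> G" "g ` f ` V = Z"
      by (auto simp: related_by_def)
    have "(\<lambda>x. g (f x)) ` V = Z" using f(5) by (simp add: image_image)
    then show "(V, Z) \<in> related_by n G" using f assms(2)[OF f(4,3)] by (auto simp: related_by_def)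
  qed
qed

abbreviation "isometric n \<equiv> related_by n {f. orthogonal_transformation f}"
abbreviation "conjugate n \<equiv> related_by n sym56"

lemma equiv_isometric: "equiv (subsystems n) (isometric n)"
proof (rule equiv_related_by)
  show "\<exists>g\<in>{f. orthogonal_transformation f}. \<forall>x. g (f x) = x" if "f \<in> {f. orthogonal_transformation f}" for f :: "real ^ 7 \<Rightarrow> real ^ 7"
  proof -
    have f: "orthogonal_transformation f" using that by simp
    then have "orthogonal_transformation (inv f)" by (rule orthogonal_transformation_inv)
    moreover have "\<forall>x. inv f (f x) = x" using orthogonal_transformation_inj[OF f] by simp
    ultimately show ?thesis by blast
  qed
qed (auto intro: orthogonal_transformation_comp)

lemma equiv_conjugate: "equiv (subsystems n) (conjugate n)"
proof (rule equiv_related_by)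
  show "(\<lambda>x. x) \<in> sym56" by (rule sym56_id)
  show "(\<lambda>x. f (g x)) \<in> sym56" if "f \<in> sym56" "g \<in> sym56" for f g using that by (rule sym56_comp)
  fix f assume "f \<in> sym56"
  then obtain g where "g \<in> sym56" "\<And>x. g (f x) = x" using sym56_inv by metis
  then show "\<exists>g\<in>sym56. \<forall>x. g (f x) = x" by auto
qed

lemma subsystemsD:
  assumes "V \<in> subsystems n"
  shows "V \<subseteq> K56" "finite V" "line_system V" "card V = 2 * n" "v \<in> V \<Longrightarrow> - v \<in> V"
proof -
  show 1: "V \<subseteq> K56" "card V = 2 * n" "v \<in> V \<Longrightarrow> - v \<in> V" using assms by (auto simp: subsystems_def)
  show "finite V" using 1(1) finite_K56 by (rule finite_subset)
  show "line_system V" using 1(1) assms line_system_K56 unfolding line_system_def subsystems_def by blast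
qed

lemma omega_eq_isometry_classes: "omega n = card (subsystems n // isometric n)"
proof -
  let ?X = "equiangular_sets n"
  let ?R = "{(U, U'). U \<in> ?X \<and> U' \<in> ?X \<and> lines_equivalent U U'}"
  have X: "line_system (vectors_of U)" "finite (vectors_of U)" "lines_of (vectors_of U) = U" "card (vectors_of U) = 2 * n"
    if "U \<in> ?X" for U
  proof -
    have U: "equiangular (arccos (1/3)) U" "finite U" "card U = n" using that by (auto simp: equiangular_sets_def)
    note s = line_system_vectors_of[OF U(1)]
    show "line_system (vectors_of U)" "lines_of (vectors_of U) = U" using s .
    show "finite (vectors_of U)" "card (vectors_of U) = 2 * n"
      using card_lines_of[OF s(1)] U s(2) by auto
  qed
  have R: "(U, U') \<in> ?R \<longleftrightarrow> U \<in> ?X \<and> U' \<in> ?X \<and> (\<exists>f. orthogonal_transformation f \<and> f ` vectors_of U = vectors_of U')" for U U'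
    using lines_equivalent_iff[OF X(1,2) X(1), of U U'] X(3) by auto
  have "equiv ?X ?R"
  proof (rule equivI)
    show "?R \<subseteq> ?X \<times> ?X" by auto
    show "refl_on ?X ?R"
    proof (rule refl_onI)
      fix U assume "U \<in> ?X"
      then show "(U, U) \<in> ?R" unfolding R by (intro conjI exI[of _ "\<lambda>x. x"]) auto
    qed
    show "sym ?R"
    proof (rule symI)
      fix U U' assume "(U, U') \<in> ?R"
      then obtain f where f: "U \<in> ?X" "U' \<in> ?X" "orthogonal_transformation f" "f ` vectors_of U = vectors_of U'" unfolding R by blast
      have "inv f ` vectors_of U' = vectors_of U"
        unfolding f(4)[symmetric] using orthogonal_transformation_inj[OF f(3)] by (simp add: image_image)
      then show "(U', U) \<in> ?R" unfolding R using f orthogonal_transformation_inv[OF f(3)] by blast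
    qed
    show "trans ?R"
    proof (rule transI)
      fix U U' U'' assume 1: "(U, U') \<in> ?R" and 2: "(U', U'') \<in> ?R"
      obtain f where f1: "U \<in> ?X" "orthogonal_transformation f" "f ` vectors_of U = vectors_of U'"
        using 1 unfolding R by blast
      obtain g where g1: "U'' \<in> ?X" "orthogonal_transformation g" "g ` vectors_of U' = vectors_of U''"
        using 2 unfolding R by blast
      note f = f1(1) g1(1) f1(2) g1(2) g1(3)[folded f1(3)]
      have "(\<lambda>x. g (f x)) ` vectors_of U = vectors_of U''" using f(5) by (simp add: image_image)
      then show "(U, U'') \<in> ?R" unfolding R using f orthogonal_transformation_comp[OF f(4,3)] by blast
    qed
  qed
  then have "card (?X // ?R) = card (subsystems n // isometric n)"
  proof (rule card_quotient_transfer[OF _ equiv_isometric, where f = lines_of])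
    show lX: "lines_of V \<in> ?X" if V: "V \<in> subsystems n" for V
      using equiangular_lines_of[OF subsystemsD(3)[OF V]] card_lines_of[OF subsystemsD(3)[OF V]] subsystemsD[OF V]
      by (auto simp: equiangular_sets_def)
    show "(lines_of V, lines_of W) \<in> ?R \<longleftrightarrow> (V, W) \<in> isometric n" if V: "V \<in> subsystems n" and W: "W \<in> subsystems n" for V W
      using lX[OF V] lX[OF W] lines_equivalent_iff[OF subsystemsD(3,2)[OF V] subsystemsD(3)[OF W]] V W
      by (auto simp: related_by_def)
    show "\<exists>V\<in>subsystems n. (U, lines_of V) \<in> ?R" if U: "U \<in> ?X" for U
    proof -
      obtain f where f: "orthogonal_transformation f" "f ` vectors_of U \<subseteq> K56" using embed_line_system[OF X(1)[OF U]] by blast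
      have "card (f ` vectors_of U) = 2 * n"
        using X(4)[OF U] card_image[of f "vectors_of U"] orthogonal_transformation_inj[OF f(1)] by (simp add: inj_on_subset)
      moreover have "- v \<in> f ` vectors_of U" if "v \<in> f ` vectors_of U" for v
        using line_system_image[OF f(1) X(1)[OF U]] that by (rule line_systemD(1))
      ultimately have V: "f ` vectors_of U \<in> subsystems n" using f(2) by (auto simp: subsystems_def)
      have "lines_equivalent (lines_of (vectors_of U)) (lines_of (f ` vectors_of U))"
        using lines_equivalent_iff[OF X(1,2)[OF U] subsystemsD(3)[OF V]] f(1) by blast
      then show ?thesis using U V lX[OF V] X(3)[OF U] by auto
    qed
  qed
  then show ?thesis by (simp add: omega_def)
qed

lemma isometric_cases:
  assumes "(V, W) \<in> isometric n"
  shows "(V, W) \<in> conjugate n \<or> n = 6 \<and> \<not> has_triad V \<and> extendable V \<noteq> extendable W"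
proof -
  obtain f where f: "V \<in> subsystems n" "W \<in> subsystems n" "orthogonal_transformation f" "f ` V = W"
    using assms by (auto simp: related_by_def)
  show ?thesis
    using isometric_subsets_of_K56[OF subsystemsD(1,5)[OF f(1)] f(3)] f subsystemsD(1)[OF f(2)] subsystemsD(4)[OF f(1)]
    by (auto simp: related_by_def)
qed

lemma conjugate_isometric: "conjugate n \<subseteq> isometric n"
  using sym56D(1) by (auto simp: related_by_def)

lemma omega_eq_orbits:
  assumes "n \<noteq> 6"
  shows "omega n = card (subsystems n // conjugate n)"
proof -
  have "isometric n = conjugate n" 
    by (intro subset_antisym subrelI conjugate_isometric) (use isometric_cases assms in blast)
  then show ?thesis by (simp add: omega_eq_isometry_classes)
qed

text \<open>
  A symmetry of K56 maps V to W if and only if it maps the complement of V to the complement of W.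
\<close>

lemma orbits_complement:
  assumes n: "n \<le> 28"
  shows "card (subsystems n // conjugate n) = card (subsystems (28 - n) // conjugate (28 - n))"
proof -
  have compl: "K56 - V \<in> subsystems (28 - n)" if V: "V \<in> subsystems n" and n: "n \<le> 28" for V n
  proof -
    have "card (K56 - V) = 56 - 2 * n"
      using card_Diff_subset[OF subsystemsD(2,1)[OF V]] subsystemsD(4)[OF V] card_K56 by simp
    moreover have "- v \<in> K56 - V" if "v \<in> K56 - V" for v
      using that K56_minus subsystemsD(5)[OF V, of "- v"] by auto
    ultimately show ?thesis using n by (auto simp: subsystems_def)
  qed
  have double: "K56 - (K56 - V) = V" if "V \<in> subsystems m" for V m using subsystemsD(1)[OF that] by blast
  have im: "f ` (K56 - V) = K56 - f ` V" if "f \<in> sym56" for f V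
    using sym56D(2)[OF that] orthogonal_transformation_inj[OF sym56D(1)[OF that]] by (simp add: image_set_diff)
  have step: "(K56 - V, K56 - W) \<in> conjugate (28 - n)" if "(V, W) \<in> conjugate n" "n \<le> 28" for V W n
    using that compl im by (auto simp: related_by_def)
  have n': "28 - (28 - n) = n" using n by simp
  have "card (subsystems (28 - n) // conjugate (28 - n)) = card (subsystems n // conjugate n)"
  proof (rule card_quotient_transfer[OF equiv_conjugate equiv_conjugate, where f = "\<lambda>V. K56 - V"])
    show "K56 - V \<in> subsystems (28 - n)" if "V \<in> subsystems n" for V using compl[OF that n] .
    show "(K56 - V, K56 - W) \<in> conjugate (28 - n) \<longleftrightarrow> (V, W) \<in> conjugate n" if V: "V \<in> subsystems n" and W: "W \<in> subsystems n" for V W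
      using step[of V W n] step[of "K56 - V" "K56 - W" "28 - n"] n double[OF V] double[OF W] n' by auto
    show "\<exists>V\<in>subsystems n. (W, K56 - V) \<in> conjugate (28 - n)" if W: "W \<in> subsystems (28 - n)" for W
    proof
      show "K56 - W \<in> subsystems n" using compl[OF W] n' by simp
      show "(W, K56 - (K56 - W)) \<in> conjugate (28 - n)"
        using equiv_conjugate W unfolding double[OF W] by (auto simp: equiv_def refl_on_def)
    qed
  qed
  then show ?thesis by simp
qed

lemma finite_subsystems: "finite (subsystems n)"
  by (rule finite_subset[of _ "Pow K56"]) (auto simp: subsystems_def finite_K56)

text \<open>
  The parameter \<sigma> selects e + m or e - m as the last vector, where e = (1, 0, 0, 0, 0, 0, 0) and
  m = (0, 1, 1, 0, 0, 0, 0); the other vectors are of the form e + n.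
\<close>

definition hexad :: "real \<Rightarrow> nat \<Rightarrow> real ^ 7" where
  "hexad \<sigma> i = [vec7 1 1 (-1) 0 0 0 0, vec7 1 0 0 1 1 0 0, vec7 1 0 0 1 (-1) 0 0, vec7 1 0 0 0 0 1 1,
     vec7 1 0 0 0 0 1 (-1), vec7 1 \<sigma> \<sigma> 0 0 0 0] ! i"

lemma hexad:
  assumes s: "\<sigma> = 1 \<or> \<sigma> = -1"
  shows "i < 6 \<Longrightarrow> hexad \<sigma> i \<in> K56" "i < 6 \<Longrightarrow> j < 6 \<Longrightarrow> hexad \<sigma> i \<bullet> hexad \<sigma> j = (if i = j then 3 else 1)"
proof -
  have l: "k = 0 \<or> k = 1 \<or> k = 2 \<or> k = 3 \<or> k = 4 \<or> k = 5" if "k < 6" for k :: nat using that by auto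
  show "hexad \<sigma> i \<in> K56" if "i < 6" using l[OF that] s by (elim disjE) (simp_all add: hexad_def K56_intros)
  show "hexad \<sigma> i \<bullet> hexad \<sigma> j = (if i = j then 3 else 1)" if "i < 6" "j < 6"
    using l[OF that(1)] l[OF that(2)] s by (elim disjE; hypsubst) (simp_all add: hexad_def)
qed

lemma triad_free_hexads:
  obtains V W where "V \<in> subsystems 6" "W \<in> subsystems 6" "\<not> has_triad V" "\<not> has_triad W" "extendable V" "\<not> extendable W"
proof -
  have sub: "signed_set (hexad \<sigma>) 6 \<in> subsystems 6" "\<not> has_triad (signed_set (hexad \<sigma>) 6)" if "\<sigma> = 1 \<or> \<sigma> = -1" for \<sigma>
  proof -
    note p = signed_set_props[of 6 "hexad \<sigma>", OF hexad(2)[OF that]]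
    show "\<not> has_triad (signed_set (hexad \<sigma>) 6)" using p(3) by blast
    have "signed_set (hexad \<sigma>) 6 \<subseteq> K56" using hexad(1)[OF that] K56_minus by (auto simp: signed_set_def)
    then show "signed_set (hexad \<sigma>) 6 \<in> subsystems 6" using p(2,4) by (auto simp: subsystems_def)
  qed
  have ext: "extendable (signed_set (hexad \<sigma>) 6) \<longleftrightarrow> (\<exists>k\<in>K56. \<forall>i<6. k \<bullet> hexad \<sigma> i = 1)" if "\<sigma> = 1 \<or> \<sigma> = -1" for \<sigma>
    using extendable_signed_set[of 6 "hexad \<sigma>", OF hexad(2)[OF that] _ hexad(1)[OF that]] by simp
  have "i < 6 \<longleftrightarrow> i = 0 \<or> i = 1 \<or> i = 2 \<or> i = 3 \<or> i = 4 \<or> i = 5" for i :: nat by presburger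
  then have all6: "(\<forall>i<6. P i) \<longleftrightarrow> P 0 \<and> P 1 \<and> P 2 \<and> P 3 \<and> P 4 \<and> P (5::nat)" for P
    by (simp only: imp_disjL all_conj_distrib simp_thms)
  have "extendable (signed_set (hexad 1) 6)"
    unfolding ext[OF disjI1[OF refl]] all6
    by (intro bexI[of _ "vec7 0 1 0 1 0 1 0"]) (auto simp: hexad_def K56_intros)
  moreover have "\<not> extendable (signed_set (hexad (-1)) 6)"
  proof
    assume "extendable (signed_set (hexad (-1)) 6)"
    then obtain k where k: "k \<in> K56" "\<forall>i<6. k \<bullet> hexad (-1) i = 1" using ext[of "-1"] by blast
    have h: "k \<bullet> vec7 1 1 (-1) 0 0 0 0 = 1" "k \<bullet> vec7 1 0 0 1 1 0 0 = 1" "k \<bullet> vec7 1 0 0 1 (-1) 0 0 = 1"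
      "k \<bullet> vec7 1 0 0 0 0 1 1 = 1" "k \<bullet> vec7 1 0 0 0 0 1 (-1) = 1" "k \<bullet> vec7 1 (-1) (-1) 0 0 0 0 = 1"
      using k(2) unfolding all6 by (simp_all add: hexad_def)
    from k(1) show False
      by (cases rule: K56_cases) (use h in \<open>auto\<close>)
  qed
  ultimately show thesis using that sub by blast
qed

lemma triad_free_isometric:
  assumes V: "V \<in> subsystems n" "\<not> has_triad V" and W: "W \<in> subsystems n" "\<not> has_triad W"
  shows "(V, W) \<in> isometric n"
proof -
  obtain b N where b: "V = signed_set b N" "\<And>i j. i < N \<Longrightarrow> j < N \<Longrightarrow> b i \<bullet> b j = (if i = j then 3 else 1)"
    using triad_free_system[OF subsystemsD(3)[OF V(1)] V(2)] by blast
  obtain c M where c: "W = signed_set c M" "\<And>i j. i < M \<Longrightarrow> j < M \<Longrightarrow> c i \<bullet> c j = (if i = j then 3 else 1)"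
    using triad_free_system[OF subsystemsD(3)[OF W(1)] W(2)] by blast
  have "N = n" using signed_set_props(2)[of N b, OF b(2)] subsystemsD(4)[OF V(1)] b(1) by simp
  moreover have "M = n" using signed_set_props(2)[of M c, OF c(2)] subsystemsD(4)[OF W(1)] c(1) by simp
  ultimately obtain f where "orthogonal_transformation f" "f ` V = W"
    using signed_set_isometric[of n b c] b c by metis
  then show ?thesis using V(1) W(1) by (auto simp: related_by_def)
qed

lemma has_triad_image:
  assumes "orthogonal_transformation f"
  shows "has_triad (f ` V) \<longleftrightarrow> has_triad V"
  unfolding has_triad_def using orthogonal_transformation_inner[OF assms] by auto

text \<open>
  The triad-free systems form one isometry class Z, which splits into the orbits Z1 and Z2 of extendable
  and non-extendable systems. On all other systems the two relations agree.
\<close>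

lemma orbits_6: "card (subsystems 6 // conjugate 6) = omega 6 + 1"
proof -
  let ?P = "subsystems 6" let ?S = "isometric 6" let ?T = "conjugate 6"
  define Z where "Z = {V \<in> ?P. \<not> has_triad V}"
  define A where "A = (\<lambda>V. ?T `` {V}) ` (?P - Z)"
  define Z1 where "Z1 = {V \<in> Z. extendable V}"
  define Z2 where "Z2 = {V \<in> Z. \<not> extendable V}"
  obtain V1 V2 where V1: "V1 \<in> Z1" and V2: "V2 \<in> Z2"
    using triad_free_hexads unfolding Z1_def Z2_def Z_def by blast
  have inv: "W \<in> ?P" "has_triad W \<longleftrightarrow> has_triad V" if "(V, W) \<in> ?S" for V W
    using that has_triad_image by (auto simp: related_by_def)
  have Sself: "(V, V) \<in> ?T" if "V \<in> ?P" for V using equiv_conjugate that by (auto simp: equiv_def refl_on_def)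
  have T_ext: "extendable W \<longleftrightarrow> extendable V" if "(V, W) \<in> ?T" for V W
    using that extendable_sym56 by (auto simp: related_by_def)
  have SZ: "?S `` {V} = Z" if "V \<in> Z" for V
    using that inv triad_free_isometric unfolding Z_def by blast
  have SQ: "?S `` {V} = ?T `` {V}" if "V \<in> ?P - Z" for V
    using that isometric_cases conjugate_isometric unfolding Z_def by blast
  have TZ: "?T `` {V} = (if extendable V then Z1 else Z2)" if V: "V \<in> Z" for V
  proof -
    have "(V, W) \<in> ?T \<longleftrightarrow> W \<in> Z \<and> (extendable W \<longleftrightarrow> extendable V)" for W
    proof
      assume T: "(V, W) \<in> ?T"
      then have "(V, W) \<in> ?S" using conjugate_isometric by blast
      then show "W \<in> Z \<and> (extendable W \<longleftrightarrow> extendable V)" using inv T_ext[OF T] V unfolding Z_def by blast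
    next
      assume W: "W \<in> Z \<and> (extendable W \<longleftrightarrow> extendable V)"
      then have "(V, W) \<in> ?S" using SZ[OF V] by blast
      then show "(V, W) \<in> ?T" using isometric_cases W by blast
    qed
    then show ?thesis unfolding Z1_def Z2_def by auto
  qed
  have P: "?P = (?P - Z) \<union> Z" by (auto simp: Z_def)
  have "?P // ?S = (\<lambda>V. ?S `` {V}) ` ((?P - Z) \<union> Z)" using P by (auto simp: quotient_def)
  also have "\<dots> = A \<union> {Z}" unfolding image_Un A_def using SQ SZ V1 by (auto simp: Z1_def)
  finally have S: "?P // ?S = A \<union> {Z}" .
  have "?P // ?T = (\<lambda>V. ?T `` {V}) ` ((?P - Z) \<union> Z)" using P by (auto simp: quotient_def)
  also have "\<dots> = A \<union> {Z1, Z2}"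
  proof -
    have "(\<lambda>V. ?T `` {V}) ` Z = {Z1, Z2}"
    proof
      show "{Z1, Z2} \<subseteq> (\<lambda>V. ?T `` {V}) ` Z"
        using TZ[of V1] TZ[of V2] V1 V2 by (auto simp: Z1_def Z2_def intro!: image_eqI)
    qed (use TZ in auto)
    then show ?thesis unfolding image_Un A_def by simp
  qed
  finally have T: "?P // ?T = A \<union> {Z1, Z2}" .
  have fin: "finite A" unfolding A_def using finite_subsystems by simp
  have "\<not> C \<subseteq> Z" if "C \<in> A" for C using that Sself unfolding A_def by blast
  then have "Z \<notin> A" "Z1 \<notin> A" "Z2 \<notin> A" unfolding Z1_def Z2_def by blast+
  moreover have "Z1 \<noteq> Z2" using V1 V2 unfolding Z1_def Z2_def by blast
  ultimately show ?thesis
    unfolding omega_eq_isometry_classes S T using fin by simp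
qed

theorem corollary1p2:
  shows "(\<forall>n\<in>{0..28} - {6, 22}. omega n = omega (28 - n)) \<and> omega 6 + 1 = omega 22"
proof (intro conjI ballI)
  fix n :: nat assume n: "n \<in> {0..28} - {6, 22}"
  then have "n \<noteq> 6" "28 - n \<noteq> 6" "n \<le> 28" by auto
  then show "omega n = omega (28 - n)" 
    using omega_eq_orbits[of n] omega_eq_orbits[of "28 - n"] orbits_complement[of n] by simp
next
  show "omega 6 + 1 = omega 22" using orbits_6 orbits_complement[of 6] omega_eq_orbits[of 22] by simp
qed

end
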